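(* Let $a: [0,1] \to \mathbb{R}$ be a continuous function with $a(1)<0$ for which there exist an integer $m\ge 1$ and points $$0 = \tau_{0} < \sigma_{1} < \tau_{1} < \ldots < \sigma_{i} < \tau_{i} < \ldots < \sigma_{m} < \tau_{m} < \sigma_{m+1} = 1$$ such that - $a(r)\geq 0$ on $[\sigma_{i},\tau_{i}]$ and $a\not\equiv0$ on $[\sigma_{i},\tau_{i}]$, for $i=1,\ldots,m$; - $a(r)\leq 0$ on $[\tau_{i},\sigma_{i+1}]$ and $a\not\equiv0$ on $[\tau_{i},\sigma_{i+1}]$, for $i=0,\ldots,m$. Let $g: \mathbb{R}^+ \to \mathbb{R}$ be a locally Lipschitz continuous function such that, with $G(u):=\int_0^u g(\xi)\,d\xi$: - $g(0)=0$ and $g(u)>0$ for every $u>0$; - $\lim_{u \to 0^+} g(u)/u = 0$; - $\lim_{u \to +\infty} g(u)/u = +\infty$; - $\displaystyle\int_1^{+\infty}\frac{d\xi}{\sqrt{G(\xi)}} <+\infty$ and $\displaystyle\lim_{u \to +\infty} \int_u^{+\infty}\frac{d\xi}{\sqrt{G(\xi)-G(u)}} = 0$. Then there exists $\mu^* > 0$ such that for any $\mu > \mu^*$ the problem $$ \begin{cases} \Delta u + \bigl(a^+(|x|)-\mu a^-(|x|)\bigr) g(u) = 0, & x \in B,\\ u(x) \to +\infty, & x \to \partial B, \end{cases} $$ has at least $2^m$ distinct positive radial solutions.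
   Context: $\mathbb{R}^+=[0,+\infty)$; $N$ is a positive integer and $B := \{ x \in \mathbb{R}^N : |x| < 1\}$ is the unit ball. $a^+=\max(a,0)$ and $a^-=\max(-a,0)$ are the positive and negative parts of $a$. A radial solution is a classical one, i.e. $u(x)=u(r)$ with $r=|x|$, where $u$ solves $(r^{N-1}u')' + r^{N-1}(a^+(r)-\mu a^-(r))g(u) = 0$ for $0<r<1$, with $u'(0)=0$ and $\lim_{r\to 1^-}u(r)=+\infty$. Positive means $u>0$ in $B$. *)

theory Defs
  imports "HOL-Analysis.Analysis"
begin

definition weight :: "(real \<Rightarrow> real) \<Rightarrow> real \<Rightarrow> real \<Rightarrow> real" where
  "weight a \<mu> r = max (a r) 0 - \<mu> * max (- a r) 0"

(* local_lipschitz takes a family of maps; the parameter is a dummy here. *)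
definition locally_lipschitz_on :: "real set \<Rightarrow> (real \<Rightarrow> real) \<Rightarrow> bool" where
  "locally_lipschitz_on X g \<longleftrightarrow> local_lipschitz (UNIV :: real set) X (\<lambda>_. g)"

definition primitive :: "(real \<Rightarrow> real) \<Rightarrow> real \<Rightarrow> real" where
  "primitive g u = integral {0..u} g"

definition partial_deriv :: "'n \<Rightarrow> (real ^ 'n \<Rightarrow> real) \<Rightarrow> real ^ 'n \<Rightarrow> real" where
  "partial_deriv i U x = deriv (\<lambda>t. U (x + t *\<^sub>R axis i 1)) 0"

definition laplacian :: "(real ^ 'n \<Rightarrow> real) \<Rightarrow> real ^ 'n \<Rightarrow> real" where
  "laplacian U x = (\<Sum>i\<in>UNIV. partial_deriv i (partial_deriv i U) x)"

(* D is the gradient and H the Hessian matrix of U; S is meant to be open. *)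
definition C2_on :: "(real ^ 'n) set \<Rightarrow> (real ^ 'n \<Rightarrow> real) \<Rightarrow> bool" where
  "C2_on S U \<longleftrightarrow>
    (\<exists>(D :: real ^ 'n \<Rightarrow> real ^ 'n) (H :: real ^ 'n \<Rightarrow> real ^ 'n ^ 'n).
      (\<forall>x\<in>S. (U has_derivative (\<lambda>h. D x \<bullet> h)) (at x)) \<and>
      (\<forall>x\<in>S. (D has_derivative (\<lambda>h. H x *v h)) (at x)) \<and>
      continuous_on S H)"

(* Classical solutions of the boundary blow-up problem
     Laplace U + w(|x|) g(U) = 0 in B,   U(x) -> +infinity as x -> boundary of B.
   Only the values of U on B matter. *)
definition large_solution ::
  "(real \<Rightarrow> real) \<Rightarrow> (real \<Rightarrow> real) \<Rightarrow> (real ^ 'n \<Rightarrow> real) \<Rightarrow> bool" where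
  "large_solution w g U \<longleftrightarrow>
    C2_on (ball 0 1) U \<and>
    (\<forall>x\<in>ball 0 1. laplacian U x + w (norm x) * g (U x) = 0) \<and>
    (\<forall>z\<in>frontier (ball 0 1). filterlim U at_top (at z within ball 0 1))"

(* The radial form of the same problem in dimension N,
     (r^(N-1) u')' + r^(N-1) w(r) g(u) = 0 on (0,1),   u'(0) = 0,   u(1-) = +infinity,
   for a function u on [0,1); v is the derivative u', one-sided at 0. *)
definition radial_profile ::
  "nat \<Rightarrow> (real \<Rightarrow> real) \<Rightarrow> (real \<Rightarrow> real) \<Rightarrow> (real \<Rightarrow> real) \<Rightarrow> bool" where
  "radial_profile N w g u \<longleftrightarrow>
    (\<exists>v. (\<forall>r\<in>{0..<1}. (u has_real_derivative v r) (at r within {0..<1})) \<and>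
         v 0 = 0 \<and>
         (\<forall>r\<in>{0<..<1}. ((\<lambda>s. s ^ (N - 1) * v s) has_real_derivative
              - (r ^ (N - 1) * w r * g (u r))) (at r))) \<and>
    filterlim u at_top (at_left 1)"

definition positive_radial_large_solution ::
  "(real \<Rightarrow> real) \<Rightarrow> (real \<Rightarrow> real) \<Rightarrow> (real ^ 'n \<Rightarrow> real) \<Rightarrow> bool" where
  "positive_radial_large_solution w g U \<longleftrightarrow>
    large_solution w g U \<and>
    (\<exists>u. radial_profile CARD('n) w g u \<and> (\<forall>x\<in>ball 0 1. U x = u (norm x))) \<and>
    (\<forall>x\<in>ball 0 1. U x > 0)"

end

theory Submission
  imports Defs
begin

text \<open>
  Shooting from the centre: solve the radial equation with \<open>u 0 = d\<close>, \<open>u' 0 = 0\<close> (with \<open>g\<close> extended by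
  0 to negative arguments, so that a solution that reaches 0 stays nonpositive) and follow the
  one-parameter family in \<open>d\<close> through the intervals.  Consider an interval of values \<open>d\<close> whose
  solutions are positive up to \<open>\<sigma> i\<close>, where at one end the solution reaches 0 and at the other it
  blows up.  On the hump \<open>[\<sigma> i, \<tau> i]\<close> superlinearity at infinity forces very large solutions, i.e.
  those near the blow-up end, down to 0.  Counting from the zero end, the last solution that is
  nonincreasing at \<open>\<sigma> i\<close> is at most tiny there if \<open>\<mu>\<close> is large, so beyond it some solution has maximum
  exactly a small constant \<open>\<rho>\<close> on the hump; by superlinearity at 0 it is still of size \<open>\<rho>\<close> and almost flat at \<open>\<tau> i\<close>,
  so for large \<open>\<mu>\<close> it blows up before \<open>\<sigma> (i + 1)\<close>.  So the pattern zero / blow-up / zero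
  appears, and the interval yields two disjoint intervals of the same kind for \<open>\<sigma> (i + 1)\<close>.  After
  \<open>m\<close> humps there are \<open>2 ^ m\<close> of them, and since \<open>a < 0\<close> near 1 the blow-up time at the blow-up end
  of each is exactly 1.
\<close>

section \<open>The initial value problem\<close>

text \<open>The shooting map is not globally defined: a solution may blow up before the next
  interval, so no continuous curve of end values is available. The proof works instead with two
  alternatives, \<open>hits\<close> and the failure of \<open>defined\<close>, and with the openness
  of their complements in the initial value. The condition on the integral of 1 / sqrt (G - G(u))
  enters as a uniform statement: there is one height, depending on a subinterval and on a bound for
  the weight there but not on the solution, above which every solution with nonnegative flux blows
  up inside it. The constants belonging to a hump have to be fixed before \<mu>. This is possible
  because on a hump the weight is \<open>a\<close> itself. In particular the flux of a positive
  solution at the end of a hump is bounded below independently of \<mu>, and this bound is what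
  makes a solution that is flat at the end of the next negative interval small there. The flux y =
  r^(N-1) x' is used instead of x': it is monotone wherever the weight has one sign, and it is
  regular at r = 0.\<close>

lemma increment_ge:
  fixes f f' :: "real \<Rightarrow> real"
  assumes "l \<le> h"
    and "\<And>r. r \<in> {l..h} \<Longrightarrow> (f has_real_derivative f' r) (at r within {l..h})"
    and "\<And>r. r \<in> {l..h} \<Longrightarrow> k \<le> f' r"
  shows "k * (h - l) \<le> f h - f l"
proof (cases "l < h")
  case True
  have "\<exists>x\<in>{l<..<h}. f h - f l = f' x * (h - l)"
    by (rule mvt_simple[OF True, where f' = "\<lambda>x. (*) (f' x)"])
      (use assms(2) in \<open>auto simp: has_field_derivative_def\<close>)
  then obtain x where "x \<in> {l<..<h}" "f h - f l = f' x * (h - l)" by blast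
  with assms(3)[of x] True show ?thesis by (simp add: mult_right_mono)
qed (use assms(1) in auto)

lemma increment_le:
  fixes f f' :: "real \<Rightarrow> real"
  assumes "l \<le> h"
    and "\<And>r. r \<in> {l..h} \<Longrightarrow> (f has_real_derivative f' r) (at r within {l..h})"
    and "\<And>r. r \<in> {l..h} \<Longrightarrow> f' r \<le> k"
  shows "f h - f l \<le> k * (h - l)"
proof -
  have "- k * (h - l) \<le> - f h - - f l"
    by (rule increment_ge[of l h _ "\<lambda>r. - f' r"]) (use assms in \<open>auto intro!: DERIV_minus\<close>)
  then show ?thesis by simp
qed

lemma continuous_on_interval_abs_bound:
  fixes f :: "real \<Rightarrow> real"
  assumes "continuous_on {a..b} f"
  obtains C where "0 \<le> C" "\<And>x. x \<in> {a..b} \<Longrightarrow> \<bar>f x\<bar> \<le> C"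
proof -
  have "bounded (f ` {a..b})"
    by (intro compact_imp_bounded compact_continuous_image assms) simp
  then obtain C where "\<forall>y\<in>f ` {a..b}. norm y \<le> C"
    unfolding bounded_iff by blast
  then have "\<bar>f x\<bar> \<le> max C 0" if "x \<in> {a..b}" for x
    using that by (auto simp: le_max_iff_disj)
  then show ?thesis using that[of "max C 0"] by simp
qed

lemma has_integral_exp_scaled:
  fixes c lam s :: real
  assumes "lam > 0" "0 \<le> s"
  shows "((\<lambda>t. c * exp (lam * t)) has_integral c * (exp (lam * s) - 1) / lam) {0..s}"
proof -
  have "((\<lambda>t. c * exp (lam * t)) has_integral
      (c * exp (lam * s) / lam - c * exp (lam * 0) / lam)) {0..s}"
    by (rule fundamental_theorem_of_calculus)
      (use assms in \<open>auto intro!: derivative_eq_intros simp: has_real_derivative_iff_has_vector_derivative[symmetric]\<close>)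
  then show ?thesis by (simp add: right_diff_distrib diff_divide_distrib)
qed

lemma first_hit:
  fixes f :: "real \<Rightarrow> real"
  assumes ab: "a \<le> b" and f: "continuous_on {a..b} f" and c: "f a < c" "c \<le> f b"
  obtains T where "a < T" "T \<le> b" "f T = c" "\<And>t. a \<le> t \<Longrightarrow> t < T \<Longrightarrow> f t < c"
proof -
  let ?S = "{a..b} \<inter> f -` {c..}"
  define T where "T = Inf ?S"
  have bdd: "bdd_below ?S" by (rule bdd_below_mono[of "{a..b}"]) auto
  have "closed ?S" by (rule continuous_closed_preimage[OF f]) auto
  moreover have "b \<in> ?S" using ab c by auto
  ultimately have T: "T \<in> ?S"
    unfolding T_def by (intro closed_contains_Inf bdd) auto
  have below: "f t < c" if "a \<le> t" "t < T" for t
  proof (rule ccontr)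
    assume "\<not> f t < c"
    then have "t \<in> ?S" using that T by auto
    then have "T \<le> t" unfolding T_def by (rule cInf_lower[OF _ bdd])
    with that show False by simp
  qed
  obtain t where t: "a \<le> t" "t \<le> T" "f t = c"
    using IVT'[of f a c T] T c continuous_on_subset[OF f, of "{a..T}"] by auto
  with below[of t] have "f T = c" by (cases "t = T") auto
  moreover have "a < T" using T c by (cases "a = T") auto
  ultimately show ?thesis using that T below by auto
qed

section \<open>Picard iteration for a globally Lipschitz nonlinearity\<close>

locale radial_ode =
  fixes N :: nat and w h :: "real \<Rightarrow> real" and L W :: real
  assumes w_cont: "continuous_on {0..1} w"
    and w_bound: "\<And>r. r \<in> {0..1} \<Longrightarrow> \<bar>w r\<bar> \<le> W"
    and h_lip: "\<And>x z. \<bar>h x - h z\<bar> \<le> L * \<bar>x - z\<bar>"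
    and L_nonneg: "0 \<le> L"
begin

text \<open>The candidate for r^(N-1) u', obtained by integrating the equation from the centre;
  \<open>picard\<close> integrates the resulting slope. Fixed points of \<open>picard\<close> are
  the solutions with value \<open>d\<close> and slope 0 at the centre.\<close>

definition flux :: "(real \<Rightarrow> real) \<Rightarrow> real \<Rightarrow> real" where
  "flux f r = - integral {0..r} (\<lambda>s. s ^ (N - 1) * w s * h (f s))"

definition picard :: "real \<Rightarrow> (real \<Rightarrow> real) \<Rightarrow> real \<Rightarrow> real" where
  "picard d f r = d + integral {0..r} (\<lambda>s. flux f s / s ^ (N - 1))"

text \<open>Rate of an exponential weight: W L / lam <= 1/2 is the contraction factor, and the added
  1 gives lam >= 1, so that the second integration does not enlarge the bound.\<close>

definition lam :: real where "lam = 2 * (W * L) + 1"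

lemma W_nonneg: "0 \<le> W"
  using w_bound[of 0] by simp

lemma lam_ge_1: "1 \<le> lam"
  using W_nonneg L_nonneg by (simp add: lam_def)

lemma h_cont: "continuous_on S h"
proof -
  have "L-lipschitz_on S h"
    by (rule lipschitz_onI) (use h_lip L_nonneg in \<open>auto simp: dist_real_def\<close>)
  then show ?thesis by (rule lipschitz_on_continuous_on)
qed

lemma hf_cont:
  assumes "b \<le> 1" "continuous_on {0..b} f"
  shows "continuous_on {0..b} (\<lambda>s. w s * h (f s))"
  by (intro continuous_intros continuous_on_compose2[OF h_cont[of UNIV] assms(2)]
      continuous_on_subset[OF w_cont]) (use assms in auto)

lemma integrand_cont:
  assumes "b \<le> 1" "continuous_on {0..b} f"
  shows "continuous_on {0..b} (\<lambda>s. s ^ (N - 1) * w s * h (f s))"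
  using continuous_on_mult[OF continuous_on_power[OF continuous_on_id] hf_cont[OF assms], of "N - 1"]
  by (simp add: mult.assoc)

lemma flux_deriv:
  assumes "b \<le> 1" "continuous_on {0..b} f" "r \<in> {0..b}"
  shows "(flux f has_real_derivative - (r ^ (N - 1) * w r * h (f r))) (at r within {0..b})"
  unfolding flux_def
  by (rule DERIV_minus[OF integral_has_real_derivative[OF integrand_cont[OF assms(1,2)] assms(3)]])

lemma flux_0 [simp]: "flux f 0 = 0"
  by (simp add: flux_def)

text \<open>The factor t^(N-1) <= s^(N-1) and the length s of the interval both contribute, so the
  flux vanishes to order s^N. Dividing by s^(N-1) leaves a factor s, which removes the singularity
  of the equation at 0.\<close>

lemma flux_bound:
  assumes "b \<le> 1" "continuous_on {0..b} f"
  obtains C where "\<And>s. s \<in> {0..b} \<Longrightarrow> \<bar>flux f s\<bar> \<le> C * s * s ^ (N - 1)"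
proof -
  obtain C where C: "\<And>s. s \<in> {0..b} \<Longrightarrow> \<bar>w s * h (f s)\<bar> \<le> C"
    using continuous_on_interval_abs_bound[OF hf_cont[OF assms]] by blast
  have "\<bar>flux f s\<bar> \<le> C * s * s ^ (N - 1)" if s: "s \<in> {0..b}" for s
  proof -
    have "norm (integral {0..s} (\<lambda>t. t ^ (N - 1) * w t * h (f t))) \<le> (s ^ (N - 1) * C) * (s - 0)"
    proof (rule integral_bound)
      show "continuous_on {0..s} (\<lambda>t. t ^ (N - 1) * w t * h (f t))"
        by (rule continuous_on_subset[OF integrand_cont[OF assms]]) (use s in auto)
      fix t assume t: "t \<in> {0..s}"
      have "\<bar>t ^ (N - 1)\<bar> * \<bar>w t * h (f t)\<bar> \<le> s ^ (N - 1) * C"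
        by (rule mult_mono) (use t s C[of t] in \<open>auto intro!: power_mono\<close>)
      then show "norm (t ^ (N - 1) * w t * h (f t)) \<le> s ^ (N - 1) * C"
        by (simp add: abs_mult mult.assoc)
    qed (use s in auto)
    then show ?thesis by (simp add: flux_def mult_ac)
  qed
  then show ?thesis by (rule that)
qed

lemma slope_cont:
  assumes "b \<le> 1" "continuous_on {0..b} f"
  shows "continuous_on {0..b} (\<lambda>s. flux f s / s ^ (N - 1))"
  unfolding continuous_on_def
proof
  fix r assume r: "r \<in> {0..b}"
  have fc: "continuous_on {0..b} (flux f)"
    by (rule DERIV_continuous_on[OF flux_deriv[OF assms]])
  show "((\<lambda>s. flux f s / s ^ (N - 1)) \<longlongrightarrow> flux f r / r ^ (N - 1)) (at r within {0..b})"
  proof (cases "r = 0")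
    case False
    show ?thesis
      by (intro tendsto_intros) (use fc r False in \<open>auto simp: continuous_on_def\<close>)
  next
    \<comment> \<open>The quotient has the value 0 at 0, because \<open>flux f 0 = 0\<close>; the
      bound C s shows that this is also its limit.\<close>
    case True
    obtain C where C: "\<And>s. s \<in> {0..b} \<Longrightarrow> \<bar>flux f s\<bar> \<le> C * s * s ^ (N - 1)"
      using flux_bound[OF assms] by blast
    have "((\<lambda>s. flux f s / s ^ (N - 1)) \<longlongrightarrow> 0) (at 0 within {0..b})"
    proof (rule Lim_null_comparison)
      show "\<forall>\<^sub>F s in at 0 within {0..b}. norm (flux f s / s ^ (N - 1)) \<le> C * s"
        unfolding eventually_at_filter
      proof (rule always_eventually, intro allI impI)
        fix s assume "s \<noteq> 0" "s \<in> {0..b}"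
        then show "norm (flux f s / s ^ (N - 1)) \<le> C * s"
          using C[of s] by (simp add: abs_mult divide_le_eq)
      qed
      have "((\<lambda>s. C * s) \<longlongrightarrow> C * 0) (at 0 within {0..b})"
        by (intro tendsto_intros)
      then show "((\<lambda>s. C * s) \<longlongrightarrow> 0) (at 0 within {0..b})" by simp
    qed
    with True show ?thesis by simp
  qed
qed

lemma picard_deriv:
  assumes "b \<le> 1" "continuous_on {0..b} f" "r \<in> {0..b}"
  shows "(picard d f has_real_derivative flux f r / r ^ (N - 1)) (at r within {0..b})"
proof -
  have "((\<lambda>r. d + integral {0..r} (\<lambda>s. flux f s / s ^ (N - 1))) has_real_derivative
      0 + flux f r / r ^ (N - 1)) (at r within {0..b})"
    by (intro DERIV_add DERIV_const integral_has_real_derivative[OF slope_cont[OF assms(1,2)] assms(3)])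
  then show ?thesis by (simp add: picard_def[abs_def])
qed

lemma picard_cont:
  assumes "b \<le> 1" "continuous_on {0..b} f"
  shows "continuous_on {0..b} (picard d f)"
  by (rule DERIV_continuous_on[OF picard_deriv[OF assms]])

text \<open>Integrating exp (lam t) gains the factor 1 / lam. The power s^(N-1) is kept outside so
  that it cancels when the slope is formed.\<close>

lemma flux_diff:
  assumes b: "b \<le> 1" and f: "continuous_on {0..b} f1" "continuous_on {0..b} f2"
    and K: "\<And>t. t \<in> {0..b} \<Longrightarrow> \<bar>f1 t - f2 t\<bar> \<le> K * exp (lam * t)"
    and s: "s \<in> {0..b}"
  shows "\<bar>flux f1 s - flux f2 s\<bar> \<le> s ^ (N - 1) * (W * L * K / lam * exp (lam * s))"
proof -
  let ?F = "\<lambda>f t. t ^ (N - 1) * w t * h (f t)"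
  have K0: "0 \<le> K" using K[of 0] s by simp
  have sub: "{0..s} \<subseteq> {0..b}" using s by auto
  have int: "?F f1 integrable_on {0..s}" "?F f2 integrable_on {0..s}"
    by (intro integrable_continuous_real continuous_on_subset[OF integrand_cont[OF b] sub] f)+
  have int_exp: "((\<lambda>t. s ^ (N - 1) * (W * L * K) * exp (lam * t)) has_integral
      s ^ (N - 1) * (W * L * K) * (exp (lam * s) - 1) / lam) {0..s}"
    by (rule has_integral_exp_scaled) (use lam_ge_1 s in auto)
  have "norm (integral {0..s} (\<lambda>t. ?F f2 t - ?F f1 t))
      \<le> integral {0..s} (\<lambda>t. s ^ (N - 1) * (W * L * K) * exp (lam * t))"
  proof (rule integral_norm_bound_integral)
    fix t assume t: "t \<in> {0..s}"
    have h: "\<bar>h (f2 t) - h (f1 t)\<bar> \<le> L * (K * exp (lam * t))"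
      using h_lip[of "f2 t" "f1 t"] K[of t] t s L_nonneg
        mult_left_mono[OF K[of t] L_nonneg] by (simp add: abs_minus_commute)
    have wh: "\<bar>w t\<bar> * \<bar>h (f2 t) - h (f1 t)\<bar> \<le> W * (L * (K * exp (lam * t)))"
      by (rule mult_mono) (use h w_bound[of t] t s b W_nonneg in auto)
    have "t ^ (N - 1) * (\<bar>w t\<bar> * \<bar>h (f2 t) - h (f1 t)\<bar>)
        \<le> s ^ (N - 1) * (W * (L * (K * exp (lam * t))))"
      by (rule mult_mono) (use t wh in \<open>auto intro: power_mono\<close>)
    moreover have "norm (?F f2 t - ?F f1 t) = t ^ (N - 1) * (\<bar>w t\<bar> * \<bar>h (f2 t) - h (f1 t)\<bar>)"
      using t by (simp add: abs_mult right_diff_distrib[symmetric] mult.assoc)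
    ultimately show "norm (?F f2 t - ?F f1 t) \<le> s ^ (N - 1) * (W * L * K) * exp (lam * t)"
      by (simp add: mult_ac)
  qed (use int int_exp in \<open>auto intro: integrable_diff\<close>)
  also have "\<dots> = s ^ (N - 1) * (W * L * K) * (exp (lam * s) - 1) / lam"
    using int_exp by (rule integral_unique)
  also have "\<dots> \<le> s ^ (N - 1) * (W * L * K) * exp (lam * s) / lam"
    using s W_nonneg L_nonneg K0 lam_ge_1
    by (intro divide_right_mono mult_left_mono) auto
  finally show ?thesis
    using int by (simp add: flux_def integral_diff mult_ac)
qed

text \<open>The inner integration turns K into at most K/2 by the choice of \<open>lam\<close>, and
  the outer one costs a factor 1 / lam <= 1. Allowing two initial values lets one estimate serve
  both convergence and dependence on the data.\<close>

lemma picard_diff: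
  assumes b: "b \<le> 1" and f: "continuous_on {0..b} f1" "continuous_on {0..b} f2"
    and K: "\<And>t. t \<in> {0..b} \<Longrightarrow> \<bar>f1 t - f2 t\<bar> \<le> K * exp (lam * t)"
    and r: "r \<in> {0..b}"
  shows "\<bar>picard d1 f1 r - picard d2 f2 r\<bar> \<le> \<bar>d1 - d2\<bar> + K / 2 * exp (lam * r)"
proof -
  let ?S = "\<lambda>f s. flux f s / s ^ (N - 1)"
  let ?c = "W * L * K / lam"
  have K0: "0 \<le> K" using K[of 0] r by simp
  have sub: "{0..r} \<subseteq> {0..b}" using r by auto
  have int: "?S f1 integrable_on {0..r}" "?S f2 integrable_on {0..r}"
    by (intro integrable_continuous_real continuous_on_subset[OF slope_cont[OF b] sub] f)+
  have int_exp: "((\<lambda>t. ?c * exp (lam * t)) has_integral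
      ?c * (exp (lam * r) - 1) / lam) {0..r}"
    by (rule has_integral_exp_scaled) (use lam_ge_1 r in auto)
  have c: "?c \<le> K / 2" "0 \<le> ?c"
  proof -
    have "W * L / lam \<le> 1 / 2"
    proof (subst pos_divide_le_eq)
      show "0 < lam" using lam_ge_1 by simp
    qed (simp add: lam_def)
    from mult_right_mono[OF this K0] show "?c \<le> K / 2" by simp
    show "0 \<le> ?c"
      by (intro divide_nonneg_nonneg mult_nonneg_nonneg W_nonneg L_nonneg K0) (use lam_ge_1 in linarith)
  qed
  have "norm (integral {0..r} (\<lambda>s. ?S f1 s - ?S f2 s)) \<le> integral {0..r} (\<lambda>t. ?c * exp (lam * t))"
  proof (rule integral_norm_bound_integral)
    fix s assume s: "s \<in> {0..r}"
    then have *: "\<bar>flux f1 s - flux f2 s\<bar> \<le> s ^ (N - 1) * (?c * exp (lam * s))"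
      using flux_diff[OF b f K, of s] r by simp
    show "norm (?S f1 s - ?S f2 s) \<le> ?c * exp (lam * s)"
    proof (cases "s ^ (N - 1) = 0")
      case True
      then show ?thesis using c(2) by simp
    next
      case False
      moreover have "0 \<le> s ^ (N - 1)" using s by simp
      ultimately have "s ^ (N - 1) > 0" by linarith
      then show ?thesis using *
        by (simp add: diff_divide_distrib[symmetric] abs_divide divide_le_eq mult_ac)
    qed
  qed (use int int_exp in \<open>auto intro: integrable_diff\<close>)
  also have "\<dots> = ?c * (exp (lam * r) - 1) / lam"
    using int_exp by (rule integral_unique)
  also have "\<dots> \<le> ?c * exp (lam * r)"
  proof -
    have "?c * (exp (lam * r) - 1) / lam \<le> ?c * (exp (lam * r) - 1) / 1"
      using lam_ge_1 c(2) r by (intro divide_left_mono mult_nonneg_nonneg) auto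
    also have "\<dots> \<le> ?c * exp (lam * r)"
      using mult_left_mono[OF _ c(2), of "exp (lam * r) - 1" "exp (lam * r)"] by simp
    finally show ?thesis .
  qed
  also have "\<dots> \<le> K / 2 * exp (lam * r)"
    using c(1) by (intro mult_right_mono) auto
  finally have "\<bar>integral {0..r} (?S f1) - integral {0..r} (?S f2)\<bar> \<le> K / 2 * exp (lam * r)"
    using int by (simp add: integral_diff)
  then show ?thesis unfolding picard_def by linarith
qed

text \<open>The weight \<open>exp (- lam r)\<close> turns the Picard operator into a contraction with factor 1/2,
  which replaces Gronwall's inequality.\<close>

lemma picard_dependence:
  assumes b: "0 \<le> b" "b \<le> 1" and f: "continuous_on {0..b} f1" "continuous_on {0..b} f2"
    and fix1: "\<And>r. r \<in> {0..b} \<Longrightarrow> f1 r = picard d1 f1 r"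
    and fix2: "\<And>r. r \<in> {0..b} \<Longrightarrow> f2 r = picard d2 f2 r"
    and r: "r \<in> {0..b}"
  shows "\<bar>f1 r - f2 r\<bar> \<le> 2 * \<bar>d1 - d2\<bar> * exp lam"
proof -
  let ?q = "\<lambda>t. \<bar>f1 t - f2 t\<bar> * exp (- lam * t)"
  \<comment> \<open>At a point t0 where the weighted difference attains its maximum K, the estimate
    reads K exp (lam t0) <= |d1 - d2| + K/2 exp (lam t0), and the last term is absorbed on the
    left.\<close>
  have "continuous_on {0..b} ?q" by (intro continuous_intros f)
  then obtain t0 where t0: "t0 \<in> {0..b}" "\<And>t. t \<in> {0..b} \<Longrightarrow> ?q t \<le> ?q t0"
    using continuous_attains_sup[of "{0..b}" ?q] b by auto
  define K where "K = ?q t0"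
  have conv: "\<bar>f1 t - f2 t\<bar> = ?q t * exp (lam * t)" for t
    by (simp add: mult.assoc mult_exp_exp)
  have K: "\<bar>f1 t - f2 t\<bar> \<le> K * exp (lam * t)" if "t \<in> {0..b}" for t
    using mult_right_mono[OF t0(2)[OF that], of "exp (lam * t)"]
    unfolding conv[of t, symmetric] K_def by simp
  have "\<bar>f1 t0 - f2 t0\<bar> \<le> \<bar>d1 - d2\<bar> + K / 2 * exp (lam * t0)"
    using picard_diff[OF b(2) f K t0(1)] fix1[OF t0(1)] fix2[OF t0(1)] by simp
  then have "K * exp (lam * t0) \<le> \<bar>d1 - d2\<bar> + K / 2 * exp (lam * t0)"
    unfolding K_def conv[of t0, symmetric] by simp
  then have "K * exp (lam * t0) \<le> 2 * \<bar>d1 - d2\<bar>" by simp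
  moreover have "0 \<le> K" by (simp add: K_def)
  moreover have "1 \<le> exp (lam * t0)" using t0(1) lam_ge_1 by simp
  ultimately have K2: "K \<le> 2 * \<bar>d1 - d2\<bar>"
    using mult_left_mono[of 1 "exp (lam * t0)" K] by simp
  have "\<bar>f1 r - f2 r\<bar> \<le> K * exp (lam * r)" by (rule K[OF r])
  also have "\<dots> \<le> 2 * \<bar>d1 - d2\<bar> * exp lam"
    using K2 \<open>0 \<le> K\<close> r b lam_ge_1 by (intro mult_mono) (auto simp: mult_left_le)
  finally show ?thesis .
qed

text \<open>Consecutive iterates differ by at most K / 2^n in the weighted norm, so their
  telescoping series converges uniformly on all of [0,1], without continuation from small
  intervals.\<close>

lemma picard_fixpoint:
  obtains f where "continuous_on {0..1} f" "\<And>r. r \<in> {0..1} \<Longrightarrow> f r = picard d f r"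
proof -
  define it where "it n = (picard d ^^ n) (\<lambda>_. d)" for n
  have it_Suc: "it (Suc n) = picard d (it n)" for n by (simp add: it_def)
  have it_cont: "continuous_on {0..1} (it n)" for n
    by (induction n) (simp_all add: it_def picard_cont)
  have "continuous_on {0..1} (\<lambda>r. it 1 r - it 0 r)"
    by (intro continuous_intros it_cont)
  then obtain K where K: "\<And>r. r \<in> {0..1} \<Longrightarrow> \<bar>it 1 r - it 0 r\<bar> \<le> K"
    using continuous_on_interval_abs_bound by blast
  have K0: "0 \<le> K" using K[of 0] by simp
  have step: "\<bar>it (Suc n) r - it n r\<bar> \<le> K / 2 ^ n * exp (lam * r)" if "r \<in> {0..1}" for n r
    using that
  proof (induction n arbitrary: r)
    case 0
    have "K * 1 \<le> K * exp (lam * r)"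
      using 0 lam_ge_1 K0 by (intro mult_left_mono) auto
    with K[OF 0] show ?case by simp
  next
    case (Suc n)
    have "\<bar>picard d (it (Suc n)) r - picard d (it n) r\<bar> \<le> \<bar>d - d\<bar> + K / 2 ^ n / 2 * exp (lam * r)"
      by (rule picard_diff[OF _ it_cont it_cont Suc.IH Suc.prems]) auto
    then show ?case by (simp add: it_Suc mult.commute)
  qed
  have unif: "uniform_limit {0..1} (\<lambda>n r. \<Sum>i<n. it (Suc i) r - it i r)
      (\<lambda>r. \<Sum>i. it (Suc i) r - it i r) sequentially"
  proof (rule Weierstrass_m_test)
    show "norm (it (Suc n) r - it n r) \<le> K * exp lam * (1 / 2) ^ n" if "r \<in> {0..1}" for n r
    proof -
      have "K / 2 ^ n * exp (lam * r) \<le> K / 2 ^ n * exp lam"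
        using that lam_ge_1 K0 by (intro mult_left_mono) (auto simp: mult_left_le)
      with step[OF that, of n] show ?thesis by (simp add: power_divide)
    qed
    show "summable (\<lambda>n. K * exp lam * (1 / 2) ^ n)"
      by (intro summable_mult summable_geometric) simp
  qed
  define f where "f r = it 0 r + (\<Sum>i. it (Suc i) r - it i r)" for r
  have "uniform_limit {0..1} (\<lambda>n r. it 0 r + (\<Sum>i<n. it (Suc i) r - it i r)) f sequentially"
    unfolding f_def by (intro uniform_limit_add uniform_limit_const unif)
  moreover have "(\<lambda>n r. it 0 r + (\<Sum>i<n. it (Suc i) r - it i r)) = it"
    using sum_lessThan_telescope[of "\<lambda>i. it i r" n for r n] by (intro ext) simp
  ultimately have lim: "uniform_limit {0..1} it f sequentially" by simp
  have f_cont: "continuous_on {0..1} f"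
    by (rule uniform_limit_theorem[OF _ lim]) (auto intro!: always_eventually it_cont)
  moreover have "f r = picard d f r" if r: "r \<in> {0..1}" for r
  proof (rule LIMSEQ_unique)
    show "(\<lambda>n. it (Suc n) r) \<longlonglongrightarrow> f r"
      using tendsto_uniform_limitI[OF lim r] by (rule LIMSEQ_Suc)
    show "(\<lambda>n. it (Suc n) r) \<longlonglongrightarrow> picard d f r"
    proof (rule tendstoI)
      fix e :: real assume e: "e > 0"
      \<comment> \<open>The weight is at most exp lam on [0,1], so a uniform error below e' becomes
        at most e/2 after one application of \<open>picard\<close>.\<close>
      define e' where "e' = e / exp lam"
      have e': "e' > 0" using e by (simp add: e'_def)
      from uniform_limitD[OF lim e']
      show "\<forall>\<^sub>F n in sequentially. dist (it (Suc n) r) (picard d f r) < e"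
      proof eventually_elim
        case (elim n)
        have "\<bar>it n t - f t\<bar> \<le> e' * exp (lam * t)" if "t \<in> {0..1}" for t
        proof -
          have "e' * 1 \<le> e' * exp (lam * t)"
            using that lam_ge_1 e' by (intro mult_left_mono) auto
          with elim that show ?thesis by (force simp: dist_real_def)
        qed
        from picard_diff[OF _ it_cont f_cont this r, of d d]
        have "\<bar>it (Suc n) r - picard d f r\<bar> \<le> e' / 2 * exp (lam * r)" by (simp add: it_Suc)
        also have "\<dots> \<le> e' / 2 * exp lam"
          using r e' lam_ge_1 by (intro mult_left_mono) (auto simp: mult_left_le)
        also have "\<dots> < e" using e by (simp add: e'_def)
        finally show ?case by (simp add: dist_real_def)
      qed
    qed
  qed
  ultimately show ?thesis using that by blast
qed

end

section \<open>Truncation and the maximal solution\<close>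

definition extend :: "(real \<Rightarrow> real) \<Rightarrow> real \<Rightarrow> real" where
  "extend g x = g (max x 0)"

text \<open>The first-order form of the radial equation, with \<open>y r = r ^ (N - 1) * x' r\<close>.  At \<open>r = 0\<close> the
  quotient is the junk value \<open>y 0 / 0 = 0\<close> (or \<open>y 0 = 0\<close> if \<open>N = 1\<close>), which is the right slope.\<close>

definition solves ::
  "nat \<Rightarrow> (real \<Rightarrow> real) \<Rightarrow> (real \<Rightarrow> real) \<Rightarrow> real \<Rightarrow> real \<Rightarrow> (real \<Rightarrow> real) \<Rightarrow> (real \<Rightarrow> real) \<Rightarrow> bool" where
  "solves N w g l h x y \<longleftrightarrow> (\<forall>r\<in>{l..h}.
    (x has_real_derivative y r / r ^ (N - 1)) (at r within {l..h}) \<and>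
    (y has_real_derivative - (r ^ (N - 1) * w r * extend g (x r))) (at r within {l..h}))"

locale shooting_ode =
  fixes N :: nat and w g :: "real \<Rightarrow> real"
  assumes weight_cont: "continuous_on {0..1} w"
    and g_lip: "locally_lipschitz_on {0..} g"
begin

text \<open>Clamping the argument to the compact interval [0,n] turns the local Lipschitz condition
  into a global one; below n it agrees with \<open>extend g\<close>.\<close>

definition trunc :: "nat \<Rightarrow> real \<Rightarrow> real" where
  "trunc n x = g (min (max x 0) (real n))"

text \<open>On [0,1] the fixed point is unique by \<open>picard_dependence\<close>, so the choice is
  harmless.\<close>

definition sol :: "nat \<Rightarrow> real \<Rightarrow> real \<Rightarrow> real" where
  "sol n d = (SOME f. continuous_on {0..1} f \<and>
     (\<forall>r\<in>{0..1}. f r = radial_ode.picard N w (trunc n) d f r))"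

text \<open>\<open>defined d s\<close> says that the maximal solution starting from the value \<open>d\<close> exists on
  \<open>[0, s]\<close>; only then \<open>X d\<close> and its flux \<open>Y d\<close> are meaningful there.\<close>

definition defined :: "real \<Rightarrow> real \<Rightarrow> bool" where
  "defined d s \<longleftrightarrow> (\<exists>n. \<forall>t\<in>{0..s}. sol n d t < real n)"

text \<open>Every level n that the trajectory does not reach on [0,r] gives the same value, by
  \<open>sol_agree\<close>; the least one is merely a canonical choice.\<close>

definition X :: "real \<Rightarrow> real \<Rightarrow> real" where
  "X d r = sol (LEAST n. \<forall>t\<in>{0..r}. sol n d t < real n) d r"

definition Y :: "real \<Rightarrow> real \<Rightarrow> real" where
  "Y d r = - integral {0..r} (\<lambda>s. s ^ (N - 1) * w s * extend g (X d s))"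

lemma trunc_ode: "\<exists>L W. radial_ode w (trunc n) L W"
proof -
  have ll: "local_lipschitz {0::real} {0..real n} (\<lambda>_. g)"
    by (rule local_lipschitz_subset[OF g_lip[unfolded locally_lipschitz_on_def]]) auto
  have "\<exists>L. L-lipschitz_on {0..real n} g"
    by (rule local_lipschitz_compact_implies_lipschitz[OF ll]) auto
  then obtain L where L: "L-lipschitz_on {0..real n} g" ..
  have L0: "0 \<le> L" using lipschitz_on_nonneg[OF L] .
  have "\<bar>trunc n x - trunc n z\<bar> \<le> L * \<bar>x - z\<bar>" for x z
  proof -
    have "\<bar>trunc n x - trunc n z\<bar> \<le> L * \<bar>min (max x 0) (real n) - min (max z 0) (real n)\<bar>"
      using lipschitz_onD[OF L, of "min (max x 0) (real n)" "min (max z 0) (real n)"]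
      by (simp add: trunc_def dist_real_def)
    also have "\<dots> \<le> L * \<bar>x - z\<bar>"
      by (rule mult_left_mono[OF _ L0]) (simp add: min_def max_def)
    finally show ?thesis .
  qed
  moreover obtain W where "\<And>r. r \<in> {0..1} \<Longrightarrow> \<bar>w r\<bar> \<le> W"
    using continuous_on_interval_abs_bound[OF weight_cont] by blast
  ultimately have "radial_ode w (trunc n) L W"
    using weight_cont L0 by unfold_locales auto
  then show ?thesis by blast
qed

lemma sol_spec:
  "continuous_on {0..1} (sol n d) \<and>
    (\<forall>r\<in>{0..1}. sol n d r = radial_ode.picard N w (trunc n) d (sol n d) r)"
proof -
  obtain L W where "radial_ode w (trunc n) L W" using trunc_ode by blast
  then interpret radial_ode N w "trunc n" L W .
  have "\<exists>f. continuous_on {0..1} f \<and> (\<forall>r\<in>{0..1}. f r = picard d f r)"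
    by (rule picard_fixpoint) blast
  from someI_ex[OF this] show ?thesis unfolding sol_def .
qed

lemma sol_cont: "s \<le> 1 \<Longrightarrow> continuous_on {0..s} (sol n d)"
  using sol_spec continuous_on_subset by (metis atLeastatMost_subset_iff order_refl)

lemma sol_eq: "r \<in> {0..1} \<Longrightarrow> sol n d r = radial_ode.picard N w (trunc n) d (sol n d) r"
  using sol_spec by blast

lemma sol_0 [simp]: "sol n d 0 = d"
proof -
  obtain L W where "radial_ode w (trunc n) L W" using trunc_ode by blast
  then interpret radial_ode N w "trunc n" L W .
  show ?thesis using sol_eq[of 0 n d] by (simp add: picard_def)
qed

lemma sol_dependence:
  "\<exists>C>0. \<forall>d d'. \<forall>r\<in>{0..1}. \<bar>sol n d r - sol n d' r\<bar> \<le> C * \<bar>d - d'\<bar>"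
proof -
  obtain L W where "radial_ode w (trunc n) L W" using trunc_ode by blast
  then interpret radial_ode N w "trunc n" L W .
  have "\<bar>sol n d r - sol n d' r\<bar> \<le> 2 * exp lam * \<bar>d - d'\<bar>" if "r \<in> {0..1}" for d d' r
  proof -
    have "\<bar>sol n d r - sol n d' r\<bar> \<le> 2 * \<bar>d - d'\<bar> * exp lam"
      by (rule picard_dependence[of 1]) (use that sol_cont sol_eq in auto)
    then show ?thesis by (simp add: mult_ac)
  qed
  then show ?thesis by (intro exI[of _ "2 * exp lam"]) auto
qed

lemma trunc_eq: "x < real n \<Longrightarrow> trunc n x = extend g x"
  by (cases n) (auto simp: trunc_def extend_def min_def max_def)

text \<open>Up to time s both truncations act alike on \<open>sol n d\<close>, so it is a fixed
  point for both, and uniqueness applies.\<close>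

lemma sol_agree:
  assumes s: "0 \<le> s" "s \<le> 1" and below: "\<And>t. t \<in> {0..s} \<Longrightarrow> sol n d t < real n"
    and nm: "n \<le> m" and t: "t \<in> {0..s}"
  shows "sol m d t = sol n d t"
proof -
  obtain L W where "radial_ode w (trunc m) L W" using trunc_ode by blast
  then interpret R: radial_ode N w "trunc m" L W .
  obtain L' W' where "radial_ode w (trunc n) L' W'" using trunc_ode by blast
  then interpret R': radial_ode N w "trunc n" L' W' .
  have tr: "trunc m (sol n d q) = trunc n (sol n d q)" if "q \<in> {0..s}" for q
    using below[OF that] nm by (simp add: trunc_eq)
  have fl: "R.flux (sol n d) r = R'.flux (sol n d) r" if "r \<in> {0..s}" for r
    unfolding R.flux_def R'.flux_def
    by (intro arg_cong[where f = uminus] integral_cong) (use that tr in auto)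
  have "R.picard d (sol n d) r = R'.picard d (sol n d) r" if "r \<in> {0..s}" for r
    unfolding R.picard_def R'.picard_def
    by (intro arg_cong[where f = "(+) d"] integral_cong) (use that fl in auto)
  then have "\<bar>sol m d t - sol n d t\<bar> \<le> 2 * \<bar>d - d\<bar> * exp R.lam"
    by (intro R.picard_dependence[OF s sol_cont[OF s(2)] sol_cont[OF s(2)] _ _ t])
      (use s sol_eq in auto)
  then show ?thesis by simp
qed

lemma X_eq:
  assumes s: "s \<le> 1" and below: "\<And>t. t \<in> {0..s} \<Longrightarrow> sol n d t < real n" and r: "r \<in> {0..s}"
  shows "X d r = sol n d r"
proof -
  define k where "k = (LEAST n. \<forall>t\<in>{0..r}. sol n d t < real n)"
  have n: "\<forall>t\<in>{0..r}. sol n d t < real n" using below r by auto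
  have "\<forall>t\<in>{0..r}. sol k d t < real k" "k \<le> n"
    unfolding k_def
    by (rule LeastI[of "\<lambda>n. \<forall>t\<in>{0..r}. sol n d t < real n", OF n])
       (rule Least_le[of "\<lambda>n. \<forall>t\<in>{0..r}. sol n d t < real n", OF n])
  then have "sol n d r = sol k d r"
    using r s by (intro sol_agree[of r]) auto
  then show ?thesis by (simp add: X_def k_def)
qed

lemma Y_eq:
  assumes "s \<le> 1" and "\<And>t. t \<in> {0..s} \<Longrightarrow> sol n d t < real n" and r: "r \<in> {0..s}"
  shows "Y d r = radial_ode.flux N w (trunc n) (sol n d) r"
proof -
  obtain L W where "radial_ode w (trunc n) L W" using trunc_ode by blast
  then interpret radial_ode N w "trunc n" L W .
  show ?thesis
    unfolding Y_def flux_def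
    by (intro arg_cong[where f = uminus] integral_cong) (use r X_eq[OF assms(1,2)] assms(2) trunc_eq in auto)
qed

lemma definedE:
  assumes "defined d s"
  obtains n where "\<And>t. t \<in> {0..s} \<Longrightarrow> sol n d t < real n"
  using assms unfolding defined_def by blast

lemma defined_mono: "defined d s \<Longrightarrow> s' \<le> s \<Longrightarrow> defined d s'"
  unfolding defined_def by (meson atLeastAtMost_iff order_trans)

lemma defined_0 [simp]: "defined d 0"
proof -
  obtain n :: nat where "d < real n" using reals_Archimedean2 by blast
  then show ?thesis unfolding defined_def by (intro exI[of _ n]) auto
qed

lemma X_0 [simp]: "X d 0 = d"
  using definedE[OF defined_0[of d]] X_eq[of 0 _ d 0] by (metis atLeastAtMost_iff order_refl sol_0 zero_le_one)

lemma Y_0 [simp]: "Y d 0 = 0"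
  by (simp add: Y_def)

lemma X_deriv:
  assumes D: "defined d s" and s: "s \<le> 1" and r: "r \<in> {0..s}"
  shows "(X d has_real_derivative Y d r / r ^ (N - 1)) (at r within {0..s})"
proof -
  obtain n where n: "\<And>t. t \<in> {0..s} \<Longrightarrow> sol n d t < real n" using definedE[OF D] by blast
  obtain L W where "radial_ode w (trunc n) L W" using trunc_ode by blast
  then interpret radial_ode N w "trunc n" L W .
  have "(picard d (sol n d) has_real_derivative Y d r / r ^ (N - 1)) (at r within {0..s})"
    using picard_deriv[OF s sol_cont[OF s] r] Y_eq[OF s n r] by simp
  then show ?thesis
    by (rule has_field_derivative_transform_within[OF _ zero_less_one r])
      (use X_eq[OF s n] sol_eq s in auto)
qed

lemma Y_deriv:
  assumes D: "defined d s" and s: "s \<le> 1" and r: "r \<in> {0..s}"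
  shows "(Y d has_real_derivative - (r ^ (N - 1) * w r * extend g (X d r))) (at r within {0..s})"
proof -
  obtain n where n: "\<And>t. t \<in> {0..s} \<Longrightarrow> sol n d t < real n" using definedE[OF D] by blast
  obtain L W where "radial_ode w (trunc n) L W" using trunc_ode by blast
  then interpret radial_ode N w "trunc n" L W .
  have "(flux (sol n d) has_real_derivative - (r ^ (N - 1) * w r * extend g (X d r))) (at r within {0..s})"
    using flux_deriv[OF s sol_cont[OF s] r, of n d] X_eq[OF s n r] trunc_eq[OF n[OF r]] by simp
  then show ?thesis
    by (rule has_field_derivative_transform_within[OF _ zero_less_one r]) (use Y_eq[OF s n] in auto)
qed

lemma solves_X: "defined d s \<Longrightarrow> s \<le> 1 \<Longrightarrow> solves N w g 0 s (X d) (Y d)"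
  unfolding solves_def using X_deriv Y_deriv by blast

lemma X_cont: "defined d s \<Longrightarrow> s \<le> 1 \<Longrightarrow> continuous_on {0..s} (X d)"
  by (rule DERIV_continuous_on[OF X_deriv])

lemma Y_cont: "defined d s \<Longrightarrow> s \<le> 1 \<Longrightarrow> continuous_on {0..s} (Y d)"
  by (rule DERIV_continuous_on[OF Y_deriv])

text \<open>By compactness a trajectory stays below its truncation level by a positive gap.
  Lipschitz dependence for that one truncation keeps nearby trajectories below the level too, so
  existence up to s is an open condition, and X and Y are uniformly close there.\<close>

lemma near:
  assumes D: "defined d s" and s: "0 \<le> s" "s \<le> 1" and e: "0 < e"
  shows "\<exists>\<delta>>0. \<forall>d'. \<bar>d' - d\<bar> < \<delta> \<longrightarrow> defined d' s \<and>
    (\<forall>r\<in>{0..s}. \<bar>X d' r - X d r\<bar> < e \<and> \<bar>Y d' r - Y d r\<bar> < e)"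
proof -
  obtain n where n: "\<And>t. t \<in> {0..s} \<Longrightarrow> sol n d t < real n" using definedE[OF D] by blast
  obtain L W where "radial_ode w (trunc n) L W" using trunc_ode by blast
  then interpret radial_ode N w "trunc n" L W .
  obtain t0 where t0: "t0 \<in> {0..s}" "\<And>t. t \<in> {0..s} \<Longrightarrow> sol n d t \<le> sol n d t0"
    using continuous_attains_sup[OF _ _ sol_cont[OF s(2)]] s(1) by (metis atLeastAtMost_iff compact_Icc empty_iff order_refl)
  define gap where "gap = real n - sol n d t0"
  have gap: "0 < gap" using n[OF t0(1)] by (simp add: gap_def)
  obtain C where C: "C > 0" "\<And>d d' r. r \<in> {0..1} \<Longrightarrow> \<bar>sol n d r - sol n d' r\<bar> \<le> C * \<bar>d - d'\<bar>"
    using sol_dependence[of n] by blast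
  \<comment> \<open>B bounds the change of the flux in terms of the distance of the trajectories, as
    read off from \<open>flux_diff\<close>; with B + 1 in \<delta> the same choice controls X as
    well.\<close>
  define B where "B = W * L / lam * exp lam"
  have B: "0 \<le> B"
    unfolding B_def using W_nonneg L_nonneg lam_ge_1 by (intro mult_nonneg_nonneg divide_nonneg_nonneg) auto
  define \<delta> where "\<delta> = min gap (e / (B + 1)) / C"
  have small: "C * \<bar>d' - d\<bar> < gap" "(B + 1) * (C * \<bar>d' - d\<bar>) < e" if "\<bar>d' - d\<bar> < \<delta>" for d'
  proof -
    have "C * \<bar>d' - d\<bar> < min gap (e / (B + 1))"
      using that C(1) by (simp add: \<delta>_def field_simps)
    then show "C * \<bar>d' - d\<bar> < gap" "(B + 1) * (C * \<bar>d' - d\<bar>) < e"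
      using B by (auto simp: field_simps)
  qed
  have n': "sol n d' t < real n" if "\<bar>d' - d\<bar> < \<delta>" "t \<in> {0..s}" for d' t
    using C(2)[of t d' d] small(1)[OF that(1)] t0(2)[OF that(2)] that(2) s by (auto simp: gap_def)
  show ?thesis
  proof (intro exI[of _ \<delta>] conjI allI impI ballI)
    show "0 < \<delta>" unfolding \<delta>_def using gap e B C(1) by auto
  next
    fix d' assume d': "\<bar>d' - d\<bar> < \<delta>"
    show "defined d' s" unfolding defined_def using n'[OF d'] by blast
  next
    fix d' r assume d': "\<bar>d' - d\<bar> < \<delta>" and r: "r \<in> {0..s}"
    have "C * \<bar>d' - d\<bar> \<le> (B + 1) * (C * \<bar>d' - d\<bar>)"
      using mult_right_mono[of 1 "B + 1" "C * \<bar>d' - d\<bar>"] B C(1) by simp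
    then show "\<bar>X d' r - X d r\<bar> < e"
      using C(2)[of r d' d] small(2)[OF d'] X_eq[OF s(2) n r] X_eq[OF s(2) n'[OF d'] r] r s by auto
  next
    fix d' r assume d': "\<bar>d' - d\<bar> < \<delta>" and r: "r \<in> {0..s}"
    let ?K = "C * \<bar>d' - d\<bar>"
    have K0: "0 \<le> ?K" using C(1) by simp
    have "\<bar>sol n d' t - sol n d t\<bar> \<le> ?K * exp (lam * t)" if "t \<in> {0..s}" for t
    proof -
      have "?K * 1 \<le> ?K * exp (lam * t)"
        using that lam_ge_1 K0 by (intro mult_left_mono) auto
      then show ?thesis using C(2)[of t d' d] that s by simp
    qed
    from flux_diff[OF s(2) sol_cont[OF s(2)] sol_cont[OF s(2)] this r]
    have "\<bar>Y d' r - Y d r\<bar> \<le> r ^ (N - 1) * (W * L * ?K / lam * exp (lam * r))"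
      using Y_eq[OF s(2) n r] Y_eq[OF s(2) n'[OF d'] r] by simp
    also have "\<dots> \<le> 1 * (W * L * ?K / lam * exp lam)"
    proof (rule mult_mono)
      have "0 \<le> W * L * ?K / lam"
        using W_nonneg L_nonneg K0 lam_ge_1 by (intro divide_nonneg_nonneg mult_nonneg_nonneg[of "W * L"]) auto
      then show "W * L * ?K / lam * exp (lam * r) \<le> W * L * ?K / lam * exp lam"
        "0 \<le> W * L * ?K / lam * exp (lam * r)"
        using r s lam_ge_1 by (intro mult_left_mono mult_nonneg_nonneg; simp add: mult_left_le)+
    qed (use r s in \<open>auto intro: power_le_one\<close>)
    also have "\<dots> = B * ?K" by (simp add: B_def)
    also have "\<dots> \<le> (B + 1) * ?K" using K0 by (simp add: distrib_right)
    also have "\<dots> < e" by (rule small(2)[OF d'])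
    finally show "\<bar>Y d' r - Y d r\<bar> < e" .
  qed
qed

text \<open>Without existence up to s, the solution of every truncated problem reaches its level n.
  Before that it takes the value max (K + 1) d by the intermediate value theorem, since it starts at
  d; as it is still below n at that time, the value belongs to the true solution.\<close>

lemma escape:
  assumes "\<not> defined d s" and s: "0 \<le> s" "s \<le> 1"
  obtains t where "0 \<le> t" "t < s" "defined d t" "K < X d t"
proof -
  obtain n :: nat where n: "max (K + 1) d < real n" using reals_Archimedean2 by blast
  let ?f = "sol n d"
  have c: "continuous_on {0..s} ?f" by (rule sol_cont[OF s(2)])
  obtain t1 where t1: "t1 \<in> {0..s}" "real n \<le> ?f t1"
    using assms(1) unfolding defined_def by (meson not_less)
  obtain T where T: "0 < T" "T \<le> t1" "?f T = real n" "\<And>t. 0 \<le> t \<Longrightarrow> t < T \<Longrightarrow> ?f t < real n"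
    by (rule first_hit[of 0 t1 ?f "real n"])
      (use t1 n in \<open>auto intro: continuous_on_subset[OF c]\<close>)
  obtain t where t: "0 \<le> t" "t \<le> T" "?f t = max (K + 1) d"
    using IVT'[of ?f 0 "max (K + 1) d" T] continuous_on_subset[OF c, of "{0..T}"] T n t1 by auto
  have "t < T" using t T n by (cases "t = T") auto
  then have below: "?f q < real n" if "q \<in> {0..t}" for q using T(4) that by auto
  show ?thesis
  proof
    show "0 \<le> t" "t < s" using t \<open>t < T\<close> T t1 by auto
    show "defined d t" unfolding defined_def using below by blast
    show "K < X d t" using X_eq[of t n d t] below t \<open>t < s\<close> s by auto
  qed
qed

end

section \<open>Estimates on a single interval\<close>

lemma solves_subset:
  assumes S: "solves N w g l h x y" and sub: "l \<le> l'" "h' \<le> h"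
  shows "solves N w g l' h' x y"
  unfolding solves_def
proof
  fix r assume r: "r \<in> {l'..h'}"
  with sub have "r \<in> {l..h}" "{l'..h'} \<subseteq> {l..h}" by auto
  with S show "(x has_real_derivative y r / r ^ (N - 1)) (at r within {l'..h'}) \<and>
    (y has_real_derivative - (r ^ (N - 1) * w r * extend g (x r))) (at r within {l'..h'})"
    unfolding solves_def by (blast intro: has_field_derivative_subset)
qed

lemma solves_x_deriv:
  "solves N w g l h x y \<Longrightarrow> r \<in> {l..h} \<Longrightarrow> (x has_real_derivative y r / r ^ (N - 1)) (at r within {l..h})"
  by (simp add: solves_def)

lemma solves_y_deriv:
  "solves N w g l h x y \<Longrightarrow> r \<in> {l..h} \<Longrightarrow>
    (y has_real_derivative - (r ^ (N - 1) * w r * extend g (x r))) (at r within {l..h})"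
  by (simp add: solves_def)

lemma solves_y_cont: "solves N w g l h x y \<Longrightarrow> continuous_on {l..h} y"
  by (rule DERIV_continuous_on[OF solves_y_deriv])

text \<open>Passing from flux to slope divides by r^(N-1), and on [l,1] the factor r^(1-N) lies
  between 1 and l^(1-N). Hence the estimates below carry either no power at all or that of the left
  end point.\<close>

lemma quotient_power_bounds:
  fixes r y :: real
  assumes "0 < l" "l \<le> r" "r \<le> 1"
  shows "0 \<le> y \<Longrightarrow> y \<le> y / r ^ n" "0 \<le> y \<Longrightarrow> y / r ^ n \<le> y / l ^ n"
    "y \<le> 0 \<Longrightarrow> y / l ^ n \<le> y / r ^ n"
proof -
  have p: "0 < r ^ n" "r ^ n \<le> 1" "l ^ n \<le> r ^ n" "0 < l ^ n"
    using assms by (auto intro: power_le_one power_mono)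
  show "y \<le> y / r ^ n" if "0 \<le> y" using p that by (simp add: le_divide_eq mult_left_le)
  show "y / r ^ n \<le> y / l ^ n" if "0 \<le> y" using p that by (intro divide_left_mono) auto
  show "y / l ^ n \<le> y / r ^ n" if "y \<le> 0" using p that by (intro divide_left_mono_neg) auto
qed

lemma solves_x_lower:
  assumes S: "solves N w g l h x y" and lh: "0 < l" "l \<le> h" "h \<le> 1"
    and y: "\<And>r. r \<in> {l..h} \<Longrightarrow> - \<theta> \<le> y r" and \<theta>: "0 \<le> \<theta>"
  shows "x l - \<theta> / l ^ (N - 1) * (h - l) \<le> x h"
proof -
  have "- \<theta> / l ^ (N - 1) * (h - l) \<le> x h - x l"
  proof (rule increment_ge[OF lh(2) solves_x_deriv[OF S]])
    fix r assume r: "r \<in> {l..h}"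
    have "- \<theta> / l ^ (N - 1) \<le> - \<theta> / r ^ (N - 1)"
      by (rule quotient_power_bounds) (use r lh \<theta> in auto)
    also have "\<dots> \<le> y r / r ^ (N - 1)"
      by (rule divide_right_mono[OF y[OF r]]) (use r lh in auto)
    finally show "- \<theta> / l ^ (N - 1) \<le> y r / r ^ (N - 1)" .
  qed
  then show ?thesis by simp
qed

lemma solves_x_upper:
  assumes S: "solves N w g l h x y" and lh: "0 < l" "l \<le> h" "h \<le> 1"
    and y: "\<And>r. r \<in> {l..h} \<Longrightarrow> y r \<le> \<theta>" and \<theta>: "0 \<le> \<theta>"
  shows "x h \<le> x l + \<theta> / l ^ (N - 1) * (h - l)"
proof -
  have "x h - x l \<le> \<theta> / l ^ (N - 1) * (h - l)"
  proof (rule increment_le[OF lh(2) solves_x_deriv[OF S]])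
    fix r assume r: "r \<in> {l..h}"
    have "y r / r ^ (N - 1) \<le> \<theta> / r ^ (N - 1)"
      by (rule divide_right_mono[OF y[OF r]]) (use r lh in auto)
    also have "\<dots> \<le> \<theta> / l ^ (N - 1)"
      by (rule quotient_power_bounds) (use r lh \<theta> in auto)
    finally show "y r / r ^ (N - 1) \<le> \<theta> / l ^ (N - 1)" .
  qed
  then show ?thesis by simp
qed

lemma solves_x_growth:
  assumes S: "solves N w g l h x y" and lh: "0 < l" "l \<le> h" "h \<le> 1"
    and y: "\<And>r. r \<in> {l..h} \<Longrightarrow> k \<le> y r" and k: "0 \<le> k"
  shows "x l + k * (h - l) \<le> x h"
proof -
  have "k * (h - l) \<le> x h - x l"
  proof (rule increment_ge[OF lh(2) solves_x_deriv[OF S]])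
    fix r assume r: "r \<in> {l..h}"
    have "y r \<le> y r / r ^ (N - 1)"
      by (rule quotient_power_bounds[of r]) (use r lh k y[OF r] in auto)
    with y[OF r] show "k \<le> y r / r ^ (N - 1)" by linarith
  qed
  then show ?thesis by simp
qed

lemma solves_x_decay:
  assumes S: "solves N w g l h x y" and lh: "0 < l" "l \<le> h" "h \<le> 1"
    and y: "\<And>r. r \<in> {l..h} \<Longrightarrow> y r \<le> - k" and k: "0 \<le> k"
  shows "x h \<le> x l - k * (h - l)"
proof -
  have "x h - x l \<le> - k * (h - l)"
  proof (rule increment_le[OF lh(2) solves_x_deriv[OF S]])
    fix r assume r: "r \<in> {l..h}"
    have "- y r \<le> - y r / r ^ (N - 1)"
      by (rule quotient_power_bounds[of r]) (use r lh k y[OF r] in auto)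
    with y[OF r] show "y r / r ^ (N - 1) \<le> - k" by simp
  qed
  then show ?thesis by simp
qed

lemma solves_x_mono:
  assumes S: "solves N w g l h x y" and lh: "0 \<le> l" "l \<le> h"
    and y: "\<And>r. r \<in> {l..h} \<Longrightarrow> 0 \<le> y r"
  shows "x l \<le> x h"
  using increment_ge[OF lh(2) solves_x_deriv[OF S], of 0] y lh by simp

lemma solves_x_antimono:
  assumes S: "solves N w g l h x y" and lh: "0 \<le> l" "l \<le> h"
    and y: "\<And>r. r \<in> {l..h} \<Longrightarrow> y r \<le> 0"
  shows "x h \<le> x l"
  using increment_le[OF lh(2) solves_x_deriv[OF S], of 0] y lh by (simp add: divide_le_0_iff)

text \<open>A neighbourhood where b exceeds half a positive value is cut down to lie strictly inside
  (l,h). The room on both sides serves for slope bounds, and where l >= 0 it makes c positive, hence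
  also c^(N-1).\<close>

lemma continuous_nonneg_bump:
  fixes b :: "real \<Rightarrow> real"
  assumes b: "continuous_on {l..h} b" and lh: "l < h"
    and nonneg: "\<And>r. r \<in> {l..h} \<Longrightarrow> 0 \<le> b r" and ne: "\<exists>r\<in>{l..h}. b r \<noteq> 0"
  obtains c f k where "l < c" "c < f" "f < h" "0 < k" "\<And>r. r \<in> {c..f} \<Longrightarrow> k \<le> b r"
proof -
  obtain r0 where r0: "r0 \<in> {l..h}" "b r0 \<noteq> 0" using ne by blast
  with nonneg[of r0] have pos: "0 < b r0" by simp
  then obtain \<delta> where \<delta>: "\<delta> > 0" "\<And>r. r \<in> {l..h} \<Longrightarrow> \<bar>r - r0\<bar> < \<delta> \<Longrightarrow> \<bar>b r - b r0\<bar> < b r0 / 2"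
    using b[unfolded continuous_on_iff, rule_format, OF r0(1), of "b r0 / 2"]
    by (auto simp: dist_real_def)
  have "max l (r0 - \<delta>) < min h (r0 + \<delta>)" using r0 lh \<delta>(1) by auto
  then obtain c where c: "max l (r0 - \<delta>) < c" "c < min h (r0 + \<delta>)" using dense by blast
  from dense[OF this(2)] obtain f where f: "c < f" "f < min h (r0 + \<delta>)" by blast
  have "b r0 / 2 \<le> b r" if "r \<in> {c..f}" for r
  proof -
    have "\<bar>b r - b r0\<bar> < b r0 / 2" by (rule \<delta>(2)) (use that c f in auto)
    then show ?thesis by linarith
  qed
  with that[of c f "b r0 / 2"] c f pos show ?thesis by auto
qed

locale superlinear =
  fixes N :: nat and g :: "real \<Rightarrow> real"
  assumes g_cont: "continuous_on {0..} g"
    and g_0: "g 0 = 0"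
    and g_pos: "\<And>u. u > 0 \<Longrightarrow> g u > 0"
    and g_zero: "((\<lambda>u. g u / u) \<longlongrightarrow> 0) (at_right 0)"
    and g_infty: "filterlim (\<lambda>u. g u / u) at_top at_top"
    and time_to_infty:
      "((\<lambda>u. \<integral>\<^sup>+ \<xi>\<in>{u<..}. ennreal (1 / sqrt (primitive g \<xi> - primitive g u)) \<partial>lborel)
          \<longlongrightarrow> 0) at_top"
begin

lemma extend_pos [simp]: "0 < u \<Longrightarrow> extend g u = g u"
  by (simp add: extend_def max_def)

lemma extend_nonpos [simp]: "u \<le> 0 \<Longrightarrow> extend g u = 0"
  using g_0 by (simp add: extend_def max_def)

lemma extend_nonneg: "0 \<le> extend g u"
  using g_pos[of u] by (cases "0 < u") auto

lemma g_superlinear: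
  obtains U where "0 < U" "\<And>u. U \<le> u \<Longrightarrow> \<Lambda> * u \<le> g u"
proof -
  obtain U where U: "\<And>u. U \<le> u \<Longrightarrow> \<Lambda> \<le> g u / u"
    using g_infty unfolding filterlim_at_top eventually_at_top_linorder by metis
  have "\<Lambda> * u \<le> g u" if "max U 1 \<le> u" for u
    using U[of u] that by (simp add: le_divide_eq)
  with that[of "max U 1"] show ?thesis by simp
qed

lemma g_sublinear:
  assumes "0 < \<eta>"
  obtains \<rho> where "0 < \<rho>" "\<And>u. 0 < u \<Longrightarrow> u \<le> \<rho> \<Longrightarrow> g u \<le> \<eta> * u"
proof -
  have "\<forall>\<^sub>F u in at_right 0. g u / u < \<eta>"
    using g_zero assms by (rule order_tendstoD(2))
  then obtain b where b: "b > 0" "\<And>u. 0 < u \<Longrightarrow> u < b \<Longrightarrow> g u / u < \<eta>"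
    unfolding eventually_at_right_field by auto
  have "g u \<le> \<eta> * u" if "0 < u" "u \<le> b / 2" for u
    using b(2)[of u] that b(1) by (simp add: divide_less_eq)
  with that[of "b / 2"] b(1) show ?thesis by simp
qed

text \<open>As g need not be monotone, compactness handles the values up to U, and superlinearity
  the rest.\<close>

lemma g_lower_bound:
  assumes \<delta>: "0 < \<delta>"
  obtains \<gamma> where "0 < \<gamma>" "\<And>u. \<delta> \<le> u \<Longrightarrow> \<gamma> \<le> g u"
proof -
  obtain U where U: "0 < U" "\<And>u. U \<le> u \<Longrightarrow> 1 * u \<le> g u" using g_superlinear by blast
  have "continuous_on {\<delta>..max \<delta> U} g" by (rule continuous_on_subset[OF g_cont]) (use \<delta> in auto)
  then obtain u0 where u0: "u0 \<in> {\<delta>..max \<delta> U}" "\<And>u. u \<in> {\<delta>..max \<delta> U} \<Longrightarrow> g u0 \<le> g u"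
    using continuous_attains_inf[of "{\<delta>..max \<delta> U}" g] by auto
  have "min (g u0) U \<le> g u" if "\<delta> \<le> u" for u
  proof (cases "u \<le> max \<delta> U")
    case True
    with u0(2)[of u] that show ?thesis by auto
  next
    case False
    then have "U \<le> u" by simp
    with U(2)[of u] have "U \<le> g u" by simp
    then show ?thesis by simp
  qed
  moreover have "0 < min (g u0) U" using u0(1) \<delta> U g_pos[of u0] by auto
  ultimately show ?thesis by (rule that[rotated])
qed

lemma primitive_deriv:
  assumes u: "0 < u"
  shows "(primitive g has_real_derivative g u) (at u)"
proof -
  have "(primitive g has_real_derivative g u) (at u within {0..u + 1})"
    unfolding primitive_def[abs_def]
    by (rule integral_has_real_derivative) (use u in \<open>auto intro: continuous_on_subset[OF g_cont]\<close>)
  moreover have "at u within {0..u + 1} = at u" by (rule at_within_Icc_at) (use u in auto)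
  ultimately show ?thesis by simp
qed

lemma primitive_strict_mono:
  assumes "0 < u" "u < v"
  shows "primitive g u < primitive g v"
proof (rule DERIV_pos_imp_increasing[OF assms(2)])
  fix t assume "u \<le> t" "t \<le> v"
  then have "0 < t" using assms by simp
  then show "\<exists>y. (primitive g has_real_derivative y) (at t) \<and> 0 < y"
    using primitive_deriv g_pos by blast
qed

section \<open>Flux where the weight has one sign, and forced blow-up\<close>

lemma y_mono:
  assumes S: "solves N w g l h x y" and l: "0 \<le> l" and w: "\<And>r. r \<in> {l..h} \<Longrightarrow> w r \<le> 0"
    and r: "l \<le> r" "r \<le> s" "s \<le> h"
  shows "y r \<le> y s"
proof -
  have "0 * (s - r) \<le> y s - y r"
  proof (rule increment_ge[OF r(2) solves_y_deriv[OF solves_subset[OF S r(1,3)]]])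
    fix t assume t: "t \<in> {r..s}"
    have "t ^ (N - 1) * w t * extend g (x t) \<le> 0"
      by (intro mult_nonpos_nonneg mult_nonneg_nonpos extend_nonneg) (use t r l w in auto)
    then show "0 \<le> - (t ^ (N - 1) * w t * extend g (x t))" by simp
  qed
  then show ?thesis by simp
qed

lemma y_antimono:
  assumes S: "solves N w g l h x y" and l: "0 \<le> l" and w: "\<And>r. r \<in> {l..h} \<Longrightarrow> 0 \<le> w r"
    and r: "l \<le> r" "r \<le> s" "s \<le> h"
  shows "y s \<le> y r"
proof -
  have "y s - y r \<le> 0 * (s - r)"
  proof (rule increment_le[OF r(2) solves_y_deriv[OF solves_subset[OF S r(1,3)]]])
    fix t assume t: "t \<in> {r..s}"
    have "0 \<le> t ^ (N - 1) * w t * extend g (x t)"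
      by (intro mult_nonneg_nonneg extend_nonneg) (use t r l w in auto)
    then show "- (t ^ (N - 1) * w t * extend g (x t)) \<le> 0" by simp
  qed
  then show ?thesis by simp
qed

lemma y_growth:
  assumes S: "solves N w g c f x y" and cf: "0 < c" "c \<le> f"
    and w: "\<And>r. r \<in> {c..f} \<Longrightarrow> w r \<le> - k" and k: "0 \<le> k"
    and x: "\<And>r. r \<in> {c..f} \<Longrightarrow> 0 < x r \<and> \<gamma> \<le> g (x r)" and \<gamma>: "0 \<le> \<gamma>"
  shows "y c + k * c ^ (N - 1) * \<gamma> * (f - c) \<le> y f"
proof -
  have "k * c ^ (N - 1) * \<gamma> * (f - c) \<le> y f - y c"
  proof (rule increment_ge[OF cf(2) solves_y_deriv[OF S]])
    fix r assume r: "r \<in> {c..f}"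
    have pw: "c ^ (N - 1) \<le> r ^ (N - 1)" "0 \<le> r ^ (N - 1)"
      using r cf by (auto intro: power_mono)
    have 1: "c ^ (N - 1) * k \<le> r ^ (N - 1) * - w r"
      by (rule mult_mono) (use pw w[OF r] k in auto)
    have 2: "0 \<le> r ^ (N - 1) * - w r"
      by (rule mult_nonneg_nonneg) (use w[OF r] k r cf in auto)
    have "c ^ (N - 1) * k * \<gamma> \<le> r ^ (N - 1) * - w r * extend g (x r)"
      by (rule mult_mono[OF 1 _ 2]) (use x[OF r] \<gamma> in auto)
    then show "k * c ^ (N - 1) * \<gamma> \<le> - (r ^ (N - 1) * w r * extend g (x r))"
      by (simp add: mult_ac)
  qed
  then show ?thesis by simp
qed

text \<open>Energy argument: with p = c^(N-1), the function y^2/2 - k p^2 G(x) is nondecreasing.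
  Hence x' >= q sqrt (G(x) - G(x c)), and separating variables bounds the elapsed time by the
  time-map integral, which is shorter than the interval permits once x c >= K. The height K comes
  before the weight and the solution are given.\<close>

lemma blow_up:
  assumes c: "0 < c" "c < f" "f \<le> 1" and k: "0 < k"
  obtains K where "0 < K"
    "\<And>w x y. solves N w g c f x y \<Longrightarrow> (\<And>r. r \<in> {c..f} \<Longrightarrow> w r \<le> - k) \<Longrightarrow>
      K \<le> x c \<Longrightarrow> 0 \<le> y c \<Longrightarrow> False"
proof -
  define p where "p = c ^ (N - 1)"
  have p: "0 < p" "p \<le> 1" unfolding p_def using c by (simp_all add: power_le_one)
  define q where "q = sqrt (2 * k * p\<^sup>2)"
  have q: "0 < q" using k p by (simp add: q_def)
  \<comment> \<open>Time is measured from m rather than from c: the integrand is singular at the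
    lower limit x c, and x m > x c keeps away from it.\<close>
  define m where "m = (c + f) / 2"
  have m: "c < m" "m < f" using c by (auto simp: m_def)
  let ?F = "\<lambda>u \<xi>. 1 / sqrt (primitive g \<xi> - primitive g u)"
  have "\<forall>\<^sub>F u in at_top. (\<integral>\<^sup>+ \<xi>\<in>{u<..}. ennreal (?F u \<xi>) \<partial>lborel) < ennreal (q * (f - m))"
    by (rule order_tendstoD(2)[OF time_to_infty]) (use q m in simp)
  then obtain K0 where K0: "\<And>u. K0 \<le> u \<Longrightarrow>
      (\<integral>\<^sup>+ \<xi>\<in>{u<..}. ennreal (?F u \<xi>) \<partial>lborel) < ennreal (q * (f - m))"
    unfolding eventually_at_top_linorder by metis
  show ?thesis
  proof (rule that[of "max K0 1"])
    fix w x y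
    assume S: "solves N w g c f x y" and w: "\<And>r. r \<in> {c..f} \<Longrightarrow> w r \<le> - k"
      and xc: "max K0 1 \<le> x c" and yc: "0 \<le> y c"
    have w0: "w r \<le> 0" if "r \<in> {c..f}" for r
      using w[OF that] k by simp
    have y0: "0 \<le> y r" if "r \<in> {c..f}" for r
      using y_mono[OF S _ w0, of c r] that c yc by auto
    have x_mono: "x r \<le> x s" if "c \<le> r" "r \<le> s" "s \<le> f" for r s
      by (rule solves_x_mono[OF solves_subset[OF S]]) (use that c y0 in auto)
    have x0: "0 < x r" if "r \<in> {c..f}" for r
      using x_mono[of c r] that xc by auto
    \<comment> \<open>Since x >= 1 from c on, g(x) is bounded below, so the flux becomes strictly
      positive before m even if y c = 0.\<close>
    obtain \<gamma> where \<gamma>: "0 < \<gamma>" "\<And>u. 1 \<le> u \<Longrightarrow> \<gamma> \<le> g u" using g_lower_bound[of 1] by auto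
    have "x c < x m"
    proof -
      define m1 where "m1 = (c + m) / 2"
      have m1: "c < m1" "m1 < m" using m by (auto simp: m1_def)
      have "y c + k * c ^ (N - 1) * \<gamma> * (m1 - c) \<le> y m1"
      proof (rule y_growth[OF solves_subset[OF S]])
        show "0 < x r \<and> \<gamma> \<le> g (x r)" if "r \<in> {c..m1}" for r
          using that m m1 x_mono[of c r] xc x0[of r] \<gamma>(2)[of "x r"] by auto
      qed (use m m1 c w k \<gamma> in auto)
      moreover have "0 < k * c ^ (N - 1) * \<gamma> * (m1 - c)" using k c \<gamma> m1 by simp
      ultimately have ym1: "0 < y m1" using yc by linarith
      have "x m1 + y m1 * (m - m1) \<le> x m"
      proof (rule solves_x_growth[OF solves_subset[OF S]])
        show "y m1 \<le> y r" if "r \<in> {m1..m}" for r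
          by (rule y_mono[OF S _ w0]) (use that c m m1 in auto)
      qed (use c m m1 ym1 in auto)
      moreover have "x c \<le> x m1" by (rule x_mono) (use m m1 in auto)
      moreover have "0 < y m1 * (m - m1)" using ym1 m1 by simp
      ultimately show ?thesis by linarith
    qed
    have energy: "q * sqrt (primitive g (x r) - primitive g (x c)) \<le> y r" if r: "r \<in> {c..f}" for r
    proof -
      define E where "E t = (y t)\<^sup>2 / 2 - k * p\<^sup>2 * primitive g (x t)" for t
      have "0 * (r - c) \<le> E r - E c"
      proof (rule increment_ge)
        fix t assume t: "t \<in> {c..r}"
        then have t': "t \<in> {c..f}" using r by auto
        have S': "solves N w g c r x y" by (rule solves_subset[OF S]) (use r in auto)
        have "((\<lambda>t. primitive g (x t)) has_real_derivative g (x t) * (y t / t ^ (N - 1))) (at t within {c..r})"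
          by (rule DERIV_chain2[OF primitive_deriv[OF x0[OF t']] solves_x_deriv[OF S' t]])
        then show "(E has_real_derivative
            y t * (- (t ^ (N - 1) * w t * extend g (x t))) - k * p\<^sup>2 * (g (x t) * (y t / t ^ (N - 1))))
            (at t within {c..r})"
          unfolding E_def
          by (auto intro!: derivative_eq_intros solves_y_deriv[OF S' t])
        have pt: "p \<le> t ^ (N - 1)" unfolding p_def using t c by (intro power_mono) auto
        have gx: "0 < g (x t)" by (rule g_pos[OF x0[OF t']])
        have "p * k * g (x t) \<le> t ^ (N - 1) * - w t * g (x t)"
        proof (rule mult_right_mono)
          show "p * k \<le> t ^ (N - 1) * - w t"
            by (rule mult_mono) (use pt p k w[OF t'] in auto)
        qed (use gx in simp)
        then have 1: "y t * (p * k * g (x t)) \<le> y t * (t ^ (N - 1) * - w t * g (x t))"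
          by (rule mult_left_mono[OF _ y0[OF t']])
        \<comment> \<open>One factor p of the energy comes from t^(N-1) in y', the other compensates
          the division by t^(N-1) in x'.\<close>
        have "p / t ^ (N - 1) \<le> 1" using pt p by simp
        then have "(k * p * g (x t) * y t) * (p / t ^ (N - 1)) \<le> (k * p * g (x t) * y t) * 1"
          by (rule mult_left_mono) (use k p gx y0[OF t'] in auto)
        with 1 show "0 \<le> y t * (- (t ^ (N - 1) * w t * extend g (x t)))
            - k * p\<^sup>2 * (g (x t) * (y t / t ^ (N - 1)))"
          using x0[OF t'] by (simp add: power2_eq_square mult_ac)
      qed (use r in auto)
      then have "2 * k * p\<^sup>2 * (primitive g (x r) - primitive g (x c)) \<le> (y r)\<^sup>2 - (y c)\<^sup>2"
        by (simp add: E_def right_diff_distrib)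
      then have "2 * k * p\<^sup>2 * (primitive g (x r) - primitive g (x c)) \<le> (y r)\<^sup>2"
        using zero_le_power2[of "y c"] by linarith
      then have "sqrt (2 * k * p\<^sup>2 * (primitive g (x r) - primitive g (x c))) \<le> sqrt ((y r)\<^sup>2)"
        by (rule real_sqrt_le_mono)
      then show ?thesis using y0[OF r] by (simp add: q_def real_sqrt_mult)
    qed
    have gap: "0 < primitive g \<xi> - primitive g (x c)" if "x m \<le> \<xi>" for \<xi>
      using primitive_strict_mono[of "x c" \<xi>] that \<open>x c < x m\<close> xc by auto
    \<comment> \<open>Separation of variables: \<Psi> (x r) has the derivative x' / sqrt (G(x) - G(x
      c)) >= q, so it grows by at least q (f - m) on [m,f].\<close>
    define \<Psi> where "\<Psi> \<xi> = integral {x m..\<xi>} (?F (x c))" for \<xi>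
    have F_cont: "continuous_on {x m..x f} (?F (x c))"
    proof (intro continuous_intros)
      show "continuous_on {x m..x f} (primitive g)"
        by (intro continuous_at_imp_continuous_on ballI DERIV_isCont[OF primitive_deriv])
          (use \<open>x c < x m\<close> xc in auto)
    qed (use gap in force)
    have "q * (f - m) \<le> \<Psi> (x f) - \<Psi> (x m)"
    proof (rule increment_ge)
      fix r assume r: "r \<in> {m..f}"
      have S': "solves N w g m f x y" by (rule solves_subset[OF S]) (use m in auto)
      have xr: "x m \<le> x r" "x r \<le> x f" using x_mono r m by auto
      have "(\<Psi> has_real_derivative ?F (x c) (x r)) (at (x r) within {x m..x f})"
        unfolding \<Psi>_def by (rule integral_has_real_derivative[OF F_cont]) (use xr in auto)
      then have "(\<Psi> has_real_derivative ?F (x c) (x r)) (at (x r) within x ` {m..f})"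
        by (rule has_field_derivative_subset) (use x_mono m in auto)
      from DERIV_image_chain[OF this solves_x_deriv[OF S' r]]
      show "((\<lambda>r. \<Psi> (x r)) has_real_derivative ?F (x c) (x r) * (y r / r ^ (N - 1))) (at r within {m..f})"
        by (simp add: o_def)
      have pos: "0 < sqrt (primitive g (x r) - primitive g (x c))" using gap[OF xr(1)] by simp
      have "q = ?F (x c) (x r) * (q * sqrt (primitive g (x r) - primitive g (x c)))"
        using pos by simp
      also have "\<dots> \<le> ?F (x c) (x r) * (y r / r ^ (N - 1))"
      proof (rule mult_left_mono)
        have "y r \<le> y r / r ^ (N - 1)"
          by (rule quotient_power_bounds[of c]) (use r m c y0 in auto)
        with energy[of r] show "q * sqrt (primitive g (x r) - primitive g (x c)) \<le> y r / r ^ (N - 1)"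
          using r m by auto
      qed (use pos in simp)
      finally show "q \<le> ?F (x c) (x r) * (y r / r ^ (N - 1))" .
    qed (use m in auto)
    then have le: "q * (f - m) \<le> \<Psi> (x f)" by (simp add: \<Psi>_def)
    have "(?F (x c) has_integral \<Psi> (x f)) {x m..x f}"
      unfolding \<Psi>_def by (intro integrable_integral integrable_continuous_real F_cont)
    then have "(\<integral>\<^sup>+ \<xi>. ennreal (?F (x c) \<xi>) * indicator {x m..x f} \<xi> \<partial>lborel) = ennreal (\<Psi> (x f))"
      by (rule nn_integral_has_integral_lebesgue'[rotated]) (use gap in \<open>auto simp: less_imp_le\<close>)
    moreover have "(\<integral>\<^sup>+ \<xi>. ennreal (?F (x c) \<xi>) * indicator {x m..x f} \<xi> \<partial>lborel)
        \<le> (\<integral>\<^sup>+ \<xi>\<in>{x c<..}. ennreal (?F (x c) \<xi>) \<partial>lborel)"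
      using \<open>x c < x m\<close> by (intro nn_integral_mono) (auto simp: indicator_def)
    ultimately have "ennreal (\<Psi> (x f)) < ennreal (q * (f - m))"
      using K0[of "x c"] xc by simp
    moreover have "ennreal (q * (f - m)) \<le> ennreal (\<Psi> (x f))" using le by (rule ennreal_leI)
    ultimately show False by simp
  qed simp
qed

section \<open>Estimates on a hump of the weight\<close>

lemma y_decay:
  assumes S: "solves N w g c f x y" and cf: "0 < c" "c \<le> f"
    and w: "\<And>r. r \<in> {c..f} \<Longrightarrow> k \<le> w r" and k: "0 \<le> k"
    and x: "\<And>r. r \<in> {c..f} \<Longrightarrow> 0 < x r \<and> \<gamma> \<le> g (x r)" and \<gamma>: "0 \<le> \<gamma>"
  shows "y f \<le> y c - k * c ^ (N - 1) * \<gamma> * (f - c)"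
proof -
  have "y f - y c \<le> - (k * c ^ (N - 1) * \<gamma>) * (f - c)"
  proof (rule increment_le[OF cf(2) solves_y_deriv[OF S]])
    fix r assume r: "r \<in> {c..f}"
    have pw: "c ^ (N - 1) \<le> r ^ (N - 1)" "0 \<le> r ^ (N - 1)"
      using r cf by (auto intro: power_mono)
    have 1: "c ^ (N - 1) * k \<le> r ^ (N - 1) * w r"
      by (rule mult_mono) (use pw w[OF r] k in auto)
    have 2: "0 \<le> r ^ (N - 1) * w r"
      by (rule mult_nonneg_nonneg) (use pw w[OF r] k in auto)
    have "c ^ (N - 1) * k * \<gamma> \<le> r ^ (N - 1) * w r * extend g (x r)"
      by (rule mult_mono[OF 1 _ 2]) (use x[OF r] \<gamma> in auto)
    then show "- (r ^ (N - 1) * w r * extend g (x r)) \<le> - (k * c ^ (N - 1) * \<gamma>)"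
      by (simp add: mult_ac)
  qed
  then show ?thesis by simp
qed

text \<open>A positive solution on a hump of the weight satisfies a Harnack inequality in its interior;
  superlinearity at infinity then bounds it.\<close>

lemma hump_bound:
  assumes st: "0 < \<sigma>" "\<sigma> < \<tau>" "\<tau> \<le> 1" and b: "continuous_on {\<sigma>..\<tau>} b"
    and nonneg: "\<And>r. r \<in> {\<sigma>..\<tau>} \<Longrightarrow> 0 \<le> b r" and ne: "\<exists>r\<in>{\<sigma>..\<tau>}. b r \<noteq> 0"
  obtains R C where "\<And>w x y. solves N w g \<sigma> \<tau> x y \<Longrightarrow> (\<And>r. r \<in> {\<sigma>..\<tau>} \<Longrightarrow> w r = b r) \<Longrightarrow>
      (\<And>r. r \<in> {\<sigma>..\<tau>} \<Longrightarrow> 0 < x r) \<Longrightarrow> x \<sigma> \<le> R \<and> - C \<le> y \<tau>"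
proof -
  obtain c f k where cf: "\<sigma> < c" "c < f" "f < \<tau>" "0 < k" "\<And>r. r \<in> {c..f} \<Longrightarrow> k \<le> b r"
    using continuous_nonneg_bump[OF b st(2) nonneg ne] by blast
  \<comment> \<open>The flux is nonincreasing on the hump. If y r > 0, looking back to \<sigma>,
    where x > 0, gives y r (r - \<sigma>) <= x r; if y r < 0, looking ahead to \<tau> gives the
    mirror image. C1 covers both: |y| <= C1 x on [c,f].\<close>
  define C1 where "C1 = max (1 / (c - \<sigma>)) (1 / (\<tau> - f))"
  have C1: "0 < C1" "1 / (c - \<sigma>) \<le> C1" "1 / (\<tau> - f) \<le> C1"
    using cf by (auto simp: C1_def less_max_iff_disj)
  \<comment> \<open>Bound for the logarithmic derivative of x on [c,f]; integrating it yields the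
    Harnack constant \<kappa>.\<close>
  define \<Lambda> where "\<Lambda> = C1 / \<sigma> ^ (N - 1)"
  have \<Lambda>: "0 < \<Lambda>" using C1 st by (simp add: \<Lambda>_def)
  define \<kappa> where "\<kappa> = exp (- \<Lambda>)"
  have \<kappa>: "0 < \<kappa>" "\<kappa> \<le> 1" using \<Lambda> by (auto simp: \<kappa>_def)
  define P where "P = k * c ^ (N - 1) * (f - c) * \<kappa>"
  have P: "0 < P" using cf st \<kappa> by (simp add: P_def)
  \<comment> \<open>The factor is calibrated against the possible range of the flux: if x c > X0,
    then y drops by (2 C1 / \<kappa> + 1) x c across [c,f], whereas |y| <= C1 x c / \<kappa> at both
    ends.\<close>
  obtain U where U: "0 < U" "\<And>u. U \<le> u \<Longrightarrow> (2 * C1 / \<kappa> + 1) / P * u \<le> g u"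
    using g_superlinear by blast
  define X0 where "X0 = U / \<kappa>"
  have X0: "0 < X0" using U \<kappa> by (simp add: X0_def)
  define \<theta> where "\<theta> = C1 * (X0 / \<kappa>)"
  have \<theta>: "0 < \<theta>" using C1 X0 \<kappa> by (simp add: \<theta>_def)
  \<comment> \<open>Past f the flux is at most \<theta>, so x stays below R2 up to \<tau>. This
    bounds g(x), and with it the loss of flux on [f,\<tau>].\<close>
  define R2 where "R2 = X0 / \<kappa> + \<theta> / f ^ (N - 1)"
  have "continuous_on {0..R2} g" by (rule continuous_on_subset[OF g_cont]) auto
  then obtain Gm where Gm: "0 \<le> Gm" "\<And>u. u \<in> {0..R2} \<Longrightarrow> \<bar>g u\<bar> \<le> Gm"
    using continuous_on_interval_abs_bound by blast
  obtain Bm where Bm: "0 \<le> Bm" "\<And>r. r \<in> {\<sigma>..\<tau>} \<Longrightarrow> \<bar>b r\<bar> \<le> Bm"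
    using continuous_on_interval_abs_bound[OF b] by blast
  have "x \<sigma> \<le> X0 + C1 * X0 / \<sigma> ^ (N - 1) * (c - \<sigma>) \<and> - (\<theta> + Bm * Gm) \<le> y \<tau>"
    if S: "solves N w g \<sigma> \<tau> x y" and w: "\<And>r. r \<in> {\<sigma>..\<tau>} \<Longrightarrow> w r = b r"
      and x0: "\<And>r. r \<in> {\<sigma>..\<tau>} \<Longrightarrow> 0 < x r" for w x y
  proof -
    have anti: "y s \<le> y r" if "\<sigma> \<le> r" "r \<le> s" "s \<le> \<tau>" for r s
      by (rule y_antimono[OF S]) (use that st w nonneg in auto)
    have yu: "y r \<le> C1 * x r" if r: "r \<in> {c..f}" for r
    proof (cases "y r \<le> 0")
      case True
      have "0 \<le> C1 * x r" using C1 x0[of r] r cf by simp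
      with True show ?thesis by linarith
    next
      case False
      have "x \<sigma> + y r * (r - \<sigma>) \<le> x r"
        by (rule solves_x_growth[OF solves_subset[OF S]]) (use r cf st False anti in auto)
      moreover have "y r * (c - \<sigma>) \<le> y r * (r - \<sigma>)" using False r by (intro mult_left_mono) auto
      moreover have "0 < x \<sigma>" using x0 st by simp
      ultimately have "y r * (c - \<sigma>) \<le> x r" by linarith
      then have "y r \<le> 1 / (c - \<sigma>) * x r" using cf by (simp add: le_divide_eq)
      also have "\<dots> \<le> C1 * x r" using C1 x0[of r] r cf by (intro mult_right_mono) auto
      finally show ?thesis .
    qed
    have yl: "- (C1 * x r) \<le> y r" if r: "r \<in> {c..f}" for r
    proof (cases "0 \<le> y r")
      case True
      have "0 \<le> C1 * x r" using C1 x0[of r] r cf by simp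
      with True show ?thesis by linarith
    next
      case False
      have "x \<tau> \<le> x r - (- y r) * (\<tau> - r)"
        by (rule solves_x_decay[OF solves_subset[OF S]]) (use r cf st False anti in auto)
      moreover have "- y r * (\<tau> - f) \<le> - y r * (\<tau> - r)" using False r by (intro mult_left_mono) auto
      moreover have "0 < x \<tau>" using x0 st by simp
      ultimately have "- y r * (\<tau> - f) \<le> x r" by linarith
      then have "- y r \<le> 1 / (\<tau> - f) * x r" using cf by (simp add: le_divide_eq)
      also have "\<dots> \<le> C1 * x r" using C1 x0[of r] r cf by (intro mult_right_mono) auto
      finally show ?thesis by linarith
    qed
    have harnack: "\<bar>ln (x r) - ln (x c)\<bar> \<le> \<Lambda>" if r: "r \<in> {c..f}" for r
    proof -
      have S': "solves N w g c r x y" by (rule solves_subset[OF S]) (use cf r in auto)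
      have d: "((\<lambda>t. ln (x t)) has_real_derivative 1 / x t * (y t / t ^ (N - 1))) (at t within {c..r})"
        if "t \<in> {c..r}" for t
        using x0[of t] that r cf
        by (intro DERIV_chain2[OF DERIV_ln_divide solves_x_deriv[OF S' that]]) auto
      have bd: "- \<Lambda> \<le> 1 / x t * (y t / t ^ (N - 1))" "1 / x t * (y t / t ^ (N - 1)) \<le> \<Lambda>"
        if t: "t \<in> {c..r}" for t
      proof -
        have xt: "0 < x t" using x0[of t] t r cf by auto
        have "\<bar>y t\<bar> \<le> C1 * x t" using yu[of t] yl[of t] t r by auto
        then have "\<bar>y t\<bar> / x t \<le> C1" using xt by (simp add: divide_le_eq)
        then have "\<bar>y t\<bar> / x t / t ^ (N - 1) \<le> C1 / \<sigma> ^ (N - 1)"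
          using t cf st C1 by (intro frac_le power_mono) auto
        then have "\<bar>1 / x t * (y t / t ^ (N - 1))\<bar> \<le> \<Lambda>"
          using xt t cf st by (simp add: \<Lambda>_def abs_mult abs_divide mult.commute)
        then show "- \<Lambda> \<le> 1 / x t * (y t / t ^ (N - 1))" "1 / x t * (y t / t ^ (N - 1)) \<le> \<Lambda>"
          by linarith+
      qed
      have len: "r - c \<le> 1" "c \<le> r" using r cf st by auto
      have "- \<Lambda> * (r - c) \<le> ln (x r) - ln (x c)"
        by (rule increment_ge[OF len(2) d bd(1)])
      moreover have "ln (x r) - ln (x c) \<le> \<Lambda> * (r - c)"
        by (rule increment_le[OF len(2) d bd(2)])
      moreover have "\<Lambda> * (r - c) \<le> \<Lambda> * 1" using \<Lambda> len by (intro mult_left_mono) auto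
      ultimately show ?thesis by simp
    qed
    have lower: "\<kappa> * x c \<le> x r" and upper: "x r \<le> x c / \<kappa>" if r: "r \<in> {c..f}" for r
    proof -
      have pos: "0 < x r" "0 < x c" using x0[of r] x0[of c] r cf by auto
      have "exp (ln (x c) - \<Lambda>) \<le> exp (ln (x r))" "exp (ln (x r)) \<le> exp (ln (x c) + \<Lambda>)"
        using harnack[OF r] by auto
      then show "\<kappa> * x c \<le> x r" "x r \<le> x c / \<kappa>"
        using pos by (auto simp: \<kappa>_def exp_diff exp_add exp_minus field_simps)
    qed
    have xc_pos: "0 < x c" using x0[of c] cf by auto
    have xc: "x c \<le> X0"
    proof (rule ccontr)
      assume "\<not> x c \<le> X0"
      then have big: "U \<le> \<kappa> * x c" using \<kappa> by (simp add: X0_def field_simps)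
      let ?\<gamma> = "(2 * C1 / \<kappa> + 1) / P * (\<kappa> * x c)"
      have "y f \<le> y c - k * c ^ (N - 1) * ?\<gamma> * (f - c)"
      proof (rule y_decay[OF solves_subset[OF S]])
        show "0 < x r \<and> ?\<gamma> \<le> g (x r)" if r: "r \<in> {c..f}" for r
        proof
          show "0 < x r" using x0[of r] r cf by auto
          have "?\<gamma> \<le> (2 * C1 / \<kappa> + 1) / P * x r"
            using lower[OF r] C1 \<kappa> P by (intro mult_left_mono) auto
          also have "\<dots> \<le> g (x r)" using U(2)[of "x r"] lower[OF r] big by linarith
          finally show "?\<gamma> \<le> g (x r)" .
        qed
        show "0 \<le> ?\<gamma>" using C1 \<kappa> P xc_pos by simp
      qed (use cf st w in auto)
      moreover have "k * c ^ (N - 1) * ?\<gamma> * (f - c) = (2 * C1 / \<kappa> + 1) * x c"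
      proof -
        have "k * c ^ (N - 1) * ?\<gamma> * (f - c) = (2 * C1 / \<kappa> + 1) / P * x c * P"
          by (simp add: P_def mult_ac)
        then show ?thesis using P by simp
      qed
      moreover have "y c \<le> C1 * (x c / \<kappa>)"
      proof -
        have "y c \<le> C1 * x c" using yu[of c] cf by auto
        also have "\<dots> \<le> C1 * (x c / \<kappa>)"
          using C1 upper[of c] cf by (intro mult_left_mono) auto
        finally show ?thesis .
      qed
      moreover have "- (C1 * (x c / \<kappa>)) \<le> y f"
      proof -
        have "C1 * x f \<le> C1 * (x c / \<kappa>)"
          using C1 upper[of f] cf by (intro mult_left_mono) auto
        with yl[of f] cf show ?thesis by auto
      qed
      moreover have "(2 * C1 / \<kappa> + 1) * x c = 2 * (C1 * (x c / \<kappa>)) + x c"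
        by (simp add: distrib_right)
      ultimately show False using xc_pos by linarith
    qed
    have xf: "x f \<le> X0 / \<kappa>"
    proof -
      have "x f \<le> x c / \<kappa>" using upper[of f] cf by auto
      also have "\<dots> \<le> X0 / \<kappa>" using xc \<kappa> by (intro divide_right_mono) auto
      finally show ?thesis .
    qed
    have "x \<sigma> - C1 * X0 / \<sigma> ^ (N - 1) * (c - \<sigma>) \<le> x c"
    proof (rule solves_x_lower[OF solves_subset[OF S]])
      fix r assume r: "r \<in> {\<sigma>..c}"
      have "C1 * x c \<le> C1 * X0" using C1 xc by (intro mult_left_mono) auto
      moreover have "- (C1 * x c) \<le> y c" using yl[of c] cf by auto
      ultimately have "- (C1 * X0) \<le> y c" by linarith
      also have "y c \<le> y r" by (rule anti) (use r cf in auto)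
      finally show "- (C1 * X0) \<le> y r" .
    qed (use cf st C1 X0 in auto)
    moreover have "- (\<theta> + Bm * Gm) \<le> y \<tau>"
    proof -
      have ub: "y f \<le> \<theta>"
      proof -
        have "C1 * x f \<le> \<theta>" unfolding \<theta>_def using C1 xf by (intro mult_left_mono) auto
        with yu[of f] cf show ?thesis by auto
      qed
      have lb: "- \<theta> \<le> y f"
      proof -
        have "C1 * x f \<le> \<theta>" unfolding \<theta>_def using C1 xf by (intro mult_left_mono) auto
        with yl[of f] cf show ?thesis by auto
      qed
      have "- (Bm * Gm) * (\<tau> - f) \<le> y \<tau> - y f"
      proof (rule increment_ge[OF _ solves_y_deriv[OF solves_subset[OF S]]])
        fix r assume r: "r \<in> {f..\<tau>}"
        have "x r \<le> x f + \<theta> / f ^ (N - 1) * (r - f)"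
        proof (rule solves_x_upper[OF solves_subset[OF S]])
          fix s assume "s \<in> {f..r}"
          then show "y s \<le> \<theta>" using anti[of f s] r cf ub by auto
        qed (use cf st r \<theta> in auto)
        also have "\<dots> \<le> X0 / \<kappa> + \<theta> / f ^ (N - 1) * 1"
          using xf r cf st \<theta> by (intro add_mono mult_left_mono) auto
        finally have "x r \<le> R2" by (simp add: R2_def)
        moreover have xr: "0 < x r" using x0[of r] r cf by auto
        ultimately have gm: "\<bar>g (x r)\<bar> \<le> Gm" using Gm(2)[of "x r"] by simp
        have "r ^ (N - 1) * \<bar>w r\<bar> \<le> 1 * Bm"
          by (rule mult_mono) (use r cf st w[of r] Bm in \<open>auto intro: power_le_one\<close>)
        then have "r ^ (N - 1) * \<bar>w r\<bar> * \<bar>g (x r)\<bar> \<le> 1 * Bm * Gm"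
          by (rule mult_mono[OF _ gm]) (use Bm in auto)
        then have "\<bar>r ^ (N - 1) * w r * g (x r)\<bar> \<le> Bm * Gm"
          using r cf st by (simp add: abs_mult)
        then show "- (Bm * Gm) \<le> - (r ^ (N - 1) * w r * extend g (x r))"
          using xr by (simp add: abs_le_iff)
      qed (use cf in auto)
      moreover have "Bm * Gm * (\<tau> - f) \<le> Bm * Gm * 1"
        using cf st Bm Gm by (intro mult_left_mono) auto
      ultimately show ?thesis using lb by simp
    qed
    ultimately show ?thesis using xc by simp
  qed
  then show ?thesis by (rule that)
qed

text \<open>While x <= \<rho>, sublinearity of g at 0 limits the loss of flux on the hump to
  \<theta>, which is small against \<rho>; after reaching \<rho> the solution therefore falls by at
  most \<rho>/4.\<close>

lemma small_hump:
  assumes st: "0 < \<sigma>" "\<sigma> < \<tau>" "\<tau> \<le> 1" and b: "continuous_on {\<sigma>..\<tau>} b"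
    and nonneg: "\<And>r. r \<in> {\<sigma>..\<tau>} \<Longrightarrow> 0 \<le> b r"
  obtains \<rho> \<theta> where "0 < \<rho>" "0 \<le> \<theta>" "\<theta> / \<sigma> ^ (N - 1) \<le> \<rho> / 4"
    "\<And>w x y r0. solves N w g \<sigma> \<tau> x y \<Longrightarrow> (\<And>r. r \<in> {\<sigma>..\<tau>} \<Longrightarrow> w r = b r) \<Longrightarrow>
      0 \<le> y \<sigma> \<Longrightarrow> 0 < x \<sigma> \<Longrightarrow> (\<And>r. r \<in> {\<sigma>..\<tau>} \<Longrightarrow> x r \<le> \<rho>) \<Longrightarrow> r0 \<in> {\<sigma>..\<tau>} \<Longrightarrow> x r0 = \<rho> \<Longrightarrow>
      (\<forall>r\<in>{\<sigma>..\<tau>}. 0 < x r) \<and> 3 * \<rho> / 4 \<le> x \<tau> \<and> - \<theta> \<le> y \<tau>"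
proof -
  obtain Bm where Bm: "0 \<le> Bm" "\<And>r. r \<in> {\<sigma>..\<tau>} \<Longrightarrow> \<bar>b r\<bar> \<le> Bm"
    using continuous_on_interval_abs_bound[OF b] by blast
  \<comment> \<open>Solved from the requirement that \<theta> = Bm \<eta> \<rho> satisfy \<theta> /
    \<sigma>^(N-1) <= \<rho>/4, with Bm + 1 to avoid a zero denominator.\<close>
  define \<eta> where "\<eta> = \<sigma> ^ (N - 1) / (4 * (Bm + 1))"
  have \<eta>: "0 < \<eta>" using st Bm by (simp add: \<eta>_def)
  obtain \<rho> where \<rho>: "0 < \<rho>" "\<And>u. 0 < u \<Longrightarrow> u \<le> \<rho> \<Longrightarrow> g u \<le> \<eta> * u"
    using g_sublinear[OF \<eta>] by blast
  define \<theta> where "\<theta> = Bm * (\<eta> * \<rho>)"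
  have \<theta>: "0 \<le> \<theta>" using Bm \<eta> \<rho> by (simp add: \<theta>_def)
  have \<theta>\<rho>: "\<theta> / \<sigma> ^ (N - 1) \<le> \<rho> / 4"
  proof -
    have "\<theta> / \<sigma> ^ (N - 1) = Bm / (Bm + 1) * (\<rho> / 4)"
      using st Bm by (simp add: \<theta>_def \<eta>_def)
    also have "\<dots> \<le> 1 * (\<rho> / 4)"
      using Bm \<rho> by (intro mult_right_mono) auto
    finally show ?thesis by simp
  qed
  have "(\<forall>r\<in>{\<sigma>..\<tau>}. 0 < x r) \<and> 3 * \<rho> / 4 \<le> x \<tau> \<and> - \<theta> \<le> y \<tau>"
    if S: "solves N w g \<sigma> \<tau> x y" and w: "\<And>r. r \<in> {\<sigma>..\<tau>} \<Longrightarrow> w r = b r"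
      and y0: "0 \<le> y \<sigma>" and x0: "0 < x \<sigma>" and xr: "\<And>r. r \<in> {\<sigma>..\<tau>} \<Longrightarrow> x r \<le> \<rho>"
      and r0: "r0 \<in> {\<sigma>..\<tau>}" "x r0 = \<rho>" for w x y r0
  proof -
    have anti: "y s \<le> y r" if "\<sigma> \<le> r" "r \<le> s" "s \<le> \<tau>" for r s
      by (rule y_antimono[OF S]) (use that st w nonneg in auto)
    have yl: "- \<theta> \<le> y r" if r: "r \<in> {\<sigma>..\<tau>}" for r
    proof -
      have "- \<theta> * (r - \<sigma>) \<le> y r - y \<sigma>"
      proof (rule increment_ge[OF _ solves_y_deriv[OF solves_subset[OF S]]])
        fix t assume t: "t \<in> {\<sigma>..r}"
        have e: "extend g (x t) \<le> \<eta> * \<rho>"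
        proof (cases "0 < x t")
          case True
          have "g (x t) \<le> \<eta> * x t" using \<rho>(2)[OF True] xr[of t] t r by auto
          also have "\<dots> \<le> \<eta> * \<rho>" using \<eta> xr[of t] t r by (intro mult_left_mono) auto
          finally show ?thesis using True by simp
        qed (use \<eta> \<rho> in simp)
        have wt: "w t \<le> Bm" "0 \<le> w t" using w[of t] Bm(2)[of t] nonneg[of t] t r by auto
        have "t ^ (N - 1) * w t \<le> 1 * Bm"
          by (rule mult_mono) (use wt t r st Bm in \<open>auto intro: power_le_one\<close>)
        then have "t ^ (N - 1) * w t * extend g (x t) \<le> 1 * Bm * (\<eta> * \<rho>)"
          by (rule mult_mono[OF _ e]) (use extend_nonneg Bm in auto)
        then show "- \<theta> \<le> - (t ^ (N - 1) * w t * extend g (x t))" by (simp add: \<theta>_def)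
      qed (use r in auto)
      moreover have "\<theta> * (r - \<sigma>) \<le> \<theta> * 1" using r st \<theta> by (intro mult_left_mono) auto
      ultimately show ?thesis using y0 by simp
    qed
    have after: "3 * \<rho> / 4 \<le> x r" if r: "r \<in> {r0..\<tau>}" for r
    proof -
      have "x r0 - \<theta> / r0 ^ (N - 1) * (r - r0) \<le> x r"
        by (rule solves_x_lower[OF solves_subset[OF S]]) (use r0 r st yl \<theta> in auto)
      moreover have "\<theta> / r0 ^ (N - 1) * (r - r0) \<le> \<theta> / \<sigma> ^ (N - 1) * 1"
        using r0 r st \<theta> by (intro mult_mono divide_left_mono power_mono) auto
      ultimately show ?thesis using \<theta>\<rho> r0(2) by linarith
    qed
    \<comment> \<open>A nonincreasing flux lets x first rise and then fall, so before r0 it is at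
      least the smaller of x \<sigma> and x r0 = \<rho>.\<close>
    have "0 < x r" if r: "r \<in> {\<sigma>..\<tau>}" for r
    proof (cases "r0 \<le> r")
      case True
      then show ?thesis using after[of r] r \<rho> by auto
    next
      case before: False
      show ?thesis
      proof (cases "y r \<le> 0")
        case True
        have "x r0 \<le> x r"
        proof (rule solves_x_antimono[OF solves_subset[OF S]])
          fix s assume "s \<in> {r..r0}"
          then show "y s \<le> 0" using anti[of r s] True r r0 by auto
        qed (use r r0 st before in auto)
        then show ?thesis using r0 \<rho> by simp
      next
        case False
        have "x \<sigma> \<le> x r"
        proof (rule solves_x_mono[OF solves_subset[OF S]])
          fix s assume "s \<in> {\<sigma>..r}"
          then show "0 \<le> y s" using anti[of s r] False r by auto
        qed (use r st in auto)
        then show ?thesis using x0 by simp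
      qed
    qed
    then show ?thesis using after[of \<tau>] yl[of \<tau>] r0 st by auto
  qed
  with \<rho>(1) \<theta> \<theta>\<rho> show ?thesis by (rule that)
qed

text \<open>The flux can only increase here, so it stays above -\<theta>, and x loses at most a
  further \<rho>/4.\<close>

lemma negative_interval_stays_large:
  assumes S: "solves N w g l h x y" and lh: "0 < l" "l \<le> h" "h \<le> 1"
    and w: "\<And>r. r \<in> {l..h} \<Longrightarrow> w r \<le> 0"
    and \<theta>: "0 \<le> \<theta>" "\<theta> / l ^ (N - 1) \<le> \<rho> / 4" and x: "3 * \<rho> / 4 \<le> x l" and y: "- \<theta> \<le> y l"
  shows "\<rho> / 2 \<le> x h"
proof -
  have "x l - \<theta> / l ^ (N - 1) * (h - l) \<le> x h"
  proof (rule solves_x_lower[OF S lh _ \<theta>(1)])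
    fix r assume "r \<in> {l..h}"
    then show "- \<theta> \<le> y r" using y_mono[OF S _ w, of l r] lh y by auto
  qed
  moreover have "\<theta> / l ^ (N - 1) * (h - l) \<le> \<theta> / l ^ (N - 1) * 1"
    using lh \<theta> by (intro mult_left_mono) auto
  ultimately show ?thesis using \<theta>(2) x by linarith
qed

text \<open>Since x stays above \<rho>/2, g(x) >= \<gamma>. On [c,c1] the factor \<mu> drives the
  flux up, on [c1,c2] this flux lifts x by K, and on [c2,f] \<open>blow_up\<close> takes over. As f
  < s is chosen before \<mu>, the blow-up is strictly inside the interval.\<close>

lemma medium_blow_up:
  assumes ts: "0 < \<tau>" "\<tau> < s" "s \<le> 1" and a: "continuous_on {\<tau>..s} a"
    and nonpos: "\<And>r. r \<in> {\<tau>..s} \<Longrightarrow> a r \<le> 0" and ne: "\<exists>r\<in>{\<tau>..s}. a r \<noteq> 0"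
    and \<rho>: "0 < \<rho>" and \<theta>: "0 \<le> \<theta>" "\<theta> / \<tau> ^ (N - 1) \<le> \<rho> / 4"
  obtains f \<mu>0 where "\<tau> < f" "f < s" "1 \<le> \<mu>0"
    "\<And>\<mu> w x y. \<mu>0 < \<mu> \<Longrightarrow> (\<And>r. r \<in> {\<tau>..s} \<Longrightarrow> w r = \<mu> * a r) \<Longrightarrow> solves N w g \<tau> f x y \<Longrightarrow>
      3 * \<rho> / 4 \<le> x \<tau> \<Longrightarrow> - \<theta> \<le> y \<tau> \<Longrightarrow> False"
proof -
  have "continuous_on {\<tau>..s} (\<lambda>r. - a r)" by (intro continuous_intros a)
  then obtain c f k where cf: "\<tau> < c" "c < f" "f < s" "0 < k" "\<And>r. r \<in> {c..f} \<Longrightarrow> k \<le> - a r"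
    by (rule continuous_nonneg_bump) (use ts nonpos ne in auto)
  obtain c1 where c1: "c < c1" "c1 < f" using dense[OF cf(2)] by blast
  obtain c2 where c2: "c1 < c2" "c2 < f" using dense[OF c1(2)] by blast
  obtain K where K: "0 < K" "\<And>w x y. solves N w g c2 f x y \<Longrightarrow> (\<And>r. r \<in> {c2..f} \<Longrightarrow> w r \<le> - k) \<Longrightarrow>
      K \<le> x c2 \<Longrightarrow> 0 \<le> y c2 \<Longrightarrow> False"
    by (rule blow_up[of c2 f k]) (use ts cf c1 c2 in auto)
  obtain \<gamma> where \<gamma>: "0 < \<gamma>" "\<And>u. \<rho> / 2 \<le> u \<Longrightarrow> \<gamma> \<le> g u"
    by (rule g_lower_bound[of "\<rho> / 2"]) (use \<rho> in auto)
  define P where "P = k * c ^ (N - 1) * \<gamma> * (c1 - c)"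
  have P: "0 < P" using cf c1 ts \<gamma> by (simp add: P_def)
  \<comment> \<open>The flux is at least -\<theta> at c and has to reach K / (c2 - c1) at c1, while
    [c,c1] contributes at least \<mu> P.\<close>
  define \<mu>0 where "\<mu>0 = max 1 ((\<theta> + K / (c2 - c1)) / P)"
  have False if \<mu>: "\<mu>0 < \<mu>" and w: "\<And>r. r \<in> {\<tau>..s} \<Longrightarrow> w r = \<mu> * a r"
    and S: "solves N w g \<tau> f x y" and x: "3 * \<rho> / 4 \<le> x \<tau>" and y: "- \<theta> \<le> y \<tau>" for \<mu> w x y
  proof -
    have \<mu>1: "1 < \<mu>" "\<theta> + K / (c2 - c1) \<le> \<mu> * P"
      using \<mu> P by (auto simp: \<mu>0_def divide_less_eq)
    have w0: "w r \<le> 0" if "r \<in> {\<tau>..f}" for r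
      using w[of r] nonpos[of r] that cf \<mu>1 by (auto simp: mult_nonneg_nonpos)
    have wk: "w r \<le> - (\<mu> * k)" if "r \<in> {c..f}" for r
      using w[of r] cf(5)[OF that] that cf \<mu>1 mult_left_mono[of k "- a r" \<mu>] by auto
    have mono: "y r \<le> y t" if "\<tau> \<le> r" "r \<le> t" "t \<le> f" for r t
      by (rule y_mono[OF S _ w0]) (use that ts in auto)
    have large: "\<rho> / 2 \<le> x r" if r: "r \<in> {\<tau>..f}" for r
      by (rule negative_interval_stays_large[OF solves_subset[OF S] _ _ _ _ \<theta> x y])
        (use r ts cf w0 in auto)
    have "y c + \<mu> * k * c ^ (N - 1) * \<gamma> * (c1 - c) \<le> y c1"
    proof (rule y_growth[OF solves_subset[OF S]])
      fix r assume r: "r \<in> {c..c1}"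
      then have "\<rho> / 2 \<le> x r" using large[of r] cf c1 by auto
      then show "0 < x r \<and> \<gamma> \<le> g (x r)" using \<gamma>(2) \<rho> by auto
    qed (use ts cf c1 wk \<mu>1 \<gamma> in auto)
    moreover have "\<mu> * k * c ^ (N - 1) * \<gamma> * (c1 - c) = \<mu> * P" by (simp add: P_def mult_ac)
    moreover have "- \<theta> \<le> y c" using mono[of \<tau> c] y cf by auto
    ultimately have yc1: "K / (c2 - c1) \<le> y c1" using \<mu>1 by linarith
    have pos: "0 < K / (c2 - c1)" using K c2 by simp
    have "x c1 + K / (c2 - c1) * (c2 - c1) \<le> x c2"
    proof (rule solves_x_growth[OF solves_subset[OF S]])
      fix r assume "r \<in> {c1..c2}"
      then show "K / (c2 - c1) \<le> y r" using mono[of c1 r] yc1 cf c1 c2 by auto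
    qed (use ts cf c1 c2 K in auto)
    then have "x c1 + K \<le> x c2" using c2 by simp
    moreover have "0 < x c1" using large[of c1] cf c1 \<rho> by auto
    ultimately have "K \<le> x c2" by simp
    moreover have "0 \<le> y c2" using mono[of c1 c2] yc1 pos cf c1 c2 by auto
    moreover have "w r \<le> - k" if "r \<in> {c2..f}" for r
    proof -
      have "k \<le> \<mu> * k" using \<mu>1 cf by simp
      then show ?thesis using wk[of r] that c1 c2 by auto
    qed
    ultimately show False using K(2)[OF solves_subset[OF S]] cf c1 c2 by auto
  qed
  then show ?thesis using that[of f \<mu>0] cf by (auto simp: \<mu>0_def)
qed

text \<open>The flux is nondecreasing and ends at 0, so it rises by at most C and x is
  nonincreasing. If x h > \<delta>, then x > \<delta> on the whole interval and the flux rises by at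
  least \<mu> P, which exceeds C for large \<mu>.\<close>

lemma turning_point_small:
  assumes lh: "0 \<le> l" "l < h" "h \<le> 1" and a: "continuous_on {l..h} a"
    and nonpos: "\<And>r. r \<in> {l..h} \<Longrightarrow> a r \<le> 0" and ne: "\<exists>r\<in>{l..h}. a r \<noteq> 0" and \<delta>: "0 < \<delta>"
  obtains \<mu>0 where "1 \<le> \<mu>0"
    "\<And>\<mu> w x y. \<mu>0 < \<mu> \<Longrightarrow> (\<And>r. r \<in> {l..h} \<Longrightarrow> w r = \<mu> * a r) \<Longrightarrow> solves N w g l h x y \<Longrightarrow>
      - C \<le> y l \<Longrightarrow> y h = 0 \<Longrightarrow> x h \<le> \<delta>"
proof -
  have "continuous_on {l..h} (\<lambda>r. - a r)" by (intro continuous_intros a)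
  then obtain c f k where cf: "l < c" "c < f" "f < h" "0 < k" "\<And>r. r \<in> {c..f} \<Longrightarrow> k \<le> - a r"
    by (rule continuous_nonneg_bump) (use lh nonpos ne in auto)
  obtain \<gamma> where \<gamma>: "0 < \<gamma>" "\<And>u. \<delta> \<le> u \<Longrightarrow> \<gamma> \<le> g u" using g_lower_bound[OF \<delta>] by blast
  define P where "P = k * c ^ (N - 1) * \<gamma> * (f - c)"
  have P: "0 < P" using cf lh \<gamma> by (simp add: P_def)
  have "x h \<le> \<delta>" if \<mu>: "max 1 (C / P) < \<mu>" and w: "\<And>r. r \<in> {l..h} \<Longrightarrow> w r = \<mu> * a r"
    and S: "solves N w g l h x y" and y: "- C \<le> y l" "y h = 0" for \<mu> w x y
  proof (rule ccontr)
    assume x: "\<not> x h \<le> \<delta>"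
    have \<mu>1: "1 < \<mu>" "C < \<mu> * P" using \<mu> P by (auto simp: divide_less_eq)
    have w0: "w r \<le> 0" if "r \<in> {l..h}" for r
      using w[of r] nonpos[of r] that \<mu>1 by (auto simp: mult_nonneg_nonpos)
    have wk: "w r \<le> - (\<mu> * k)" if "r \<in> {c..f}" for r
      using w[of r] cf(5)[OF that] that cf \<mu>1 mult_left_mono[of k "- a r" \<mu>] by auto
    have mono: "y r \<le> y t" if "l \<le> r" "r \<le> t" "t \<le> h" for r t
      by (rule y_mono[OF S _ w0]) (use that lh in auto)
    have large: "\<delta> \<le> x r" if r: "r \<in> {l..h}" for r
    proof -
      have "x h \<le> x r"
      proof (rule solves_x_antimono[OF solves_subset[OF S]])
        fix t assume "t \<in> {r..h}"
        then show "y t \<le> 0" using mono[of t h] y r by auto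
      qed (use r lh in auto)
      with x show ?thesis by simp
    qed
    have "y c + \<mu> * k * c ^ (N - 1) * \<gamma> * (f - c) \<le> y f"
    proof (rule y_growth[OF solves_subset[OF S]])
      fix r assume r: "r \<in> {c..f}"
      then have "\<delta> \<le> x r" using large[of r] cf by auto
      then show "0 < x r \<and> \<gamma> \<le> g (x r)" using \<gamma>(2) \<delta> by auto
    qed (use lh cf wk \<mu>1 \<gamma> in auto)
    moreover have "\<mu> * k * c ^ (N - 1) * \<gamma> * (f - c) = \<mu> * P" by (simp add: P_def mult_ac)
    moreover have "- C \<le> y c" "y f \<le> 0" using mono[of l c] mono[of f h] y cf by auto
    ultimately show False using \<mu>1 by linarith
  qed
  then show ?thesis using that[of "max 1 (C / P)"] by auto
qed

end

section \<open>Shooting\<close>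

text \<open>The complement of P is relatively open in [p,q], so the set where P holds is compact and
  contains its supremum.\<close>

lemma last_point:
  fixes p q :: real
  assumes pq: "p \<le> q" and P: "P p"
    and op: "\<And>s. s \<in> {p..q} \<Longrightarrow> \<not> P s \<Longrightarrow> \<exists>\<delta>>0. \<forall>s'\<in>{p..q}. \<bar>s' - s\<bar> < \<delta> \<longrightarrow> \<not> P s'"
  obtains s where "s \<in> {p..q}" "P s" "\<And>s'. s < s' \<Longrightarrow> s' \<le> q \<Longrightarrow> \<not> P s'"
proof -
  let ?A = "{s\<in>{p..q}. P s}"
  have A: "?A \<noteq> {}" "bdd_above ?A" using pq P by (auto intro: bdd_aboveI[of _ q])
  define s where "s = Sup ?A"
  have s: "s \<in> {p..q}"
    unfolding s_def using A pq P by (auto intro!: cSup_upper cSup_least)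
  moreover have "\<not> P s'" if "s < s'" "s' \<le> q" for s'
  proof
    assume "P s'"
    then have "s' \<le> s" unfolding s_def using that s A(2) by (intro cSup_upper) auto
    with that show False by simp
  qed
  moreover have "P s"
  proof (rule ccontr)
    assume "\<not> P s"
    then obtain \<delta> where \<delta>: "\<delta> > 0" "\<And>s'. s' \<in> {p..q} \<Longrightarrow> \<bar>s' - s\<bar> < \<delta> \<Longrightarrow> \<not> P s'"
      using op[OF s] by blast
    then obtain s' where s': "s' \<in> ?A" "s - \<delta> < s'"
      using less_cSupD[OF A(1), of "s - \<delta>"] by (auto simp: s_def)
    have "s' \<le> s" unfolding s_def using s' A(2) by (intro cSup_upper)
    with \<delta> s' show False by auto
  qed
  ultimately show ?thesis using that by blast
qed

lemma first_point:
  fixes p q :: real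
  assumes pq: "p \<le> q" and P: "P q"
    and op: "\<And>s. s \<in> {p..q} \<Longrightarrow> \<not> P s \<Longrightarrow> \<exists>\<delta>>0. \<forall>s'\<in>{p..q}. \<bar>s' - s\<bar> < \<delta> \<longrightarrow> \<not> P s'"
  obtains s where "s \<in> {p..q}" "P s" "\<And>s'. p \<le> s' \<Longrightarrow> s' < s \<Longrightarrow> \<not> P s'"
proof -
  have op': "\<exists>\<delta>>0. \<forall>s'\<in>{-q..-p}. \<bar>s' - s\<bar> < \<delta> \<longrightarrow> \<not> P (- s')"
    if s: "s \<in> {-q..-p}" and np: "\<not> P (- s)" for s
  proof -
    have "- s \<in> {p..q}" using s by auto
    from op[OF this np] obtain \<delta> where \<delta>: "\<delta> > 0"
      "\<And>s'. s' \<in> {p..q} \<Longrightarrow> \<bar>s' - - s\<bar> < \<delta> \<Longrightarrow> \<not> P s'" by blast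
    have "\<not> P (- s')" if "s' \<in> {-q..-p}" "\<bar>s' - s\<bar> < \<delta>" for s'
      by (rule \<delta>(2)) (use that in auto)
    with \<delta>(1) show ?thesis by blast
  qed
  obtain s where "s \<in> {-q..-p}" "P (- s)" "\<And>s'. s < s' \<Longrightarrow> s' \<le> - p \<Longrightarrow> \<not> P (- s')"
    by (rule last_point[of "- q" "- p" "\<lambda>s. P (- s)"]) (use pq P op' in auto)
  with that[of "- s"] show ?thesis by (metis add.inverse_inverse atLeastAtMost_iff minus_le_iff minus_less_iff neg_le_iff_le le_minus_iff)
qed

locale shooting = shooting_ode N w g + superlinear N g for N w g
begin

section \<open>Solutions that reach zero\<close>

definition hits :: "real \<Rightarrow> real \<Rightarrow> bool" where
  "hits d r \<longleftrightarrow> (\<exists>t\<in>{0..r}. defined d t \<and> X d t \<le> 0)"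

lemma hits_mono: "hits d r \<Longrightarrow> r \<le> r' \<Longrightarrow> hits d r'"
  unfolding hits_def by force

lemma not_hits_pos: "\<not> hits d r \<Longrightarrow> t \<in> {0..r} \<Longrightarrow> defined d t \<Longrightarrow> 0 < X d t"
  unfolding hits_def by (meson not_less)

lemma solves_XY: "defined d h \<Longrightarrow> 0 \<le> l \<Longrightarrow> h \<le> 1 \<Longrightarrow> solves N w g l h (X d) (Y d)"
  using solves_subset[OF solves_X] by blast

text \<open>The truncated nonlinearity vanishes at nonpositive values, so the constant d is itself a
  fixed point.\<close>

lemma sol_nonpos:
  assumes d: "d \<le> 0" and r: "r \<in> {0..1}"
  shows "sol n d r = d"
proof -
  obtain L W where "radial_ode w (trunc n) L W" using trunc_ode by blast
  then interpret R: radial_ode N w "trunc n" L W .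
  have "trunc n d = 0" using d g_0 by (simp add: trunc_def max_def min_def)
  then have fl: "R.flux (\<lambda>_. d) s = 0" for s by (simp add: R.flux_def)
  have "\<bar>sol n d r - (\<lambda>_. d) r\<bar> \<le> 2 * \<bar>d - d\<bar> * exp R.lam"
    by (rule R.picard_dependence[of 1 "sol n d" "\<lambda>_. d"])
      (use r sol_cont[of 1] sol_eq in \<open>auto simp: R.picard_def fl\<close>)
  then show ?thesis by simp
qed

lemma nonpos_data:
  assumes d: "d \<le> 0"
  shows "defined d 1" "r \<in> {0..1} \<Longrightarrow> X d r = d" "r \<in> {0..1} \<Longrightarrow> Y d r = 0"
proof -
  obtain n :: nat where "d < real n" using reals_Archimedean2 by blast
  then have n: "\<And>t. t \<in> {0..1} \<Longrightarrow> sol n d t < real n" using sol_nonpos[OF d] by simp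
  then show "defined d 1" unfolding defined_def by blast
  show x: "X d r = d" if "r \<in> {0..1}" for r
    using X_eq[OF _ n that] sol_nonpos[OF d that] by simp
  show "Y d r = 0" if "r \<in> {0..1}" for r
  proof -
    have "integral {0..r} (\<lambda>s. s ^ (N - 1) * w s * extend g (X d s)) = integral {0..r} (\<lambda>_. 0)"
      by (rule integral_cong) (use x that d in auto)
    then show ?thesis by (simp add: Y_def)
  qed
qed

text \<open>Uniqueness at the trivial solution, from \<open>\<bar>(x\<^sup>2 + y\<^sup>2)'\<bar> \<le> M * (x\<^sup>2 + y\<^sup>2)\<close> backwards in time.\<close>

lemma no_double_zero:
  assumes D: "defined d T" and T: "0 < T" "T \<le> 1" and zero: "X d T = 0" "Y d T = 0"
  shows "d = 0"
proof -
  obtain Xm where Xm: "0 \<le> Xm" "\<And>r. r \<in> {0..T} \<Longrightarrow> \<bar>X d r\<bar> \<le> Xm"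
    using continuous_on_interval_abs_bound[OF X_cont[OF D T(2)]] by blast
  obtain n :: nat where n: "Xm < real n" using reals_Archimedean2 by blast
  obtain L W where "radial_ode w (trunc n) L W" using trunc_ode by blast
  then interpret R: radial_ode N w "trunc n" L W .
  have lin: "\<bar>extend g (X d r)\<bar> \<le> L * \<bar>X d r\<bar>" if "r \<in> {0..T}" for r
  proof -
    have "trunc n 0 = 0" using g_0 by (simp add: trunc_def)
    moreover have "trunc n (X d r) = extend g (X d r)"
      by (rule trunc_eq) (use Xm(2)[OF that] n in auto)
    ultimately show ?thesis using R.h_lip[of "X d r" 0] by simp
  qed
  \<comment> \<open>The differential inequality is used on [\<delta>,T] only, as r^(1-N) may be
    unbounded at 0; continuity then carries X d = 0 to the centre.\<close>
  have "X d \<delta> = 0" if \<delta>: "\<delta> \<in> {0<..<T}" for \<delta>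
  proof -
    \<comment> \<open>M dominates the relative rate of decrease of X^2 + Y^2, so after
      multiplication by exp (M r) this sum is nondecreasing; it is nonnegative and ends at
      0.\<close>
    define M where "M = 1 / \<delta> ^ (N - 1) + W * L"
    let ?\<phi> = "\<lambda>r. ((X d r)\<^sup>2 + (Y d r)\<^sup>2) * exp (M * r)"
    let ?x' = "\<lambda>r. Y d r / r ^ (N - 1)" and ?y' = "\<lambda>r. - (r ^ (N - 1) * w r * extend g (X d r))"
    have S: "solves N w g \<delta> T (X d) (Y d)" by (rule solves_XY[OF D]) (use \<delta> T in auto)
    have "0 * (T - \<delta>) \<le> ?\<phi> T - ?\<phi> \<delta>"
    proof (rule increment_ge)
      fix r assume r: "r \<in> {\<delta>..T}"
      show "(?\<phi> has_real_derivative (2 * X d r * ?x' r + 2 * Y d r * ?y' r + M * ((X d r)\<^sup>2 + (Y d r)\<^sup>2)) * exp (M * r))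
          (at r within {\<delta>..T})"
        by (rule derivative_eq_intros refl solves_x_deriv[OF S r] solves_y_deriv[OF S r])+
          (simp add: algebra_simps)
      have W: "0 \<le> W" "0 \<le> L" by (rule R.W_nonneg R.L_nonneg)+
      have 1: "\<bar>?x' r\<bar> \<le> 1 / \<delta> ^ (N - 1) * \<bar>Y d r\<bar>"
        using quotient_power_bounds(2)[of \<delta> r "\<bar>Y d r\<bar>" "N - 1"] r \<delta> T by (simp add: abs_divide)
      have 2: "\<bar>?y' r\<bar> \<le> W * L * \<bar>X d r\<bar>"
      proof -
        have "r ^ (N - 1) * \<bar>w r\<bar> \<le> 1 * W"
          by (rule mult_mono) (use r \<delta> T R.w_bound[of r] in \<open>auto intro: power_le_one\<close>)
        then have "r ^ (N - 1) * \<bar>w r\<bar> * \<bar>extend g (X d r)\<bar> \<le> 1 * W * (L * \<bar>X d r\<bar>)"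
          by (rule mult_mono) (use lin[of r] r \<delta> W in auto)
        then show ?thesis using r \<delta> by (simp add: abs_mult)
      qed
      have xy: "2 * (\<bar>X d r\<bar> * \<bar>Y d r\<bar>) \<le> (X d r)\<^sup>2 + (Y d r)\<^sup>2"
        using sum_squares_bound[of "\<bar>X d r\<bar>" "\<bar>Y d r\<bar>"] by simp
      have "- (2 * X d r * ?x' r) \<le> 2 * \<bar>X d r\<bar> * \<bar>?x' r\<bar>"
        using abs_ge_minus_self[of "2 * X d r * ?x' r"] by (simp add: abs_mult)
      also have "\<dots> \<le> 2 * \<bar>X d r\<bar> * (1 / \<delta> ^ (N - 1) * \<bar>Y d r\<bar>)"
        by (rule mult_left_mono[OF 1]) simp
      also have "\<dots> = 1 / \<delta> ^ (N - 1) * (2 * (\<bar>X d r\<bar> * \<bar>Y d r\<bar>))" by simp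
      also have "\<dots> \<le> 1 / \<delta> ^ (N - 1) * ((X d r)\<^sup>2 + (Y d r)\<^sup>2)"
        by (rule mult_left_mono[OF xy]) (use \<delta> in simp)
      finally have 3: "- (2 * X d r * ?x' r) \<le> 1 / \<delta> ^ (N - 1) * ((X d r)\<^sup>2 + (Y d r)\<^sup>2)" .
      have "- (2 * Y d r * ?y' r) \<le> 2 * \<bar>Y d r\<bar> * \<bar>?y' r\<bar>"
        using abs_ge_minus_self[of "2 * Y d r * ?y' r"] by (simp add: abs_mult)
      also have "\<dots> \<le> 2 * \<bar>Y d r\<bar> * (W * L * \<bar>X d r\<bar>)"
        by (rule mult_left_mono[OF 2]) simp
      also have "\<dots> = W * L * (2 * (\<bar>X d r\<bar> * \<bar>Y d r\<bar>))" by simp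
      also have "\<dots> \<le> W * L * ((X d r)\<^sup>2 + (Y d r)\<^sup>2)"
        by (rule mult_left_mono[OF xy]) (use W in simp)
      finally have "0 \<le> 2 * X d r * ?x' r + 2 * Y d r * ?y' r + M * ((X d r)\<^sup>2 + (Y d r)\<^sup>2)"
        using 3 unfolding M_def distrib_right by linarith
      then show "0 \<le> (2 * X d r * ?x' r + 2 * Y d r * ?y' r + M * ((X d r)\<^sup>2 + (Y d r)\<^sup>2)) * exp (M * r)"
        by (rule mult_nonneg_nonneg) simp
    qed (use \<delta> in auto)
    then have "((X d \<delta>)\<^sup>2 + (Y d \<delta>)\<^sup>2) * exp (M * \<delta>) \<le> 0" using zero by simp
    then have "(X d \<delta>)\<^sup>2 + (Y d \<delta>)\<^sup>2 \<le> 0" by (simp add: mult_le_0_iff)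
    then have "(X d \<delta>)\<^sup>2 \<le> 0" using zero_le_power2[of "Y d \<delta>"] by linarith
    then show ?thesis by simp
  qed
  moreover have "closure {0<..<T} = {0..T}" using T by (simp add: closure_greaterThanLessThan)
  ultimately have "X d 0 = 0"
    using continuous_constant_on_closure[of "{0<..<T}" "X d" 0 0] X_cont[OF D T(2)] T by simp
  then show ?thesis by simp
qed

text \<open>At the first zero the flux is negative: a positive flux contradicts the positivity
  before, and flux 0 is excluded by \<open>no_double_zero\<close>. Below 0 the nonlinearity is
  switched off, so the flux stays constant and the solution decreases for good; in particular it
  cannot blow up. For d <= 0 the solution is constant.\<close>

lemma after_hit:
  assumes "hits d r" and r: "0 \<le> r" "r \<le> 1"
  shows "defined d 1" "s \<in> {r..1} \<Longrightarrow> X d s \<le> 0" "s \<in> {r..1} \<Longrightarrow> Y d s \<le> 0"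
proof -
  have "defined d 1 \<and> (\<forall>s\<in>{r..1}. X d s \<le> 0 \<and> Y d s \<le> 0)"
  proof (cases "d \<le> 0")
    case True
    have "X d s \<le> 0 \<and> Y d s \<le> 0" if "s \<in> {r..1}" for s
    proof -
      have s: "s \<in> {0..1}" using that r by auto
      show ?thesis using nonpos_data(2,3)[OF True s] True by simp
    qed
    with nonpos_data(1)[OF True] show ?thesis by blast
  next
    case False
    obtain t where t: "t \<in> {0..r}" "defined d t" "X d t \<le> 0"
      using assms(1) unfolding hits_def by blast
    have "continuous_on {0..t} (\<lambda>s. - X d s)"
      by (rule continuous_on_minus[OF X_cont[OF t(2)]]) (use t r in auto)
    then obtain T where T: "0 < T" "T \<le> t" "X d T = 0" "\<And>s. 0 \<le> s \<Longrightarrow> s < T \<Longrightarrow> 0 < X d s"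
      using first_hit[of 0 t "\<lambda>s. - X d s" 0] t(1,3) False by auto
    have DT: "defined d T" and T1: "T \<le> 1" using defined_mono[OF t(2) T(2)] T t r by auto
    have "Y d T \<noteq> 0" using no_double_zero[OF DT T(1) T1 T(3)] False by auto
    moreover have "\<not> 0 < Y d T"
    proof
      assume Ypos: "0 < Y d T"
      obtain \<delta> where \<delta>: "\<delta> > 0" "\<And>s. s \<in> {0..T} \<Longrightarrow> \<bar>s - T\<bar> < \<delta> \<Longrightarrow> \<bar>Y d s - Y d T\<bar> < Y d T"
        using Y_cont[OF DT T1, unfolded continuous_on_iff, rule_format, of T "Y d T"] T Ypos
        by (auto simp: dist_real_def)
      define l where "l = max 0 (T - \<delta> / 2)"
      have l: "0 \<le> l" "l < T" using \<delta> T by (auto simp: l_def)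
      have "X d l \<le> X d T"
      proof (rule solves_x_mono[OF solves_XY[OF DT]])
        fix s assume "s \<in> {l..T}"
        then have "\<bar>Y d s - Y d T\<bar> < Y d T" by (intro \<delta>(2)) (use \<delta>(1) in \<open>auto simp: l_def\<close>)
        then show "0 \<le> Y d s" by linarith
      qed (use l T1 in auto)
      with T(3) T(4)[of l] l show False by simp
    qed
    ultimately have YT: "Y d T < 0" by simp
    have Y_const: "Y d s = Y d T" if s: "T \<le> s" "s \<le> 1" "defined d s" and np: "\<And>q. q \<in> {T..s} \<Longrightarrow> X d q \<le> 0" for s
    proof -
      have S: "solves N w g T s (X d) (Y d)" by (rule solves_XY[OF s(3)]) (use s T in auto)
      have "0 * (s - T) \<le> Y d s - Y d T" "Y d s - Y d T \<le> 0 * (s - T)"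
        using increment_ge[OF s(1) solves_y_deriv[OF S], of 0] increment_le[OF s(1) solves_y_deriv[OF S], of 0] np
        by auto
      then show ?thesis by simp
    qed
    have neg: "X d s \<le> 0" if s: "T \<le> s" "s \<le> 1" "defined d s" for s
    proof (rule ccontr)
      assume pos: "\<not> X d s \<le> 0"
      then have Ts: "T < s" using s T(3) by (cases "s = T") auto
      obtain \<delta> where \<delta>: "\<delta> > 0" "\<And>q. q \<in> {0..s} \<Longrightarrow> \<bar>q - T\<bar> < \<delta> \<Longrightarrow> \<bar>Y d q - Y d T\<bar> < - Y d T / 2"
        using Y_cont[OF s(3,2), unfolded continuous_on_iff, rule_format, of T "- Y d T / 2"] T s YT
        by (auto simp: dist_real_def)
      define h where "h = min s (T + \<delta> / 2)"
      have h: "T < h" "h \<le> s" using \<delta> Ts by (auto simp: h_def)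
      have below: "X d q \<le> X d T - (- Y d T / 2) * (q - T)" if q: "q \<in> {T..h}" for q
      proof (rule solves_x_decay[OF solves_XY[OF defined_mono[OF s(3)]]])
        fix t' assume "t' \<in> {T..q}"
        then have "\<bar>Y d t' - Y d T\<bar> < - Y d T / 2"
          by (intro \<delta>(2)) (use \<delta>(1) q T s in \<open>auto simp: h_def\<close>)
        then show "Y d t' \<le> - (- Y d T / 2)" by linarith
      qed (use q h T s YT in auto)
      have nonpos: "X d q \<le> 0" if "q \<in> {T..h}" for q
      proof -
        have "0 \<le> (- Y d T / 2) * (q - T)" using that YT by (intro mult_nonneg_nonneg) auto
        then show ?thesis using below[OF that] T(3) by linarith
      qed
      have "0 < (- Y d T / 2) * (h - T)" using YT h by (intro mult_pos_pos) auto
      then have Xh: "X d h < 0" using below[of h] T(3) h by simp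
      \<comment> \<open>A first return to 0 at T1 is impossible: the solution is nonpositive on
        [T,T1], so its flux is constant and negative there, and it cannot climb back from X d h <
        0.\<close>
      have "continuous_on {h..s} (X d)"
        by (rule continuous_on_subset[OF X_cont[OF s(3,2)]]) (use h T in auto)
      then obtain T1 where T1: "h < T1" "T1 \<le> s" "X d T1 = 0" "\<And>q. h \<le> q \<Longrightarrow> q < T1 \<Longrightarrow> X d q < 0"
        using first_hit[of h s "X d" 0] h Xh pos by auto
      have np: "X d q \<le> 0" if "q \<in> {T..T1}" for q
        using nonpos[of q] T1(3) T1(4)[of q] that by (cases "q \<le> h"; cases "q = T1") auto
      have "X d T1 \<le> X d h"
      proof (rule solves_x_antimono[OF solves_XY[OF defined_mono[OF s(3)]]])
        fix q assume q: "q \<in> {h..T1}"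
        have "Y d q = Y d T"
          by (rule Y_const) (use q h T1 T s np defined_mono[OF s(3)] in auto)
        then show "Y d q \<le> 0" using YT by simp
      qed (use h T1 T s in auto)
      with T1(3) Xh show False by simp
    qed
    have "defined d 1"
    proof (rule ccontr)
      assume nd: "\<not> defined d 1"
      obtain K where K: "0 \<le> K" "\<And>s. s \<in> {0..T} \<Longrightarrow> \<bar>X d s\<bar> \<le> K"
        using continuous_on_interval_abs_bound[OF X_cont[OF DT T1]] by blast
      obtain s where s: "0 \<le> s" "s < 1" "defined d s" "K < X d s"
        using escape[OF nd, of K] by auto
      show False
      proof (cases "s \<le> T")
        case True
        with K(2)[of s] s show False by auto
      next
        case False
        with neg[of s] s K show False by auto
      qed
    qed
    moreover have "X d s \<le> 0 \<and> Y d s \<le> 0" if s: "s \<in> {r..1}" for s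
    proof -
      have s': "T \<le> s" "s \<le> 1" "defined d s" using s T t defined_mono[OF \<open>defined d 1\<close>] by auto
      have "Y d s = Y d T"
        by (rule Y_const[OF s']) (use neg s' defined_mono[OF s'(3)] in auto)
      with neg[OF s'] YT show ?thesis by simp
    qed
    ultimately show ?thesis by blast
  qed
  then show "defined d 1" "s \<in> {r..1} \<Longrightarrow> X d s \<le> 0" "s \<in> {r..1} \<Longrightarrow> Y d s \<le> 0" by auto
qed

text \<open>On a hump the flux is nonincreasing, so x grows at most linearly from \<sigma> on and
  cannot escape to infinity.\<close>

lemma defined_through_hump:
  assumes D: "defined d \<sigma>" and st: "0 < \<sigma>" "\<sigma> \<le> \<tau>" "\<tau> \<le> 1" and w: "\<And>r. r \<in> {\<sigma>..\<tau>} \<Longrightarrow> 0 \<le> w r"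
  shows "defined d \<tau>"
proof (rule ccontr)
  assume nd: "\<not> defined d \<tau>"
  have \<sigma>1: "\<sigma> \<le> 1" using st by simp
  obtain K where K: "0 \<le> K" "\<And>s. s \<in> {0..\<sigma>} \<Longrightarrow> \<bar>X d s\<bar> \<le> K"
    using continuous_on_interval_abs_bound[OF X_cont[OF D \<sigma>1]] by blast
  define B where "B = max (Y d \<sigma>) 0 / \<sigma> ^ (N - 1)"
  have B: "0 \<le> B" using st by (simp add: B_def)
  obtain t where t: "0 \<le> t" "t < \<tau>" "defined d t" "K + B < X d t"
    using escape[OF nd, of "K + B"] st by auto
  show False
  proof (cases "t \<le> \<sigma>")
    case True
    with K(2)[of t] t B show False by auto
  next
    case False
    have S: "solves N w g \<sigma> t (X d) (Y d)" by (rule solves_XY[OF t(3)]) (use st t in auto)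
    have "X d t \<le> X d \<sigma> + max (Y d \<sigma>) 0 / \<sigma> ^ (N - 1) * (t - \<sigma>)"
    proof (rule solves_x_upper[OF S])
      fix r assume "r \<in> {\<sigma>..t}"
      then have "Y d r \<le> Y d \<sigma>" by (intro y_antimono[OF S]) (use w t st in auto)
      then show "Y d r \<le> max (Y d \<sigma>) 0" by simp
    qed (use False st t in auto)
    also have "\<dots> \<le> K + B * 1"
      unfolding B_def[symmetric] using K(2)[of \<sigma>] B st t False by (intro add_mono mult_left_mono) auto
    finally show False using t by simp
  qed
qed

text \<open>Values above any bound occur before h. At such a time after l the flux is positive:
  otherwise, being nondecreasing, it would have been nonpositive since l, and x could not exceed x
  l.\<close>

lemma blow_up_on_negative_interval:
  assumes D: "defined d l" "\<not> defined d h" and lh: "0 \<le> l" "l \<le> h" "h \<le> 1"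
    and w: "\<And>r. r \<in> {l..h} \<Longrightarrow> w r \<le> 0"
  obtains t where "l \<le> t" "t < h" "defined d t" "K < X d t" "0 < Y d t"
proof -
  have l1: "l \<le> 1" using lh by simp
  obtain B where B: "0 \<le> B" "\<And>s. s \<in> {0..l} \<Longrightarrow> \<bar>X d s\<bar> \<le> B"
    using continuous_on_interval_abs_bound[OF X_cont[OF D(1) l1]] by blast
  obtain t where t: "0 \<le> t" "t < h" "defined d t" "max K B < X d t"
    using escape[OF D(2), of "max K B"] lh by auto
  have lt: "l < t"
  proof (rule ccontr)
    assume "\<not> l < t"
    with B(2)[of t] t show False by auto
  qed
  have "0 < Y d t"
  proof (rule ccontr)
    assume np: "\<not> 0 < Y d t"
    have S: "solves N w g l t (X d) (Y d)" by (rule solves_XY[OF t(3)]) (use lh t in auto)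
    have "X d t \<le> X d l"
    proof (rule solves_x_antimono[OF S])
      fix r assume "r \<in> {l..t}"
      then have "Y d r \<le> Y d t" by (intro y_mono[OF S]) (use lh t w in auto)
      with np show "Y d r \<le> 0" by simp
    qed (use lh lt in auto)
    with B(2)[of l] t lh show False by auto
  qed
  with t lt show ?thesis by (intro that[of t]) auto
qed

lemma stays_large:
  assumes D: "defined d s" and ts: "0 \<le> t" "t \<le> s" "s \<le> 1" and w: "\<And>r. r \<in> {t..s} \<Longrightarrow> w r \<le> 0"
    and Y: "0 \<le> Y d t"
  shows "X d t \<le> X d s" "Y d t \<le> Y d s"
proof -
  have S: "solves N w g t s (X d) (Y d)" by (rule solves_XY[OF D]) (use ts in auto)
  show "Y d t \<le> Y d s" by (rule y_mono[OF S]) (use ts w in auto)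
  show "X d t \<le> X d s"
  proof (rule solves_x_mono[OF S ts(1,2)])
    fix r assume "r \<in> {t..s}"
    then have "Y d t \<le> Y d r" by (intro y_mono[OF S]) (use ts w in auto)
    with Y show "0 \<le> Y d r" by simp
  qed
qed

text \<open>To have X > K and Y > 0 at one time t is an open condition on d, and it persists on a
  negative interval. Neighbours need not blow up, but from t on they are above K as long as they
  exist; this replaces a limit of X d' h as d' tends to d.\<close>

lemma near_blow_up:
  assumes D: "defined d l" "\<not> defined d h" and lh: "0 \<le> l" "l \<le> h" "h \<le> 1"
    and w: "\<And>r. r \<in> {l..h} \<Longrightarrow> w r \<le> 0"
  shows "\<exists>\<delta>>0. \<exists>t\<in>{l..<h}. defined d t \<and> (\<forall>d'. \<bar>d' - d\<bar> < \<delta> \<longrightarrow> defined d' t \<and>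
    (\<forall>s\<in>{t..h}. defined d' s \<longrightarrow> K < X d' s \<and> 0 < Y d' s))"
proof -
  obtain t where t: "l \<le> t" "t < h" "defined d t" "K < X d t" "0 < Y d t"
    by (rule blow_up_on_negative_interval[OF D lh w])
  define e where "e = min (X d t - K) (Y d t)"
  have e: "0 < e" using t by (simp add: e_def)
  have t01: "0 \<le> t" "t \<le> 1" using t lh by auto
  obtain \<delta> where \<delta>: "0 < \<delta>" "\<forall>d'. \<bar>d' - d\<bar> < \<delta> \<longrightarrow> defined d' t \<and>
    (\<forall>r\<in>{0..t}. \<bar>X d' r - X d r\<bar> < e \<and> \<bar>Y d' r - Y d r\<bar> < e)"
    using near[OF t(3) t01 e] by blast
  have "K < X d' s \<and> 0 < Y d' s" if d': "\<bar>d' - d\<bar> < \<delta>" and s: "s \<in> {t..h}" "defined d' s" for d' s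
  proof -
    have "K < X d' t" "0 < Y d' t"
      using \<delta>(2)[rule_format, OF d'] t01 by (force simp: e_def)+
    moreover have "X d' t \<le> X d' s" "Y d' t \<le> Y d' s"
      using stays_large[OF s(2), of t] s t01 lh t w \<open>0 < Y d' t\<close> by auto
    ultimately show ?thesis by simp
  qed
  then show ?thesis
    using \<delta> t(1-3) by (intro exI[of _ \<delta>] bexI[of _ t] conjI allI impI ballI) auto
qed

lemma not_hits_near:
  assumes D: "defined d r" and r: "0 \<le> r" "r \<le> 1" and nh: "\<not> hits d r"
  shows "\<exists>\<delta>>0. \<forall>d'. \<bar>d' - d\<bar> < \<delta> \<longrightarrow> \<not> hits d' r"
proof -
  obtain t0 where t0: "t0 \<in> {0..r}" "\<And>t. t \<in> {0..r} \<Longrightarrow> X d t0 \<le> X d t"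
    using continuous_attains_inf[OF _ _ X_cont[OF D r(2)]] r by auto
  have pos: "0 < X d t0" by (rule not_hits_pos[OF nh t0(1)]) (use t0 defined_mono[OF D] in auto)
  obtain \<delta> where \<delta>: "0 < \<delta>" "\<And>d' t. \<bar>d' - d\<bar> < \<delta> \<Longrightarrow> t \<in> {0..r} \<Longrightarrow> \<bar>X d' t - X d t\<bar> < X d t0"
    using near[OF D r pos] by blast
  have "\<not> hits d' r" if d': "\<bar>d' - d\<bar> < \<delta>" for d'
    unfolding hits_def
  proof
    assume "\<exists>t\<in>{0..r}. defined d' t \<and> X d' t \<le> 0"
    then obtain t where t: "t \<in> {0..r}" "X d' t \<le> 0" by blast
    with \<delta>(2)[OF d' t(1)] t0(2)[OF t(1)] show False by linarith
  qed
  with \<delta>(1) show ?thesis by blast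
qed

text \<open>If d blows up, its trajectory is followed only to the time t of
  \<open>near_blow_up\<close> with K = 0: up to t nearby solutions stay positive by compactness, and
  after t by that lemma.\<close>

lemma not_hits_open:
  assumes D: "defined d l" and lh: "0 \<le> l" "l \<le> h" "h \<le> 1"
    and w: "\<And>r. r \<in> {l..h} \<Longrightarrow> w r \<le> 0" and nh: "\<not> hits d h"
  shows "\<exists>\<delta>>0. \<forall>d'. \<bar>d' - d\<bar> < \<delta> \<longrightarrow> \<not> hits d' h"
proof (cases "defined d h")
  case True
  show ?thesis by (rule not_hits_near[OF True _ lh(3) nh]) (use lh in auto)
next
  case False
  obtain \<delta>1 t where t: "0 < \<delta>1" "t \<in> {l..<h}" "defined d t"
    "\<And>d' s. \<bar>d' - d\<bar> < \<delta>1 \<Longrightarrow> s \<in> {t..h} \<Longrightarrow> defined d' s \<Longrightarrow> 0 < X d' s"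
    using near_blow_up[OF D False lh w, of 0] by blast
  have "\<not> hits d t" using nh hits_mono[of d t h] t by auto
  then obtain \<delta>2 where \<delta>2: "0 < \<delta>2" "\<And>d'. \<bar>d' - d\<bar> < \<delta>2 \<Longrightarrow> \<not> hits d' t"
    using not_hits_near[OF t(3)] t lh by auto
  have "\<not> hits d' h" if d': "\<bar>d' - d\<bar> < min \<delta>1 \<delta>2" for d'
    unfolding hits_def
  proof
    assume "\<exists>s\<in>{0..h}. defined d' s \<and> X d' s \<le> 0"
    then obtain s where s: "s \<in> {0..h}" "defined d' s" "X d' s \<le> 0" by blast
    show False
    proof (cases "s \<le> t")
      case True
      then have "hits d' t" unfolding hits_def using s by auto
      with \<delta>2(2)[of d'] d' show False by simp
    next
      case False
      with t(4)[of d' s] d' s show False by auto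
    qed
  qed
  moreover have "0 < min \<delta>1 \<delta>2" using t(1) \<delta>2(1) by simp
  ultimately show ?thesis by blast
qed


text \<open>A branch is a family of initial values whose solutions, up to time \<open>h\<close>, have left the positive
  half-line at one end and have blown up at the other; \<open>e = 1\<close> or \<open>e = - 1\<close> gives its orientation.\<close>

definition branch :: "real \<Rightarrow> real \<Rightarrow> real \<Rightarrow> real \<Rightarrow> real \<Rightarrow> bool" where
  "branch e p q l h \<longleftrightarrow> p < q \<and> (\<forall>s\<in>{p..q}. defined (e * s) l) \<and> hits (e * p) h \<and>
     \<not> defined (e * q) h \<and> \<not> hits (e * q) h \<and>
     (\<forall>s\<in>{p<..<q}. defined (e * s) h \<and> \<not> hits (e * s) h)"

text \<open>p is the last parameter whose solution reaches 0, and q the first one after p whose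
  solution fails to exist up to h. Both exist by openness. The solution at p exists up to 1 by
  \<open>after_hit\<close>, so p < q.\<close>

lemma branch_exists:
  assumes e: "\<bar>e\<bar> = 1" and pq: "p0 \<le> q0" and lh: "0 \<le> l" "l \<le> h" "h \<le> 1"
    and w: "\<And>r. r \<in> {l..h} \<Longrightarrow> w r \<le> 0"
    and D: "\<And>s. s \<in> {p0..q0} \<Longrightarrow> defined (e * s) l"
    and p0: "hits (e * p0) h" and q0: "\<not> hits (e * q0) h" "\<not> defined (e * q0) h"
  obtains p q where "p0 \<le> p" "q \<le> q0" "branch e p q l h"
proof -
  have dist: "\<bar>e * s' - e * s\<bar> = \<bar>s' - s\<bar>" for s s'
    using e by (simp add: right_diff_distrib[symmetric] abs_mult)
  obtain p where p: "p \<in> {p0..q0}" "hits (e * p) h" "\<And>s. p < s \<Longrightarrow> s \<le> q0 \<Longrightarrow> \<not> hits (e * s) h"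
  proof (rule last_point[OF pq, of "\<lambda>s. hits (e * s) h"])
    fix s assume s: "s \<in> {p0..q0}" "\<not> hits (e * s) h"
    obtain \<delta> where "\<delta> > 0" "\<forall>d'. \<bar>d' - e * s\<bar> < \<delta> \<longrightarrow> \<not> hits d' h"
      using not_hits_open[OF D[OF s(1)] lh w s(2)] by blast
    then show "\<exists>\<delta>>0. \<forall>s'\<in>{p0..q0}. \<bar>s' - s\<bar> < \<delta> \<longrightarrow> \<not> hits (e * s') h"
      using dist by metis
  qed (use p0 in auto)
  have Dp: "defined (e * p) h"
    using after_hit(1)[OF p(2)] lh defined_mono[of "e * p" 1 h] by auto
  obtain q where q: "q \<in> {p..q0}" "\<not> defined (e * q) h" "\<And>s. p \<le> s \<Longrightarrow> s < q \<Longrightarrow> \<not> \<not> defined (e * s) h"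
  proof (rule first_point[of p q0 "\<lambda>s. \<not> defined (e * s) h"])
    fix s assume s: "s \<in> {p..q0}" "\<not> \<not> defined (e * s) h"
    then obtain \<delta> where "\<delta> > 0" "\<forall>d'. \<bar>d' - e * s\<bar> < \<delta> \<longrightarrow> defined d' h"
      using near[of "e * s" h 1] lh by auto
    then show "\<exists>\<delta>>0. \<forall>s'\<in>{p..q0}. \<bar>s' - s\<bar> < \<delta> \<longrightarrow> \<not> \<not> defined (e * s') h"
      using dist by metis
  qed (use p q0 in auto)
  have "p < q" using q Dp by (cases "p = q") auto
  then have "branch e p q l h"
    unfolding branch_def using p q D by auto
  then show ?thesis using that p q by auto
qed

text \<open>The initial value 0 counts as a hit at time 0. Starting from K, the flux is nonnegative,
  so a solution that reached c would still be at least K there, and \<open>blow_up\<close>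
  applies.\<close>

lemma initial_branch:
  assumes h: "0 < h" "h \<le> 1" and w: "\<And>r. r \<in> {0..h} \<Longrightarrow> w r \<le> 0"
    and cf: "0 < c" "c < f" "f \<le> h" "0 < k" and wk: "\<And>r. r \<in> {c..f} \<Longrightarrow> w r \<le> - k"
  obtains p q where "branch 1 p q 0 h"
proof -
  have f1: "f \<le> 1" using cf h by simp
  obtain K where K: "0 < K" "\<And>w x y. solves N w g c f x y \<Longrightarrow> (\<And>r. r \<in> {c..f} \<Longrightarrow> w r \<le> - k) \<Longrightarrow>
      K \<le> x c \<Longrightarrow> 0 \<le> y c \<Longrightarrow> False"
    by (rule blow_up[of c f k]) (use cf f1 in auto)
  have large: "K \<le> X K r" "0 \<le> Y K r" if "r \<in> {0..h}" "defined K r" for r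
    using stays_large[OF that(2), of 0] that h w by auto
  have "\<not> defined K f"
  proof
    assume D: "defined K f"
    have Dc: "defined K c" by (rule defined_mono[OF D]) (use cf in simp)
    show False
      by (rule K(2)[OF solves_XY[OF D _ f1] wk]) (use cf large[of c] Dc in auto)
  qed
  then have nd: "\<not> defined K h" using defined_mono cf by blast
  have nh: "\<not> hits K h" unfolding hits_def using large(1) K(1) by fastforce
  show ?thesis
  proof (rule branch_exists[of 1 0 K 0 h])
    show "hits (1 * 0) h" unfolding hits_def using h by (intro bexI[of _ 0]) auto
  qed (use h w K nd nh that in auto)
qed

text \<open>If the solution at q did not exist up to some c < 1, parameters of the branch near q
  would have values above K and positive flux at c. As the weight is at most -k from c on, they
  would blow up by time 1; but inside the branch solutions exist up to 1.\<close>

lemma terminal_defined: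
  assumes br: "branch e p q l 1" and e: "\<bar>e\<bar> = 1" and l: "0 \<le> l" "l < 1"
    and w: "\<And>r. r \<in> {l..1} \<Longrightarrow> w r \<le> 0"
    and t0: "t0 < 1" and k: "0 < k" and wk: "\<And>r. r \<in> {t0..1} \<Longrightarrow> w r \<le> - k"
    and t: "t < 1"
  shows "defined (e * q) t"
proof (rule ccontr)
  assume nd: "\<not> defined (e * q) t"
  define c where "c = max (max t t0) ((l + 1) / 2)"
  have c: "t \<le> c" "t0 \<le> c" "l < c" "c < 1" "0 < c" using t t0 l by (auto simp: c_def less_max_iff_disj)
  have nc: "\<not> defined (e * q) c" using nd defined_mono c by blast
  obtain K where K: "0 < K" "\<And>w x y. solves N w g c 1 x y \<Longrightarrow> (\<And>r. r \<in> {c..1} \<Longrightarrow> w r \<le> - k) \<Longrightarrow>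
      K \<le> x c \<Longrightarrow> 0 \<le> y c \<Longrightarrow> False"
    by (rule blow_up[of c 1 k]) (use c k in auto)
  have pq: "p < q" and Dl: "defined (e * q) l" using br by (auto simp: branch_def)
  obtain \<delta> t' where \<delta>: "0 < \<delta>" "t' \<in> {l..<c}"
    "\<And>d' s. \<bar>d' - e * q\<bar> < \<delta> \<Longrightarrow> s \<in> {t'..c} \<Longrightarrow> defined d' s \<Longrightarrow> K < X d' s \<and> 0 < Y d' s"
    using near_blow_up[OF Dl nc, of K] l c w by auto
  obtain s where s: "max p (q - \<delta>) < s" "s < q"
    using dense[of "max p (q - \<delta>)" q] pq \<delta>(1) by auto
  have D1: "defined (e * s) 1" using br s by (auto simp: branch_def)
  have Dc: "defined (e * s) c" by (rule defined_mono[OF D1]) (use c in simp)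
  have "\<bar>e * s - e * q\<bar> < \<delta>"
    using s e by (simp add: right_diff_distrib[symmetric] abs_mult)
  then have "K < X (e * s) c \<and> 0 < Y (e * s) c" using \<delta>(2) c Dc by (intro \<delta>(3)) auto
  then show False
    by (intro K(2)[OF solves_XY[OF D1 _ order_refl] wk]) (use c in auto)
qed

text \<open>Between the two ends of a branch some solution has a hump of height exactly \<open>\<rho>\<close>; it blows up
  before \<open>h\<close> if \<open>\<mu>\<close> is large.  Near the blow-up end solutions are so large at \<open>\<sigma>\<close> that
  they hit zero within the hump.  So each side of that solution contains a new branch.\<close>

lemma branch_split:
  assumes ord: "0 \<le> l" "l < \<sigma>" "\<sigma> < \<tau>" "\<tau> < h" "h \<le> 1"
    and w_l: "\<And>r. r \<in> {l..\<sigma>} \<Longrightarrow> w r \<le> 0" and w_h: "\<And>r. r \<in> {\<tau>..h} \<Longrightarrow> w r \<le> 0"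
    and w_hump: "\<And>r. r \<in> {\<sigma>..\<tau>} \<Longrightarrow> 0 \<le> w r"
    and \<rho>: "0 < \<rho>" and \<theta>: "0 \<le> \<theta>" "\<theta> / \<tau> ^ (N - 1) \<le> \<rho> / 4" and f: "\<tau> < f" "f < h"
    and turn: "\<And>d. defined d \<sigma> \<Longrightarrow> \<not> hits d \<sigma> \<Longrightarrow> Y d \<sigma> = 0 \<Longrightarrow> X d \<sigma> \<le> \<rho> / 2"
    and small: "\<And>d r0. defined d \<tau> \<Longrightarrow> 0 \<le> Y d \<sigma> \<Longrightarrow> 0 < X d \<sigma> \<Longrightarrow> (\<And>r. r \<in> {\<sigma>..\<tau>} \<Longrightarrow> X d r \<le> \<rho>) \<Longrightarrow>
      r0 \<in> {\<sigma>..\<tau>} \<Longrightarrow> X d r0 = \<rho> \<Longrightarrow>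
      (\<forall>r\<in>{\<sigma>..\<tau>}. 0 < X d r) \<and> 3 * \<rho> / 4 \<le> X d \<tau> \<and> - \<theta> \<le> Y d \<tau>"
    and blow: "\<And>d. 3 * \<rho> / 4 \<le> X d \<tau> \<Longrightarrow> - \<theta> \<le> Y d \<tau> \<Longrightarrow> \<not> defined d f"
    and hump: "\<And>d. defined d \<tau> \<Longrightarrow> (\<And>r. r \<in> {\<sigma>..\<tau>} \<Longrightarrow> 0 < X d r) \<Longrightarrow> X d \<sigma> \<le> R"
    and e: "\<bar>e\<bar> = 1" and br: "branch e p q l \<sigma>"
  shows "\<exists>p1 q1 p2 q2 sm. branch e p1 q1 \<tau> h \<and> branch (- e) p2 q2 \<tau> h \<and>
    p \<le> p1 \<and> q1 \<le> sm \<and> sm \<le> - q2 \<and> - p2 < q \<and> \<not> defined (e * sm) f"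
proof -
  have dist: "\<bar>e * s' - e * s\<bar> = \<bar>s' - s\<bar>" for s s'
    using e by (simp add: right_diff_distrib[symmetric] abs_mult)
  note br' = br[unfolded branch_def]
  have pq: "p < q" using br' by simp
  have inner: "defined (e * s) \<sigma>" "\<not> hits (e * s) \<sigma>" if "s \<in> {p<..<q}" for s
    using br' that by auto
  have hit_p: "hits (e * p) \<sigma>" using br' by simp
  have D\<sigma>: "defined (e * s) \<sigma>" if "s \<in> {p..<q}" for s
  proof (cases "s = p")
    case True
    then show ?thesis using after_hit(1)[OF hit_p] defined_mono[of "e * p" 1 \<sigma>] ord by auto
  next
    case False
    then show ?thesis using inner(1)[of s] that by auto
  qed
  have D\<tau>: "defined (e * s) \<tau>" if "s \<in> {p..<q}" for s
    by (rule defined_through_hump[OF D\<sigma>[OF that]]) (use ord w_hump in auto)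
  have near_s: "\<exists>\<delta>>0. \<forall>s'. \<bar>s' - s\<bar> < \<delta> \<longrightarrow>
      (\<forall>r\<in>{0..\<tau>}. \<bar>X (e * s') r - X (e * s) r\<bar> < \<epsilon> \<and> \<bar>Y (e * s') r - Y (e * s) r\<bar> < \<epsilon>)"
    if sp: "s \<in> {p..<q}" and ep: "0 < \<epsilon>" for s \<epsilon>
  proof -
    obtain \<delta> where "\<delta> > 0" "\<forall>d'. \<bar>d' - e * s\<bar> < \<delta> \<longrightarrow> defined d' \<tau> \<and>
      (\<forall>r\<in>{0..\<tau>}. \<bar>X d' r - X (e * s) r\<bar> < \<epsilon> \<and> \<bar>Y d' r - Y (e * s) r\<bar> < \<epsilon>)"
      using near[OF D\<tau>[OF sp] _ _ ep] ord by auto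
    then show ?thesis using dist by metis
  qed
  have Dl: "defined (e * q) l" and nq: "\<not> defined (e * q) \<sigma>" using br' by auto
  \<comment> \<open>Near the blow-up end the value at \<sigma> exceeds R, which forces a zero within
    the hump, and \<rho>, which ends the search for \<open>sm\<close>.\<close>
  obtain \<delta> t where \<delta>: "0 < \<delta>" "t \<in> {l..<\<sigma>}"
    "\<And>d' s. \<bar>d' - e * q\<bar> < \<delta> \<Longrightarrow> s \<in> {t..\<sigma>} \<Longrightarrow> defined d' s \<Longrightarrow> max R \<rho> < X d' s \<and> 0 < Y d' s"
    using near_blow_up[OF Dl nq, of "max R \<rho>"] ord w_l by auto
  obtain s3 where s3: "max p (q - \<delta>) < s3" "s3 < q"
    using dense[of "max p (q - \<delta>)" q] pq \<delta>(1) by auto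
  have big3: "max R \<rho> < X (e * s3) \<sigma>" "0 < Y (e * s3) \<sigma>"
    using \<delta>(3)[of "e * s3" \<sigma>] \<delta>(2) dist[of s3 q] s3 D\<sigma>[of s3] by auto
  have ps3: "p \<le> s3" using s3 by simp
  \<comment> \<open>The parameters with Y <= 0 at \<sigma> form a closed set. It contains p, because
    a solution that has reached 0 has nonpositive flux from then on.\<close>
  obtain s0 where s0: "s0 \<in> {p..s3}" "Y (e * s0) \<sigma> \<le> 0" "\<And>s. s0 < s \<Longrightarrow> s \<le> s3 \<Longrightarrow> \<not> Y (e * s) \<sigma> \<le> 0"
  proof (rule last_point[OF ps3, of "\<lambda>s. Y (e * s) \<sigma> \<le> 0"])
    show "Y (e * p) \<sigma> \<le> 0" using after_hit(3)[OF hit_p, of \<sigma>] ord by auto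
    fix s assume s: "s \<in> {p..s3}" "\<not> Y (e * s) \<sigma> \<le> 0"
    have "s \<in> {p..<q}" using s s3 by auto
    from near_s[OF this, of "Y (e * s) \<sigma>"] s(2)
    obtain \<delta> where \<delta>: "\<delta> > 0" "\<And>s' r. \<bar>s' - s\<bar> < \<delta> \<Longrightarrow> r \<in> {0..\<tau>} \<Longrightarrow> \<bar>Y (e * s') r - Y (e * s) r\<bar> < Y (e * s) \<sigma>"
      by (auto simp: not_le)
    have "\<not> Y (e * s') \<sigma> \<le> 0" if "\<bar>s' - s\<bar> < \<delta>" for s'
      using \<delta>(2)[OF that, of \<sigma>] ord by auto
    with \<delta>(1) show "\<exists>\<delta>>0. \<forall>s'\<in>{p..s3}. \<bar>s' - s\<bar> < \<delta> \<longrightarrow> \<not> Y (e * s') \<sigma> \<le> 0" by blast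
  qed (rule that)
  have s03: "s0 < s3" using s0 big3 by (cases "s0 = s3") auto
  have s0': "s0 \<in> {p..<q}" using s0 s3 by auto
  have X0: "X (e * s0) \<sigma> \<le> \<rho> / 2"
  proof (cases "s0 = p")
    case True
    then show ?thesis using after_hit(2)[OF hit_p, of \<sigma>] ord \<rho> by auto
  next
    case False
    then have s0_in: "s0 \<in> {p<..<q}" using s0' by auto
    \<comment> \<open>Just above s0 the flux at \<sigma> is positive by the maximality of s0, so by
      continuity it cannot be negative at s0.\<close>
    have "Y (e * s0) \<sigma> = 0"
    proof (rule ccontr)
      assume "Y (e * s0) \<sigma> \<noteq> 0"
      then have neg: "Y (e * s0) \<sigma> < 0" using s0 by simp
      from near_s[OF s0', of "- Y (e * s0) \<sigma>"] neg
      obtain \<delta> where \<delta>: "\<delta> > 0" "\<And>s' r. \<bar>s' - s0\<bar> < \<delta> \<Longrightarrow> r \<in> {0..\<tau>} \<Longrightarrow> \<bar>Y (e * s') r - Y (e * s0) r\<bar> < - Y (e * s0) \<sigma>"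
        by auto
      define s' where "s' = min s3 (s0 + \<delta> / 2)"
      have "s0 < s'" "s' \<le> s3" "\<bar>s' - s0\<bar> < \<delta>" using \<delta>(1) s03 by (auto simp: s'_def)
      with s0(3)[of s'] \<delta>(2)[of s' \<sigma>] ord show False by auto
    qed
    then show ?thesis using turn[OF inner[OF s0_in]] by simp
  qed
  have low0: "X (e * s0) r < \<rho>" if r: "r \<in> {\<sigma>..\<tau>}" for r
  proof -
    have S: "solves N w g \<sigma> \<tau> (X (e * s0)) (Y (e * s0))"
      by (rule solves_XY[OF D\<tau>[OF s0']]) (use ord in auto)
    have "X (e * s0) r \<le> X (e * s0) \<sigma>"
    proof (rule solves_x_antimono[OF solves_subset[OF S]])
      fix t assume "t \<in> {\<sigma>..r}"
      then have "Y (e * s0) t \<le> Y (e * s0) \<sigma>" by (intro y_antimono[OF S]) (use ord w_hump r in auto)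
      then show "Y (e * s0) t \<le> 0" using s0(2) by simp
    qed (use r ord in auto)
    with X0 \<rho> show ?thesis by simp
  qed
  \<comment> \<open>At s0 the solution stays below \<rho> on the hump, at s3 it is above \<rho>
    already at \<sigma>. At the first parameter in between that reaches \<rho>, continuity makes the
    maximum exactly \<rho>; as sm > s0, its flux at \<sigma> has the sign required by
    \<open>small\<close>.\<close>
  obtain sm where sm: "sm \<in> {s0..s3}" "\<exists>r\<in>{\<sigma>..\<tau>}. \<rho> \<le> X (e * sm) r"
    "\<And>s. s0 \<le> s \<Longrightarrow> s < sm \<Longrightarrow> \<not> (\<exists>r\<in>{\<sigma>..\<tau>}. \<rho> \<le> X (e * s) r)"
  proof (rule first_point[of s0 s3 "\<lambda>s. \<exists>r\<in>{\<sigma>..\<tau>}. \<rho> \<le> X (e * s) r"])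
    show "\<exists>r\<in>{\<sigma>..\<tau>}. \<rho> \<le> X (e * s3) r" using big3 ord by (intro bexI[of _ \<sigma>]) auto
    fix s assume s: "s \<in> {s0..s3}" and np: "\<not> (\<exists>r\<in>{\<sigma>..\<tau>}. \<rho> \<le> X (e * s) r)"
    have s': "s \<in> {p..<q}" using s s0' s3 by auto
    have "continuous_on {\<sigma>..\<tau>} (X (e * s))"
      by (rule continuous_on_subset[OF X_cont[OF D\<tau>[OF s']]]) (use ord in auto)
    then obtain r0 where r0: "r0 \<in> {\<sigma>..\<tau>}" "\<And>r. r \<in> {\<sigma>..\<tau>} \<Longrightarrow> X (e * s) r \<le> X (e * s) r0"
      using continuous_attains_sup[of "{\<sigma>..\<tau>}" "X (e * s)"] ord by auto
    have "0 < \<rho> - X (e * s) r0" using np r0(1) by force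
    from near_s[OF s' this] obtain \<delta> where \<delta>: "\<delta> > 0" "\<And>s' r. \<bar>s' - s\<bar> < \<delta> \<Longrightarrow> r \<in> {0..\<tau>} \<Longrightarrow>
        \<bar>X (e * s') r - X (e * s) r\<bar> < \<rho> - X (e * s) r0" by blast
    have "\<not> (\<exists>r\<in>{\<sigma>..\<tau>}. \<rho> \<le> X (e * s') r)" if s': "\<bar>s' - s\<bar> < \<delta>" for s'
    proof
      assume "\<exists>r\<in>{\<sigma>..\<tau>}. \<rho> \<le> X (e * s') r"
      then obtain r where r: "r \<in> {\<sigma>..\<tau>}" "\<rho> \<le> X (e * s') r" by blast
      with \<delta>(2)[OF s', of r] r0(2)[OF r(1)] ord show False by auto
    qed
    with \<delta>(1) show "\<exists>\<delta>>0. \<forall>s'\<in>{s0..s3}. \<bar>s' - s\<bar> < \<delta> \<longrightarrow> \<not> (\<exists>r\<in>{\<sigma>..\<tau>}. \<rho> \<le> X (e * s') r)" by blast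
  qed (use s03 in auto)
  have s0m: "s0 < sm"
  proof (rule ccontr)
    assume "\<not> s0 < sm"
    then have "sm = s0" using sm by auto
    with sm(2) low0 show False by fastforce
  qed
  have sm': "sm \<in> {p..<q}" "sm \<in> {p<..<q}" using sm s0m s0' s3 by auto
  have le: "X (e * sm) r \<le> \<rho>" if r: "r \<in> {\<sigma>..\<tau>}" for r
  proof (rule ccontr)
    assume "\<not> X (e * sm) r \<le> \<rho>"
    then have "0 < X (e * sm) r - \<rho>" by simp
    from near_s[OF sm'(1) this] obtain \<delta> where \<delta>: "\<delta> > 0" "\<And>s' q. \<bar>s' - sm\<bar> < \<delta> \<Longrightarrow> q \<in> {0..\<tau>} \<Longrightarrow>
        \<bar>X (e * s') q - X (e * sm) q\<bar> < X (e * sm) r - \<rho>" by blast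
    define s' where "s' = max s0 (sm - \<delta> / 2)"
    have s': "s0 \<le> s'" "s' < sm" "\<bar>s' - sm\<bar> < \<delta>" using \<delta>(1) s0m by (auto simp: s'_def)
    have "r \<in> {0..\<tau>}" using r ord by auto
    from \<delta>(2)[OF s'(3) this] have "\<rho> \<le> X (e * s') r" by linarith
    with sm(3)[OF s'(1,2)] r show False by blast
  qed
  obtain r0 where r0: "r0 \<in> {\<sigma>..\<tau>}" "X (e * sm) r0 = \<rho>" using sm(2) le by force
  have X\<sigma>: "0 < X (e * sm) \<sigma>"
    by (rule not_hits_pos[OF inner(2)[OF sm'(2)]]) (use inner(1)[OF sm'(2)] ord in auto)
  have Y\<sigma>: "0 \<le> Y (e * sm) \<sigma>" using s0(3)[of sm] s0m sm by auto
  have sm_hump: "\<forall>r\<in>{\<sigma>..\<tau>}. 0 < X (e * sm) r" "3 * \<rho> / 4 \<le> X (e * sm) \<tau>" "- \<theta> \<le> Y (e * sm) \<tau>"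
    using small[OF D\<tau>[OF sm'(1)] Y\<sigma> X\<sigma> le r0] by auto
  have nf: "\<not> defined (e * sm) f" by (rule blow[OF sm_hump(2,3)])
  have nh: "\<not> defined (e * sm) h" using nf defined_mono f by (meson less_imp_le)
  have nhit: "\<not> hits (e * sm) h"
    unfolding hits_def
  proof
    assume "\<exists>t\<in>{0..h}. defined (e * sm) t \<and> X (e * sm) t \<le> 0"
    then obtain t where t: "t \<in> {0..h}" "defined (e * sm) t" "X (e * sm) t \<le> 0" by blast
    show False
    proof (cases "t \<le> \<sigma>")
      case True
      then have "hits (e * sm) \<sigma>" unfolding hits_def using t by auto
      with inner(2)[OF sm'(2)] show False by simp
    next
      case False
      show False
      proof (cases "t \<le> \<tau>")
        case True
        then have "t \<in> {\<sigma>..\<tau>}" using False by simp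
        with sm_hump(1) have "0 < X (e * sm) t" by blast
        with t show False by simp
      next
        case False
        have "\<rho> / 2 \<le> X (e * sm) t"
          by (rule negative_interval_stays_large[OF solves_XY[OF t(2)] _ _ _ _ \<theta> sm_hump(2,3)])
            (use False ord w_h t in auto)
        with t \<rho> show False by simp
      qed
    qed
  qed
  \<comment> \<open>Otherwise the solution would be positive on the whole hump, and
    \<open>hump\<close> would bound its value at \<sigma> by R.\<close>
  have "hits (e * s3) \<tau>"
  proof (rule ccontr)
    assume n: "\<not> hits (e * s3) \<tau>"
    have D3: "defined (e * s3) \<tau>" by (rule D\<tau>) (use s3 in auto)
    have "X (e * s3) \<sigma> \<le> R"
    proof (rule hump[OF D3])
      fix r assume "r \<in> {\<sigma>..\<tau>}"
      then show "0 < X (e * s3) r"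
        by (intro not_hits_pos[OF n]) (use ord defined_mono[OF D3] in auto)
    qed
    with big3 show False by simp
  qed
  then have h3: "hits (e * s3) h" using hits_mono ord by (meson less_imp_le)
  have hp: "hits (e * p) h" using hits_mono[OF hit_p] ord by simp
  obtain p1 q1 where 1: "p \<le> p1" "q1 \<le> sm" "branch e p1 q1 \<tau> h"
  proof (rule branch_exists[OF e, of p sm \<tau> h])
    show "defined (e * s) \<tau>" if "s \<in> {p..sm}" for s
      using that sm' by (intro D\<tau>) auto
  qed (use sm' ord w_h hp nhit nh in auto)
  \<comment> \<open>This branch leads from the zero end s3 down to the blow-up at sm, so it is
    parametrised by -s with the opposite orientation.\<close>
  obtain p2 q2 where 2: "- s3 \<le> p2" "q2 \<le> - sm" "branch (- e) p2 q2 \<tau> h"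
  proof (rule branch_exists[of "- e" "- s3" "- sm" \<tau> h])
    show "defined (- e * s) \<tau>" if "s \<in> {- s3..- sm}" for s
      using D\<tau>[of "- s"] that sm' s3 by auto
  qed (use e sm ord w_h h3 nhit nh in auto)
  show ?thesis
    using 1 2 nf s3 by (intro exI[of _ p1] exI[of _ q1] exI[of _ p2] exI[of _ q2] exI[of _ sm]) auto
qed

text \<open>The time f < h records that the solution at \<open>sm\<close> blows up strictly before
  h. For h = 1 this tells \<open>sm\<close> apart from the blow-up ends of the two new branches,
  whose solutions exist at every time before 1.\<close>

definition splits :: "real \<Rightarrow> real \<Rightarrow> real \<Rightarrow> real \<Rightarrow> bool" where
  "splits l \<sigma> \<tau> h \<longleftrightarrow> (\<forall>e p q. \<bar>e\<bar> = 1 \<longrightarrow> branch e p q l \<sigma> \<longrightarrow>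
    (\<exists>p1 q1 p2 q2 sm f. branch e p1 q1 \<tau> h \<and> branch (- e) p2 q2 \<tau> h \<and>
      p \<le> p1 \<and> q1 \<le> sm \<and> sm \<le> - q2 \<and> - p2 < q \<and> f < h \<and> \<not> defined (e * sm) f))"

definition large :: "real \<Rightarrow> bool" where
  "large d \<longleftrightarrow> (\<forall>t<1. defined d t) \<and> \<not> defined d 1 \<and> \<not> hits d 1"

text \<open>The induction goes from i = m downwards, for all branches at once: a branch at \<sigma>
  i yields two at \<sigma> (i + 1), and the count doubles. The strict bounds p < s < q keep the two
  sets of values on different sides of \<open>sm\<close>.\<close>

lemma many_large:
  fixes \<sigma> \<tau> :: "nat \<Rightarrow> real"
  assumes splits: "\<And>i. i \<in> {1..m} \<Longrightarrow> splits (\<tau> (i - 1)) (\<sigma> i) (\<tau> i) (\<sigma> (i + 1))"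
    and last: "\<sigma> (m + 1) = 1" "0 \<le> \<tau> m" "\<tau> m < 1" and w: "\<And>r. r \<in> {\<tau> m..1} \<Longrightarrow> w r \<le> 0"
    and t0: "t0 < 1" and k: "0 < k" and wk: "\<And>r. r \<in> {t0..1} \<Longrightarrow> w r \<le> - k"
    and i: "1 \<le> i" "i \<le> m" and e: "\<bar>e\<bar> = 1" and br: "branch e p q (\<tau> (i - 1)) (\<sigma> i)"
  shows "\<exists>F. finite F \<and> card F = 2 ^ (m + 1 - i) \<and> (\<forall>s\<in>F. p < s \<and> s < q \<and> large (e * s))"
  using i(2,1) e br
proof (induction i arbitrary: e p q rule: inc_induct)
  case base
  have large_end: "large (e * q)" if "\<bar>e\<bar> = 1" "branch e p q (\<tau> m) 1" for e p q
    unfolding large_def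
    using terminal_defined[OF that(2,1) last(2,3) w t0 k wk] that(2) by (auto simp: branch_def)
  have "splits (\<tau> (m - 1)) (\<sigma> m) (\<tau> m) (\<sigma> (m + 1))" using splits[of m] base by auto
  then obtain p1 q1 p2 q2 sm f where s: "branch e p1 q1 (\<tau> m) 1" "branch (- e) p2 q2 (\<tau> m) 1"
      "p \<le> p1" "q1 \<le> sm" "sm \<le> - q2" "- p2 < q" "f < 1" "\<not> defined (e * sm) f"
    unfolding splits_def last(1) using base(2,3) by blast
  have l1: "large (e * q1)" using large_end[OF base(2) s(1)] .
  have l2: "large (e * - q2)" using large_end[OF _ s(2)] base(2) by simp
  \<comment> \<open>The solution at \<open>sm\<close> ends before 1 while those at q1 and - q2 do
    not; hence q1 < sm < - q2, and the two values are distinct.\<close>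
  have "q1 \<noteq> sm" "sm \<noteq> - q2" using l1 l2 s by (auto simp: large_def)
  moreover have "p1 < q1" "p2 < q2" using s by (auto simp: branch_def)
  ultimately show ?case
    using l1 l2 s by (intro exI[of _ "{q1, - q2}"]) auto
next
  case (step n)
  have "splits (\<tau> (n - 1)) (\<sigma> n) (\<tau> n) (\<sigma> (n + 1))" using splits[of n] step by auto
  then obtain p1 q1 p2 q2 sm where s: "branch e p1 q1 (\<tau> n) (\<sigma> (Suc n))" "branch (- e) p2 q2 (\<tau> n) (\<sigma> (Suc n))"
      "p \<le> p1" "q1 \<le> sm" "sm \<le> - q2" "- p2 < q"
    unfolding splits_def using step.prems(2,3) by fastforce
  obtain F1 where F1: "finite F1" "card F1 = 2 ^ (m + 1 - Suc n)" "\<forall>s\<in>F1. p1 < s \<and> s < q1 \<and> large (e * s)"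
    using step.IH[of e p1 q1] step.prems s by auto
  obtain F2 where F2: "finite F2" "card F2 = 2 ^ (m + 1 - Suc n)" "\<forall>s\<in>F2. p2 < s \<and> s < q2 \<and> large (- e * s)"
    using step.IH[of "- e" p2 q2] step.prems s by auto
  have "card (F1 \<union> uminus ` F2) = card F1 + card (uminus ` F2)"
  proof (rule card_Un_disjoint)
    show "F1 \<inter> uminus ` F2 = {}" using F1(3) F2(3) s by fastforce
  qed (use F1 F2 in auto)
  also have "card (uminus ` F2) = card F2" by (rule card_image) (simp add: inj_on_def)
  finally have "card (F1 \<union> uminus ` F2) = 2 ^ (m + 1 - n)"
    using F1(2) F2(2) step.hyps by (simp add: Suc_diff_le)
  moreover have "p < s \<and> s < q \<and> large (e * s)" if "s \<in> F1 \<union> uminus ` F2" for s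
    using that
  proof
    assume "s \<in> F1"
    moreover have "p2 < q2" using s by (auto simp: branch_def)
    ultimately show ?thesis using F1(3) s by force
  next
    assume "s \<in> uminus ` F2"
    moreover have "p1 < q1" using s by (auto simp: branch_def)
    ultimately show ?thesis using F2(3) s by fastforce
  qed
  ultimately show ?case using F1(1) F2(1) by (intro exI[of _ "F1 \<union> uminus ` F2"]) auto
qed

end

section \<open>From radial profiles to solutions in the ball\<close>

lemma deriv_along_axis:
  fixes F :: "real ^ 'n \<Rightarrow> 'b::real_normed_vector"
  assumes "(F has_derivative F') (at x)"
  shows "((\<lambda>t. F (x + t *\<^sub>R axis i 1)) has_vector_derivative F' (axis i 1)) (at 0)"
proof -
  have "((\<lambda>t. x + t *\<^sub>R axis i (1::real)) has_derivative (\<lambda>t. t *\<^sub>R axis i 1)) (at 0)"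
    by (auto intro!: derivative_eq_intros)
  from has_derivative_compose[OF this, of F F'] assms
  have "((\<lambda>t. F (x + t *\<^sub>R axis i 1)) has_derivative (\<lambda>t. F' (t *\<^sub>R axis i 1))) (at 0)" by simp
  moreover have "linear F'" using assms by (rule has_derivative_linear)
  ultimately show ?thesis by (simp add: has_vector_derivative_def linear_cmul)
qed

text \<open>\<open>laplacian\<close> iterates derivatives along coordinate lines, so the first
  partial derivatives must be known on a whole segment around x; openness of S provides it.\<close>

lemma C2_laplacian:
  fixes U :: "real ^ 'n \<Rightarrow> real" and H :: "real ^ 'n \<Rightarrow> real ^ 'n ^ 'n"
  assumes S: "open S" "x \<in> S"
    and D: "\<And>y. y \<in> S \<Longrightarrow> (U has_derivative (\<lambda>h. D y \<bullet> h)) (at y)"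
    and H: "(D has_derivative (\<lambda>h. H x *v h)) (at x)"
  shows "laplacian U x = (\<Sum>i\<in>UNIV. H x $ i $ i)"
proof -
  have pd: "partial_deriv i U y = D y $ i" if "y \<in> S" for i y
  proof -
    have "((\<lambda>t. U (y + t *\<^sub>R axis i 1)) has_real_derivative D y $ i) (at 0)"
      using deriv_along_axis[OF D[OF that], of i]
      by (simp add: has_real_derivative_iff_has_vector_derivative inner_axis)
    then show ?thesis unfolding partial_deriv_def by (rule DERIV_imp_deriv)
  qed
  have "partial_deriv i (partial_deriv i U) x = H x $ i $ i" for i
  proof -
    have "((\<lambda>t. D (x + t *\<^sub>R axis i 1) $ i) has_vector_derivative (H x *v axis i 1) $ i) (at 0)"
      using deriv_along_axis[OF H, of i]
      by (rule bounded_linear.has_vector_derivative[OF bounded_linear_vec_nth])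
    then have 1: "((\<lambda>t. D (x + t *\<^sub>R axis i 1) $ i) has_real_derivative H x $ i $ i) (at 0)"
      by (simp add: has_real_derivative_iff_has_vector_derivative matrix_vector_mult_basis column_def)
    have "isCont (\<lambda>t. x + t *\<^sub>R axis i (1::real)) 0" by (intro continuous_intros)
    then have "((\<lambda>t. x + t *\<^sub>R axis i (1::real)) \<longlongrightarrow> x) (at 0)" by (simp add: isCont_def)
    then have "\<forall>\<^sub>F t in at 0. x + t *\<^sub>R axis i 1 \<in> S"
      using S by (rule topological_tendstoD)
    then have "\<forall>\<^sub>F t in nhds 0. x + t *\<^sub>R axis i 1 \<in> S"
      using S(2) by (simp add: eventually_nhds_conv_at)
    then have ev: "\<forall>\<^sub>F t in nhds 0. partial_deriv i U (x + t *\<^sub>R axis i 1) = D (x + t *\<^sub>R axis i 1) $ i"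
      by eventually_elim (rule pd)
    have "((\<lambda>t. partial_deriv i U (x + t *\<^sub>R axis i 1)) has_real_derivative H x $ i $ i) (at 0)"
      using 1 DERIV_cong_ev[OF refl ev refl] by blast
    then show ?thesis unfolding partial_deriv_def[of i "partial_deriv i U"] by (rule DERIV_imp_deriv)
  qed
  then show ?thesis by (simp add: laplacian_def)
qed

section \<open>Regularity of a radial solution at the origin\<close>

locale radial_large =
  fixes N :: nat and w g x y :: "real \<Rightarrow> real"
  assumes N_pos: "0 < N" and w_cont: "continuous_on {0..1} w" and g_cont: "continuous_on {0..} g"
    and S: "\<And>s. s < 1 \<Longrightarrow> solves N w g 0 s x y" and y_0: "y 0 = 0"
    and pos: "\<And>r. r \<in> {0..<1} \<Longrightarrow> 0 < x r" and blow_up: "filterlim x at_top (at_left 1)"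
begin

definition v :: "real \<Rightarrow> real" where "v r = y r / r ^ (N - 1)"

text \<open>The limit of u'(r) / r at the centre, that is u''(0): there the equation reads N u''(0)
  + w(0) g(u(0)) = 0.\<close>

definition L :: real where "L = - (w 0 * g (x 0)) / real N"

definition q :: "real \<Rightarrow> real" where "q r = (if r = 0 then L else v r / r)"

text \<open>The second derivative u'', obtained by expanding (r^(N-1) u')' in the equation.\<close>

definition v' :: "real \<Rightarrow> real" where "v' r = - (w r * g (x r)) - real (N - 1) * q r"

lemma x_deriv_within: "r \<in> {0..<1} \<Longrightarrow> (x has_real_derivative v r) (at r within {0..<1})"
proof -
  assume r: "r \<in> {0..<1}"
  then obtain s where s: "r < s" "s < 1" using dense[of r 1] by auto
  have "(x has_real_derivative v r) (at r within {0..s})"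
    unfolding v_def by (rule solves_x_deriv[OF S[OF s(2)]]) (use r s in auto)
  moreover have "at r within {0..s} = at r within {0..<1}"
    by (rule at_within_nhd[of _ "{..<s}"]) (use r s in auto)
  ultimately show ?thesis by simp
qed

lemma y_deriv: "r \<in> {0<..<1} \<Longrightarrow> (y has_real_derivative - (r ^ (N - 1) * w r * g (x r))) (at r)"
proof -
  assume r: "r \<in> {0<..<1}"
  then obtain s where s: "r < s" "s < 1" using dense[of r 1] by auto
  have "(y has_real_derivative - (r ^ (N - 1) * w r * extend g (x r))) (at r within {0..s})"
    by (rule solves_y_deriv[OF S[OF s(2)]]) (use r s in auto)
  moreover have "at r within {0..s} = at r" by (rule at_within_Icc_at) (use r s in auto)
  moreover have "0 < x r" using pos r by simp
  ultimately show ?thesis by (simp add: extend_def max_def)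
qed

lemma x_deriv: "r \<in> {0<..<1} \<Longrightarrow> (x has_real_derivative v r) (at r)"
  using x_deriv_within[of r] by (metis at_within_open greaterThanLessThan_subseteq_atLeastLessThan_iff
      has_field_derivative_subset open_greaterThanLessThan order_refl subsetD)

lemma x_cont: "continuous_on {0..<1} x"
  by (rule DERIV_continuous_on[OF x_deriv_within])

lemma wg_cont: "continuous_on {0..<1} (\<lambda>r. w r * g (x r))"
  by (intro continuous_on_mult continuous_on_subset[OF w_cont] continuous_on_compose2[OF g_cont x_cont])
    (use pos in \<open>auto simp: less_imp_le\<close>)

lemma v_0: "v 0 = 0"
  by (simp add: v_def y_0)

lemma at_0_within: "at (0::real) within {0..<1} = at_right 0"
  by (rule at_within_nhd[of _ "{-1<..<1}"]) auto

lemma tendsto_wg_0: "((\<lambda>r. w r * g (x r)) \<longlongrightarrow> w 0 * g (x 0)) (at_right 0)"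
  using wg_cont by (simp add: continuous_on_def at_0_within[symmetric])

text \<open>The quotient u'(r) / r equals y r / r^N, and a single use of l'Hospital's rule cancels
  all powers of r.\<close>

lemma q_tendsto: "((\<lambda>r. v r / r) \<longlongrightarrow> L) (at_right 0)"
proof -
  have ev: "\<forall>\<^sub>F r in at_right (0::real). r \<in> {0<..<1}"
    by (rule eventually_at_right_real) simp
  have "((\<lambda>r. y r / r ^ N) \<longlongrightarrow> L) (at_right 0)"
  proof (rule lhopital_right_0)
    have "continuous_on {0..1/2} y" by (rule solves_y_cont[OF S]) simp
    then have "(y \<longlongrightarrow> y 0) (at 0 within {0..1/2})" by (simp add: continuous_on_def)
    then show "(y \<longlongrightarrow> 0) (at_right 0)" by (simp add: at_within_Icc_at_right y_0)
    have "((\<lambda>r::real. r ^ N) \<longlongrightarrow> 0 ^ N) (at_right 0)" by (intro tendsto_intros)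
    then show "((\<lambda>r::real. r ^ N) \<longlongrightarrow> 0) (at_right 0)" by (simp add: zero_power[OF N_pos])
    show "\<forall>\<^sub>F r in at_right 0. r ^ N \<noteq> (0::real)" using ev by eventually_elim simp
    show "\<forall>\<^sub>F r in at_right 0. real N * r ^ (N - 1) \<noteq> (0::real)"
      by (rule eventually_mono[OF ev]) (use N_pos in simp)
    show "\<forall>\<^sub>F r in at_right 0. (y has_real_derivative - (r ^ (N - 1) * w r * g (x r))) (at r)"
      using ev by eventually_elim (rule y_deriv)
    show "\<forall>\<^sub>F r in at_right 0. ((\<lambda>r. r ^ N) has_real_derivative real N * r ^ (N - 1)) (at r)"
      by (intro always_eventually allI) (auto intro!: derivative_eq_intros)
    have "((\<lambda>r. - (w r * g (x r)) / real N) \<longlongrightarrow> L) (at_right 0)"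
      unfolding L_def
      by (rule tendsto_divide[OF tendsto_minus[OF tendsto_wg_0] tendsto_const]) (use N_pos in simp)
    then show "((\<lambda>r. - (r ^ (N - 1) * w r * g (x r)) / (real N * r ^ (N - 1))) \<longlongrightarrow> L) (at_right 0)"
      by (rule Lim_transform_eventually) (use ev in \<open>eventually_elim, simp\<close>)
  qed
  then show ?thesis
    by (rule Lim_transform_eventually)
      (rule eventually_mono[OF ev], use N_pos in \<open>simp add: v_def power_eq_if[of _ N]\<close>)
qed

lemma v_deriv: "r \<in> {0<..<1} \<Longrightarrow> (v has_real_derivative v' r) (at r)"
proof -
  assume r: "r \<in> {0<..<1}"
  have "((\<lambda>r. y r / r ^ (N - 1)) has_real_derivative
      (- (r ^ (N - 1) * w r * g (x r)) * r ^ (N - 1) - y r * (real (N - 1) * r ^ (N - 1 - Suc 0))) /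
        (r ^ (N - 1) * r ^ (N - 1))) (at r)"
    by (rule DERIV_divide[OF y_deriv[OF r]])
      (use r in \<open>auto intro!: derivative_eq_intros\<close>)
  moreover have "(- (r ^ (N - 1) * w r * g (x r)) * r ^ (N - 1) - y r * (real (N - 1) * r ^ (N - 1 - Suc 0))) /
        (r ^ (N - 1) * r ^ (N - 1)) = v' r"
  proof (cases "N - 1")
    case 0
    then show ?thesis by (simp add: v'_def)
  next
    case (Suc k)
    then show ?thesis using r by (simp add: v'_def q_def v_def field_simps)
  qed
  ultimately show ?thesis by (simp add: v_def[abs_def])
qed

lemma q_deriv: "r \<in> {0<..<1} \<Longrightarrow> (q has_real_derivative (v' r - q r) / r) (at r)"
proof -
  assume r: "r \<in> {0<..<1}"
  have "((\<lambda>r. v r / r) has_real_derivative (v' r * r - v r * 1) / (r * r)) (at r)"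
    by (rule DERIV_divide[OF v_deriv[OF r] DERIV_ident]) (use r in auto)
  moreover have "(v' r * r - v r * 1) / (r * r) = (v' r - q r) / r"
    using r by (simp add: q_def field_simps)
  moreover have "\<forall>\<^sub>F s in nhds r. s \<in> {0<..<1}"
    using r by (intro eventually_nhds_in_open) auto
  then have "\<forall>\<^sub>F s in nhds r. v s / s = q s"
    by eventually_elim (simp add: q_def)
  ultimately show ?thesis using DERIV_cong_ev[OF refl _ refl] by metis
qed

lemma q_cont: "continuous_on {0..<1} q"
  unfolding continuous_on_def
proof
  fix r :: real assume r: "r \<in> {0..<1}"
  show "(q \<longlongrightarrow> q r) (at r within {0..<1})"
  proof (cases "r = 0")
    case True
    have "(q \<longlongrightarrow> L) (at_right 0)"
      by (rule Lim_transform_eventually[OF q_tendsto])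
        (auto simp: q_def eventually_at_filter)
    then have "(q \<longlongrightarrow> L) (at 0 within {0..<1})"
      by (simp add: at_0_within)
    then show ?thesis using True by (simp add: q_def)
  next
    case False
    then have "isCont q r" using r by (intro DERIV_isCont[OF q_deriv]) auto
    then show ?thesis unfolding isCont_def by (rule tendsto_within_subset) simp
  qed
qed

lemma v'_cont: "continuous_on {0..<1} v'"
  unfolding v'_def[abs_def] by (intro continuous_intros wg_cont q_cont)

text \<open>With - w(0) g(u(0)) = N L, the definition leaves N L - (N - 1) L = L. That u'' and u'/r
  agree at 0 makes the Hessian continuous at the origin.\<close>

lemma v'_0: "v' 0 = q 0"
proof -
  have "real N * L = - (w 0 * g (x 0))" "real (N - 1) = real N - 1"
    using N_pos by (simp_all add: L_def of_nat_diff)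
  then show ?thesis by (simp add: v'_def q_def left_diff_distrib)
qed

definition D :: "real ^ 'n \<Rightarrow> real ^ 'n" where
  "D z = q (norm z) *\<^sub>R z"

definition c :: "real \<Rightarrow> real" where
  "c r = (v' r - q r) / r\<^sup>2"

text \<open>Hessian of a radial function: (u'/r) I + (u'' - u'/r) z z^T / r^2. At the origin z = 0
  leaves only the multiple \<open>q 0\<close> of the identity.\<close>

definition H :: "real ^ 'n \<Rightarrow> real ^ 'n ^ 'n" where
  "H z = (\<chi> i j. (if i = j then q (norm z) else 0) + c (norm z) * (z $ i * z $ j))"

lemma H_mult: "H z *v h = q (norm z) *\<^sub>R h + (c (norm z) * (z \<bullet> h)) *\<^sub>R z"
proof (rule vec_eq_iff[THEN iffD2], rule allI)
  fix i
  have "(H z *v h) $ i = (\<Sum>j\<in>UNIV. (if i = j then q (norm z) * h $ j else 0) + c (norm z) * z $ i * (z $ j * h $ j))"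
    unfolding matrix_vector_mult_def H_def by (auto intro!: sum.cong simp: algebra_simps)
  also have "\<dots> = q (norm z) * h $ i + c (norm z) * z $ i * (z \<bullet> h)"
    by (simp add: sum.distrib sum_distrib_left[symmetric] inner_vec_def)
  finally show "(H z *v h) $ i = (q (norm z) *\<^sub>R h + (c (norm z) * (z \<bullet> h)) *\<^sub>R z) $ i" by simp
qed

lemma norm_cont_comp:
  fixes f :: "real \<Rightarrow> real"
  assumes "continuous_on {0..<1} f"
  shows "continuous_on (ball 0 1) (\<lambda>z :: real ^ 'n. f (norm z))"
  by (rule continuous_on_compose2[OF assms]) (auto intro!: continuous_intros)

text \<open>The norm is not differentiable at 0; there the difference quotient is that of u at 0,
  composed with the norm, and it tends to u'(0) = 0. Elsewhere the chain rule applies.\<close>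

lemma U_deriv:
  fixes z :: "real ^ 'n"
  assumes z: "z \<in> ball 0 1"
  shows "((\<lambda>z. x (norm z)) has_derivative (\<lambda>h. D z \<bullet> h)) (at z)"
proof (cases "z = 0")
  case False
  then have r: "norm z \<in> {0<..<1}" using z by simp
  have "(x has_derivative (*) (v (norm z))) (at (norm z))"
    using x_deriv[OF r] by (simp add: has_field_derivative_def)
  from has_derivative_compose[OF has_derivative_norm[OF False] this]
  have "((\<lambda>z. x (norm z)) has_derivative (\<lambda>h. v (norm z) * (sgn z \<bullet> h))) (at z)" by (simp add: inner_commute)
  moreover have "v (norm z) * (sgn z \<bullet> h) = D z \<bullet> h" for h
    using False by (simp add: D_def q_def sgn_div_norm divide_inverse)
  ultimately show ?thesis by simp
next
  case True
  have "((\<lambda>h. (x (norm h) - x (norm z) - D z \<bullet> (h - z)) /\<^sub>R norm (h - z)) \<longlongrightarrow> 0) (at z)"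
  proof -
    have "((\<lambda>r. (x r - x 0) / (r - 0)) \<longlongrightarrow> 0) (at 0 within {0..<1})"
      using x_deriv_within[of 0] by (simp add: has_field_derivative_iff v_0)
    moreover have "filterlim norm (at 0 within {0..<1}) (at (0 :: real ^ 'n))"
    proof -
      have "\<forall>\<^sub>F h in at (0 :: real ^ 'n). norm h < 1"
        using eventually_nhds_in_open[of "ball (0 :: real ^ 'n) 1" 0]
        by (auto simp: eventually_at_filter elim!: eventually_mono)
      then have "\<forall>\<^sub>F h in at (0 :: real ^ 'n). norm h \<in> {0..<1} \<and> norm h \<noteq> 0"
        unfolding eventually_at_filter by (rule eventually_mono) auto
      moreover have "(norm \<longlongrightarrow> 0) (at (0 :: real ^ 'n))"
        using tendsto_norm[OF tendsto_ident_at, of "0 :: real ^ 'n" UNIV] by simp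
      ultimately show ?thesis by (simp add: filterlim_at)
    qed
    ultimately have "((\<lambda>h. (x (norm h) - x 0) / (norm h - 0)) \<longlongrightarrow> 0) (at (0 :: real ^ 'n))"
      by (rule filterlim_compose)
    then show ?thesis using True by (simp add: D_def divide_inverse mult.commute)
  qed
  then show ?thesis
    by (simp add: has_derivative_at_within True D_def)
qed

lemma D_deriv:
  fixes z :: "real ^ 'n"
  assumes z: "z \<in> ball 0 1"
  shows "(D has_derivative (\<lambda>h. H z *v h)) (at z)"
proof (cases "z = 0")
  case False
  then have r: "norm z \<in> {0<..<1}" using z by simp
  let ?q' = "(v' (norm z) - q (norm z)) / norm z"
  have "(q has_derivative (*) ?q') (at (norm z))"
    using q_deriv[OF r] by (simp add: has_field_derivative_def)
  from has_derivative_compose[OF has_derivative_norm[OF False] this]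
  have "((\<lambda>z. q (norm z)) has_derivative (\<lambda>h. ?q' * (sgn z \<bullet> h))) (at z)" by (simp add: inner_commute)
  from has_derivative_scaleR[OF this has_derivative_ident]
  have "((\<lambda>z. q (norm z) *\<^sub>R z) has_derivative (\<lambda>h. q (norm z) *\<^sub>R h + (?q' * (sgn z \<bullet> h)) *\<^sub>R z)) (at z)" .
  moreover have "?q' * (sgn z \<bullet> h) = c (norm z) * (z \<bullet> h)" for h
    using False by (simp add: c_def sgn_div_norm power2_eq_square field_simps)
  ultimately show ?thesis by (simp add: D_def[abs_def] H_mult)
next
  case True
  have "((\<lambda>h. (D h - D z - H z *v (h - z)) /\<^sub>R norm (h - z)) \<longlongrightarrow> 0) (at z)"
  proof (rule Lim_null_comparison)
    show "\<forall>\<^sub>F h in at z. norm ((D h - D z - H z *v (h - z)) /\<^sub>R norm (h - z)) \<le> \<bar>q (norm h) - q 0\<bar>"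
    proof (rule always_eventually, rule allI)
      fix h :: "real ^ 'n"
      \<comment> \<open>At the origin the remainder is a scalar multiple of h whose factor tends to
        0 by the continuity of \<open>q\<close>.\<close>
      have eq: "D h - D z - H z *v (h - z) = (q (norm h) - q 0) *\<^sub>R h"
        by (simp add: True D_def H_mult scaleR_left_diff_distrib)
      have "norm ((D h - D z - H z *v (h - z)) /\<^sub>R norm (h - z)) = \<bar>q (norm h) - q 0\<bar> * (norm h / norm h)"
        unfolding eq by (simp add: True abs_mult divide_inverse mult_ac)
      also have "\<dots> \<le> \<bar>q (norm h) - q 0\<bar>" by (cases "h = 0") auto
      finally show "norm ((D h - D z - H z *v (h - z)) /\<^sub>R norm (h - z)) \<le> \<bar>q (norm h) - q 0\<bar>" .
    qed
    have "isCont (\<lambda>z :: real ^ 'n. q (norm z)) z"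
      using norm_cont_comp[OF q_cont] z
      unfolding continuous_on_eq_continuous_at[OF open_ball] by blast
    then have "((\<lambda>h. \<bar>q (norm h) - q 0\<bar>) \<longlongrightarrow> \<bar>q (norm z) - q 0\<bar>) (at z)"
      unfolding isCont_def by (intro tendsto_intros)
    then show "((\<lambda>h. \<bar>q (norm h) - q 0\<bar>) \<longlongrightarrow> 0) (at z)" using True by simp
  qed
  then show ?thesis
    by (simp add: has_derivative_at_within matrix_vector_mul_bounded_linear)
qed

text \<open>Only \<open>c\<close> is singular at the origin. As |z_i z_j| <= |z|^2, its term is
  bounded by |v' - q|, which tends to 0 there by \<open>v'_0\<close>.\<close>

lemma H_cont: "continuous_on (ball 0 1) (H :: real ^ 'n \<Rightarrow> _)"
proof -
  have "continuous_on (ball 0 1) (\<lambda>z. c (norm z) * (z $ i * z $ j))" for i j :: 'n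
    unfolding continuous_on_eq_continuous_at[OF open_ball]
  proof
    fix z :: "real ^ 'n" assume z: "z \<in> ball 0 1"
    have cont: "isCont (\<lambda>z :: real ^ 'n. v' (norm z) - q (norm z)) z"
      using continuous_on_diff[OF norm_cont_comp[OF v'_cont] norm_cont_comp[OF q_cont]] z
      unfolding continuous_on_eq_continuous_at[OF open_ball] by blast
    show "isCont (\<lambda>z. c (norm z) * (z $ i * z $ j)) z"
    proof (cases "z = 0")
      case False
      then show ?thesis unfolding c_def by (intro continuous_intros cont) auto
    next
      case True
      have "((\<lambda>z :: real ^ 'n. c (norm z) * (z $ i * z $ j)) \<longlongrightarrow> 0) (at 0)"
      proof (rule Lim_null_comparison)
        show "\<forall>\<^sub>F z in at (0 :: real ^ 'n). norm (c (norm z) * (z $ i * z $ j)) \<le> \<bar>v' (norm z) - q (norm z)\<bar>"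
        proof (rule always_eventually, rule allI)
          fix z :: "real ^ 'n"
          have "\<bar>z $ i\<bar> * \<bar>z $ j\<bar> \<le> norm z * norm z"
            by (intro mult_mono component_le_norm_cart) auto
          then have "\<bar>v' (norm z) - q (norm z)\<bar> / (norm z)\<^sup>2 * (\<bar>z $ i\<bar> * \<bar>z $ j\<bar>)
              \<le> \<bar>v' (norm z) - q (norm z)\<bar> / (norm z)\<^sup>2 * (norm z * norm z)"
            by (rule mult_left_mono) simp
          also have "\<dots> \<le> \<bar>v' (norm z) - q (norm z)\<bar>"
            by (simp add: power2_eq_square)
          finally show "norm (c (norm z) * (z $ i * z $ j)) \<le> \<bar>v' (norm z) - q (norm z)\<bar>"
            by (simp add: c_def abs_mult)
        qed
        have "((\<lambda>z. \<bar>v' (norm z) - q (norm z)\<bar>) \<longlongrightarrow> \<bar>v' 0 - q 0\<bar>) (at (0 :: real ^ 'n))"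
          using cont True by (intro tendsto_rabs) (simp add: isCont_def)
        then show "((\<lambda>z. \<bar>v' (norm z) - q (norm z)\<bar>) \<longlongrightarrow> 0) (at (0 :: real ^ 'n))" by (simp add: v'_0)
      qed
      then show ?thesis using True by (simp add: isCont_def)
    qed
  qed
  moreover have "continuous_on (ball 0 1) (\<lambda>z :: real ^ 'n. if i = j then q (norm z) else 0)" for i j :: 'n
    using norm_cont_comp[OF q_cont] by (cases "i = j") auto
  ultimately show ?thesis
    unfolding H_def[abs_def] by (intro continuous_on_vec_lambda continuous_on_add)
qed

text \<open>The trace of the Hessian is N q + (v' - q) = v' + (N - 1) q, which is the radial
  operator by the definition of \<open>v'\<close>.\<close>

lemma large_solution:
  assumes N: "N = CARD('n)"
  shows "large_solution w g (\<lambda>z :: real ^ 'n. x (norm z))"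
  unfolding large_solution_def
proof (intro conjI ballI)
  show "C2_on (ball 0 1) (\<lambda>z :: real ^ 'n. x (norm z))"
    unfolding C2_on_def using U_deriv D_deriv H_cont by blast
next
  fix z :: "real ^ 'n" assume z: "z \<in> ball 0 1"
  have "laplacian (\<lambda>z. x (norm z)) z = (\<Sum>i\<in>UNIV. H z $ i $ i)"
    by (rule C2_laplacian[of "ball 0 1" z _ D H]) (use z U_deriv D_deriv in auto)
  also have "\<dots> = real CARD('n) * q (norm z) + c (norm z) * (z \<bullet> z)"
    by (simp add: H_def sum.distrib sum_distrib_left[symmetric] inner_vec_def)
  also have "c (norm z) * (z \<bullet> z) = v' (norm z) - q (norm z)"
    by (cases "z = 0") (simp_all add: v'_0 c_def power2_norm_eq_inner[symmetric])
  also have "real CARD('n) * q (norm z) + (v' (norm z) - q (norm z)) = - (w (norm z) * g (x (norm z)))"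
    using N_pos by (simp add: v'_def of_nat_diff left_diff_distrib flip: N)
  finally show "laplacian (\<lambda>z. x (norm z)) z + w (norm z) * g (x (norm z)) = 0" by simp
next
  fix z :: "real ^ 'n" assume "z \<in> frontier (ball 0 1)"
  then have z: "norm z = 1" by simp
  have "filterlim norm (at_left 1) (at z within ball 0 1)"
  proof -
    have "(norm \<longlongrightarrow> norm z) (at z within ball 0 1)" by (intro tendsto_intros)
    moreover have "\<forall>\<^sub>F h in at z within ball 0 1. norm h \<in> {..<1} \<and> norm h \<noteq> 1"
      by (auto simp: eventually_at_filter)
    ultimately show ?thesis using z by (simp add: filterlim_at)
  qed
  with blow_up show "filterlim (\<lambda>z. x (norm z)) at_top (at z within ball 0 1)"
    by (rule filterlim_compose)
qed

lemma radial_profile: "radial_profile N w g x"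
  unfolding radial_profile_def
proof (intro conjI exI[of _ v] ballI)
  fix r :: real assume r: "r \<in> {0<..<1}"
  have "\<forall>\<^sub>F s in nhds r. s \<in> {0<..<1}"
    using r by (intro eventually_nhds_in_open) auto
  then have "\<forall>\<^sub>F s in nhds r. y s = s ^ (N - 1) * v s"
    by eventually_elim (simp add: v_def)
  from DERIV_cong_ev[OF refl this refl] y_deriv[OF r]
  show "((\<lambda>s. s ^ (N - 1) * v s) has_real_derivative - (r ^ (N - 1) * w r * g (x r))) (at r)" by blast
qed (use x_deriv_within v_0 blow_up in auto)

end

section \<open>The multiplicity theorem\<close>

context shooting
begin

lemma large_pos: "large d \<Longrightarrow> r \<in> {0..<1} \<Longrightarrow> 0 < X d r"
  unfolding large_def by (intro not_hits_pos[of d 1]) auto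

lemma large_solves:
  assumes "large d" "s < 1"
  shows "solves N w g 0 s (X d) (Y d)"
  by (rule solves_X) (use assms in \<open>auto simp: large_def\<close>)

text \<open>At some time before 1 the value exceeds K with positive flux; on the last negative
  interval both persist, so the value stays above K up to 1.\<close>

lemma large_blow_up:
  assumes d: "large d" and l: "0 \<le> l" "l < 1" and w: "\<And>r. r \<in> {l..1} \<Longrightarrow> w r \<le> 0"
  shows "filterlim (X d) at_top (at_left 1)"
  unfolding filterlim_at_top
proof
  fix K
  have D: "\<And>t. t < 1 \<Longrightarrow> defined d t" "\<not> defined d 1" using d by (auto simp: large_def)
  obtain t where t: "l \<le> t" "t < 1" "K < X d t" "0 < Y d t"
    by (rule blow_up_on_negative_interval[OF D(1)[OF l(2)] D(2), of K]) (use l w in auto)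
  have "K \<le> X d s" if "t < s" "s < 1" for s
    using stays_large(1)[OF D(1)[OF that(2)], of t] that t l w by auto
  then show "\<forall>\<^sub>F s in at_left 1. K \<le> X d s"
    unfolding eventually_at_left_field using t(2) by blast
qed

lemma large_imp_solution:
  assumes N: "N = CARD('n)" and d: "large d" and l: "0 \<le> l" "l < 1" and w: "\<And>r. r \<in> {l..1} \<Longrightarrow> w r \<le> 0"
  shows "positive_radial_large_solution w g (\<lambda>z :: real ^ 'n. X d (norm z))"
proof -
  interpret R: radial_large N w g "X d" "Y d"
  proof
    show "0 < N" using N by simp
    show "continuous_on {0..1} w" by (rule weight_cont)
    show "continuous_on {0..} g" by (rule g_cont)
    show "filterlim (X d) at_top (at_left 1)" by (rule large_blow_up[OF d l w])
  qed (use large_solves[OF d] large_pos[OF d] in auto)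
  show ?thesis
    unfolding positive_radial_large_solution_def
  proof (intro conjI ballI exI[of _ "X d"])
    show "large_solution w g (\<lambda>z :: real ^ 'n. X d (norm z))" by (rule R.large_solution[OF N])
    show "radial_profile CARD('n) w g (X d)" using R.radial_profile N by simp
  qed (use large_pos[OF d] in auto)
qed

end

lemma weight_nonneg_eq: "0 \<le> a r \<Longrightarrow> weight a \<mu> r = a r"
  by (simp add: weight_def max_def)

lemma weight_nonpos_eq: "a r \<le> 0 \<Longrightarrow> weight a \<mu> r = \<mu> * a r"
  by (simp add: weight_def max_def)

theorem theorem3p1:
  fixes a g :: "real \<Rightarrow> real" and m :: nat and \<sigma> \<tau> :: "nat \<Rightarrow> real"
  assumes a_cont: "continuous_on {0..1} a"
    and a_end: "a 1 < 0"
    and m_pos: "m \<ge> 1"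
    and tau_0: "\<tau> 0 = 0"
    and sigma_end: "\<sigma> (m + 1) = 1"
    and tau_sigma: "\<And>i. i \<in> {0..m} \<Longrightarrow> \<tau> i < \<sigma> (i + 1)"
    and sigma_tau: "\<And>i. i \<in> {1..m} \<Longrightarrow> \<sigma> i < \<tau> i"
    and a_nonneg: "\<And>i. i \<in> {1..m} \<Longrightarrow>
      (\<forall>r\<in>{\<sigma> i..\<tau> i}. a r \<ge> 0) \<and> (\<exists>r\<in>{\<sigma> i..\<tau> i}. a r \<noteq> 0)"
    and a_nonpos: "\<And>i. i \<in> {0..m} \<Longrightarrow>
      (\<forall>r\<in>{\<tau> i..\<sigma> (i + 1)}. a r \<le> 0) \<and> (\<exists>r\<in>{\<tau> i..\<sigma> (i + 1)}. a r \<noteq> 0)"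
    and g_lip: "locally_lipschitz_on {0..} g"
    and g_0: "g 0 = 0"
    and g_pos: "\<And>u. u > 0 \<Longrightarrow> g u > 0"
    and g_zero: "((\<lambda>u. g u / u) \<longlongrightarrow> 0) (at_right 0)"
    and g_infty: "filterlim (\<lambda>u. g u / u) at_top at_top"
    and keller_osserman:
      "(\<integral>\<^sup>+ \<xi>\<in>{1..}. ennreal (1 / sqrt (primitive g \<xi>)) \<partial>lborel) < \<infinity>"
    and time_to_infty:
      "((\<lambda>u. \<integral>\<^sup>+ \<xi>\<in>{u<..}. ennreal (1 / sqrt (primitive g \<xi> - primitive g u)) \<partial>lborel)
          \<longlongrightarrow> 0) at_top"
  shows "\<exists>\<mu>\<^sub>0>0. \<forall>\<mu>>\<mu>\<^sub>0. \<exists>S :: (real ^ 'n \<Rightarrow> real) set.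
      card S = 2 ^ m \<and>
      inj_on (\<lambda>U. restrict U (ball 0 1)) S \<and>
      (\<forall>U\<in>S. positive_radial_large_solution (weight a \<mu>) g U)"
proof -
  let ?N = "CARD('n)"
  have g_cont: "continuous_on {0..} g"
    using local_lipschitz_continuous_on[OF g_lip[unfolded locally_lipschitz_on_def], of 0] by simp
  interpret superlinear ?N g
    by unfold_locales (fact g_cont g_0 g_pos g_zero g_infty time_to_infty)+
  have shooting: "shooting (weight a \<mu>) g" for \<mu>
  proof unfold_locales
    show "continuous_on {0..1} (weight a \<mu>)"
      unfolding weight_def[abs_def] by (intro continuous_intros a_cont)
    show "locally_lipschitz_on {0..} g" by (rule g_lip)
  qed
  have \<tau>_nonneg: "0 \<le> \<tau> i" if "i \<le> m" for i
    using that
  proof (induction i)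
    case (Suc i)
    with tau_sigma[of i] sigma_tau[of "Suc i"] show ?case by auto
  qed (simp add: tau_0)
  have \<sigma>_le: "\<sigma> (i + 1) \<le> 1" if "i \<le> m" for i
    using that
  proof (induction i rule: inc_induct)
    case (step n)
    with tau_sigma[of "Suc n"] sigma_tau[of "Suc n"] show ?case by auto
  qed (use sigma_end in simp)
  have a_sub: "continuous_on {l..h} a" if "0 \<le> l" "h \<le> 1" for l h
    by (rule continuous_on_subset[OF a_cont]) (use that in auto)
  have neg: "a r \<le> 0" "weight a \<mu> r = \<mu> * a r" "1 < \<mu> \<Longrightarrow> weight a \<mu> r \<le> 0"
    if "i \<le> m" "r \<in> {\<tau> i..\<sigma> (i + 1)}" for i r \<mu>
    using a_nonpos[of i] that by (auto simp: weight_nonpos_eq mult_nonneg_nonpos)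
  have pos: "0 \<le> a r" "weight a \<mu> r = a r" if "i \<in> {1..m}" "r \<in> {\<sigma> i..\<tau> i}" for i r \<mu>
    using a_nonneg[of i] that by (auto simp: weight_nonneg_eq)
  \<comment> \<open>The constants R, \<rho>, \<theta>, f and C obtained below do not involve \<mu>;
    only then are thresholds for \<mu> taken, one from \<open>medium_blow_up\<close> and one from
    \<open>turning_point_small\<close>.\<close>
  have step: "\<exists>\<mu>0\<ge>1. \<forall>\<mu>>\<mu>0. shooting.splits ?N (weight a \<mu>) g (\<tau> (i - 1)) (\<sigma> i) (\<tau> i) (\<sigma> (i + 1))"
    if i: "i \<in> {1..m}" for i
  proof -
    have ord: "0 \<le> \<tau> (i - 1)" "\<tau> (i - 1) < \<sigma> i" "\<sigma> i < \<tau> i" "\<tau> i < \<sigma> (i + 1)" "\<sigma> (i + 1) \<le> 1"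
      using \<tau>_nonneg[of "i - 1"] tau_sigma[of "i - 1"] sigma_tau[of i] tau_sigma[of i] \<sigma>_le[of i] i by auto
    have neg1: "a r \<le> 0" "weight a \<mu> r = \<mu> * a r" "1 < \<mu> \<Longrightarrow> weight a \<mu> r \<le> 0"
      if "r \<in> {\<tau> (i - 1)..\<sigma> i}" for r \<mu>
      using neg(1)[of "i - 1" r] neg(2,3)[of "i - 1" r \<mu>] that i by auto
    have ne1: "\<exists>r\<in>{\<tau> (i - 1)..\<sigma> i}. a r \<noteq> 0" using a_nonpos[of "i - 1"] i by auto
    have neg2: "a r \<le> 0" "weight a \<mu> r = \<mu> * a r" "1 < \<mu> \<Longrightarrow> weight a \<mu> r \<le> 0"
      if "r \<in> {\<tau> i..\<sigma> (i + 1)}" for r \<mu>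
      using neg(1)[of i r] neg(2,3)[of i r \<mu>] that i by auto
    have ne2: "\<exists>r\<in>{\<tau> i..\<sigma> (i + 1)}. a r \<noteq> 0" using a_nonpos[of i] i by auto
    have ne0: "\<exists>r\<in>{\<sigma> i..\<tau> i}. a r \<noteq> 0" using a_nonneg[of i] i by auto
    obtain R C' where R: "\<And>w x y. solves ?N w g (\<sigma> i) (\<tau> i) x y \<Longrightarrow> (\<And>r. r \<in> {\<sigma> i..\<tau> i} \<Longrightarrow> w r = a r) \<Longrightarrow>
        (\<And>r. r \<in> {\<sigma> i..\<tau> i} \<Longrightarrow> 0 < x r) \<Longrightarrow> x (\<sigma> i) \<le> R \<and> - C' \<le> y (\<tau> i)"
      by (rule hump_bound[of "\<sigma> i" "\<tau> i" a]) (use ord a_sub pos i ne0 in auto)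
    obtain \<rho> \<theta> where \<rho>: "0 < \<rho>" "0 \<le> \<theta>" "\<theta> / \<sigma> i ^ (?N - 1) \<le> \<rho> / 4"
      "\<And>w x y r0. solves ?N w g (\<sigma> i) (\<tau> i) x y \<Longrightarrow> (\<And>r. r \<in> {\<sigma> i..\<tau> i} \<Longrightarrow> w r = a r) \<Longrightarrow>
        0 \<le> y (\<sigma> i) \<Longrightarrow> 0 < x (\<sigma> i) \<Longrightarrow> (\<And>r. r \<in> {\<sigma> i..\<tau> i} \<Longrightarrow> x r \<le> \<rho>) \<Longrightarrow>
        r0 \<in> {\<sigma> i..\<tau> i} \<Longrightarrow> x r0 = \<rho> \<Longrightarrow>
        (\<forall>r\<in>{\<sigma> i..\<tau> i}. 0 < x r) \<and> 3 * \<rho> / 4 \<le> x (\<tau> i) \<and> - \<theta> \<le> y (\<tau> i)"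
      by (rule small_hump[of "\<sigma> i" "\<tau> i" a]) (use ord a_sub pos i in auto)
    have "\<theta> / \<tau> i ^ (?N - 1) \<le> \<theta> / \<sigma> i ^ (?N - 1)"
      using ord \<rho>(2) by (intro divide_left_mono power_mono mult_pos_pos zero_less_power) auto
    with \<rho>(3) have \<theta>: "\<theta> / \<tau> i ^ (?N - 1) \<le> \<rho> / 4" by linarith
    obtain f \<mu>1 where f: "\<tau> i < f" "f < \<sigma> (i + 1)" "1 \<le> \<mu>1"
      "\<And>\<mu> w x y. \<mu>1 < \<mu> \<Longrightarrow> (\<And>r. r \<in> {\<tau> i..\<sigma> (i + 1)} \<Longrightarrow> w r = \<mu> * a r) \<Longrightarrow> solves ?N w g (\<tau> i) f x y \<Longrightarrow>
        3 * \<rho> / 4 \<le> x (\<tau> i) \<Longrightarrow> - \<theta> \<le> y (\<tau> i) \<Longrightarrow> False"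
      by (rule medium_blow_up[of "\<tau> i" "\<sigma> (i + 1)" a \<rho> \<theta>]) (use ord a_sub neg2(1) ne2 \<rho> \<theta> in auto)
    \<comment> \<open>A lower bound for the flux at the start of the negative interval, uniform in
      \<mu> and d. For i = 1 the interval starts at the centre, where the flux is 0. Otherwise
      \<open>hump_bound\<close> on the preceding hump gives it, as a solution that has not hit 0 by
      \<sigma> i is positive there.\<close>
    obtain C where C: "\<And>\<mu> d. shooting_ode.defined ?N (weight a \<mu>) g d (\<sigma> i) \<Longrightarrow>
        \<not> shooting.hits ?N (weight a \<mu>) g d (\<sigma> i) \<Longrightarrow> - C \<le> shooting_ode.Y ?N (weight a \<mu>) g d (\<tau> (i - 1))"
    proof (cases "i = 1")
      case True
      have "- 0 \<le> shooting_ode.Y ?N (weight a \<mu>) g d (\<tau> (i - 1))" for \<mu> d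
      proof -
        interpret M: shooting ?N "weight a \<mu>" g by (rule shooting)
        show ?thesis using True tau_0 by simp
      qed
      then show ?thesis by (rule that)
    next
      case False
      define j where "j = i - 1"
      have j: "j \<in> {1..m}" "j \<le> m" using i False by (auto simp: j_def)
      have j': "j - 1 \<in> {0..m}" "j - 1 \<le> m" "j - 1 + 1 = j" using j by auto
      have "0 < \<sigma> j" using \<tau>_nonneg[OF j'(2)] tau_sigma[OF j'(1)] unfolding j'(3) by linarith
      then have ordj: "0 < \<sigma> j" "\<sigma> j < \<tau> j" "\<tau> j \<le> \<sigma> i"
        using sigma_tau[OF j(1)] ord(2) by (simp_all add: j_def)
      obtain R' C where R': "\<And>w x y. solves ?N w g (\<sigma> j) (\<tau> j) x y \<Longrightarrow> (\<And>r. r \<in> {\<sigma> j..\<tau> j} \<Longrightarrow> w r = a r) \<Longrightarrow>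
          (\<And>r. r \<in> {\<sigma> j..\<tau> j} \<Longrightarrow> 0 < x r) \<Longrightarrow> x (\<sigma> j) \<le> R' \<and> - C \<le> y (\<tau> j)"
        by (rule hump_bound[of "\<sigma> j" "\<tau> j" a]) (use ordj ord a_sub pos j a_nonneg[of j] in auto)
      have "- C \<le> shooting_ode.Y ?N (weight a \<mu>) g d (\<tau> (i - 1))"
        if d: "shooting_ode.defined ?N (weight a \<mu>) g d (\<sigma> i)" "\<not> shooting.hits ?N (weight a \<mu>) g d (\<sigma> i)" for \<mu> d
      proof -
        interpret M: shooting ?N "weight a \<mu>" g by (rule shooting)
        have D: "M.defined d (\<tau> j)" by (rule M.defined_mono[OF d(1) ordj(3)])
        have "- C \<le> M.Y d (\<tau> j)"
        proof (rule R'[THEN conjunct2])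
          show "solves ?N (weight a \<mu>) g (\<sigma> j) (\<tau> j) (M.X d) (M.Y d)"
            by (rule M.solves_XY[OF D]) (use ordj ord in auto)
          show "weight a \<mu> r = a r" if "r \<in> {\<sigma> j..\<tau> j}" for r by (rule pos(2)[OF j(1) that])
          show "0 < M.X d r" if "r \<in> {\<sigma> j..\<tau> j}" for r
            by (rule M.not_hits_pos[OF d(2)]) (use that ordj M.defined_mono[OF D] in auto)
        qed
        then show ?thesis by (simp add: j_def)
      qed
      then show ?thesis by (rule that)
    qed
    obtain \<mu>2 where \<mu>2: "1 \<le> \<mu>2"
      "\<And>\<mu> w x y. \<mu>2 < \<mu> \<Longrightarrow> (\<And>r. r \<in> {\<tau> (i - 1)..\<sigma> i} \<Longrightarrow> w r = \<mu> * a r) \<Longrightarrow>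
        solves ?N w g (\<tau> (i - 1)) (\<sigma> i) x y \<Longrightarrow> - C \<le> y (\<tau> (i - 1)) \<Longrightarrow> y (\<sigma> i) = 0 \<Longrightarrow> x (\<sigma> i) \<le> \<rho> / 2"
      by (rule turning_point_small[of "\<tau> (i - 1)" "\<sigma> i" a "\<rho> / 2" C])
        (use ord a_sub neg1(1) ne1 \<rho> in auto)
    have "shooting.splits ?N (weight a \<mu>) g (\<tau> (i - 1)) (\<sigma> i) (\<tau> i) (\<sigma> (i + 1))" if \<mu>: "max \<mu>1 \<mu>2 < \<mu>" for \<mu>
    proof -
      interpret M: shooting ?N "weight a \<mu>" g by (rule shooting)
      have \<mu>1: "1 < \<mu>" using \<mu> f(3) by simp
      show ?thesis
        unfolding M.splits_def
      proof (intro allI impI)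
        fix e p q :: real
        assume e: "\<bar>e\<bar> = 1" and br: "M.branch e p q (\<tau> (i - 1)) (\<sigma> i)"
        have "\<exists>p1 q1 p2 q2 sm. M.branch e p1 q1 (\<tau> i) (\<sigma> (i + 1)) \<and> M.branch (- e) p2 q2 (\<tau> i) (\<sigma> (i + 1)) \<and>
          p \<le> p1 \<and> q1 \<le> sm \<and> sm \<le> - q2 \<and> - p2 < q \<and> \<not> M.defined (e * sm) f"
        proof (rule M.branch_split[OF ord _ _ _ \<rho>(1,2) \<theta> f(1,2) _ _ _ _ e br])
          show "weight a \<mu> r \<le> 0" if "r \<in> {\<tau> (i - 1)..\<sigma> i}" for r using neg1(3)[OF that \<mu>1] .
          show "weight a \<mu> r \<le> 0" if "r \<in> {\<tau> i..\<sigma> (i + 1)}" for r using neg2(3)[OF that \<mu>1] .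
          show "0 \<le> weight a \<mu> r" if "r \<in> {\<sigma> i..\<tau> i}" for r using pos[OF i that] by simp
        next
          fix d assume d: "M.defined d (\<sigma> i)" "\<not> M.hits d (\<sigma> i)" "M.Y d (\<sigma> i) = 0"
          show "M.X d (\<sigma> i) \<le> \<rho> / 2"
            by (rule \<mu>2(2)[OF _ neg1(2) M.solves_XY[OF d(1)] C[OF d(1,2)] d(3)]) (use \<mu> ord in auto)
        next
          fix d r0
          assume "M.defined d (\<tau> i)" "0 \<le> M.Y d (\<sigma> i)" "0 < M.X d (\<sigma> i)"
            "\<And>r. r \<in> {\<sigma> i..\<tau> i} \<Longrightarrow> M.X d r \<le> \<rho>" "r0 \<in> {\<sigma> i..\<tau> i}" "M.X d r0 = \<rho>"
          then show "(\<forall>r\<in>{\<sigma> i..\<tau> i}. 0 < M.X d r) \<and> 3 * \<rho> / 4 \<le> M.X d (\<tau> i) \<and> - \<theta> \<le> M.Y d (\<tau> i)"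
            by (intro \<rho>(4)[OF M.solves_XY pos(2)[OF i]]) (use ord in auto)
        next
          fix d assume d: "3 * \<rho> / 4 \<le> M.X d (\<tau> i)" "- \<theta> \<le> M.Y d (\<tau> i)"
          show "\<not> M.defined d f"
          proof
            assume D: "M.defined d f"
            show False
              by (rule f(4)[OF _ neg2(2) M.solves_XY[OF D] d]) (use \<mu> f ord in auto)
          qed
        next
          fix d assume d: "M.defined d (\<tau> i)" "\<And>r. r \<in> {\<sigma> i..\<tau> i} \<Longrightarrow> 0 < M.X d r"
          show "M.X d (\<sigma> i) \<le> R"
            by (rule R[THEN conjunct1, OF M.solves_XY[OF d(1)] pos(2)[OF i] d(2)]) (use ord in auto)
        qed
        with f(2) show "\<exists>p1 q1 p2 q2 sm f. M.branch e p1 q1 (\<tau> i) (\<sigma> (i + 1)) \<and> M.branch (- e) p2 q2 (\<tau> i) (\<sigma> (i + 1)) \<and>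
          p \<le> p1 \<and> q1 \<le> sm \<and> sm \<le> - q2 \<and> - p2 < q \<and> f < \<sigma> (i + 1) \<and> \<not> M.defined (e * sm) f" by blast
      qed
    qed
    then show ?thesis using f(3) by (intro exI[of _ "max \<mu>1 \<mu>2"]) auto
  qed
  then obtain \<mu>0 where \<mu>0: "\<And>i. i \<in> {1..m} \<Longrightarrow> 1 \<le> \<mu>0 i"
    "\<And>i \<mu>. i \<in> {1..m} \<Longrightarrow> \<mu>0 i < \<mu> \<Longrightarrow>
      shooting.splits ?N (weight a \<mu>) g (\<tau> (i - 1)) (\<sigma> i) (\<tau> i) (\<sigma> (i + 1))"
    by metis
  define \<mu>s where "\<mu>s = Max (\<mu>0 ` {1..m})"
  have \<mu>s: "\<mu>0 i \<le> \<mu>s" if "i \<in> {1..m}" for i unfolding \<mu>s_def using that by (intro Max_ge) auto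
  have \<mu>s1: "1 \<le> \<mu>s" using \<mu>s[of 1] \<mu>0(1)[of 1] m_pos by auto
  have \<tau>m: "0 \<le> \<tau> m" "\<tau> m < 1" using \<tau>_nonneg[of m] tau_sigma[of m] sigma_end by auto
  \<comment> \<open>By continuity a <= a(1)/2 < 0 near 1; this is the negativity that excludes
    blow-up before 1 at the ends of the final branches.\<close>
  obtain t0 where t0: "t0 < 1" "\<And>r. r \<in> {t0..1} \<Longrightarrow> a r \<le> a 1 / 2"
  proof -
    obtain \<delta> where \<delta>: "\<delta> > 0" "\<And>r. r \<in> {0..1} \<Longrightarrow> \<bar>r - 1\<bar> < \<delta> \<Longrightarrow> \<bar>a r - a 1\<bar> < - a 1 / 2"
      using a_cont[unfolded continuous_on_iff, rule_format, of 1 "- a 1 / 2"] a_end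
      by (auto simp: dist_real_def)
    have "a r \<le> a 1 / 2" if "r \<in> {max 0 (1 - \<delta> / 2)..1}" for r
    proof -
      have "\<bar>a r - a 1\<bar> < - a 1 / 2" by (rule \<delta>(2)) (use that \<delta>(1) in auto)
      then show ?thesis by linarith
    qed
    then show ?thesis using that[of "max 0 (1 - \<delta> / 2)"] \<delta>(1) by auto
  qed
  have first: "0 < \<sigma> 1" "\<sigma> 1 \<le> 1" using tau_sigma[of 0] tau_0 \<sigma>_le[of 0] by auto
  have "continuous_on {0..\<sigma> 1} (\<lambda>r. - a r)" by (intro continuous_intros a_sub) (use first in auto)
  then obtain c f k where cf: "0 < c" "c < f" "f < \<sigma> 1" "0 < k" "\<And>r. r \<in> {c..f} \<Longrightarrow> k \<le> - a r"
    by (rule continuous_nonneg_bump) (use first a_nonpos[of 0] tau_0 in auto)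
  show ?thesis
  proof (intro exI[of _ \<mu>s] conjI allI impI)
    show "0 < \<mu>s" using \<mu>s1 by simp
    fix \<mu> assume \<mu>: "\<mu>s < \<mu>"
    have \<mu>1: "1 < \<mu>" using \<mu> \<mu>s1 by simp
    interpret M: shooting ?N "weight a \<mu>" g by (rule shooting)
    obtain p q where pq: "M.branch 1 p q 0 (\<sigma> 1)"
    proof (rule M.initial_branch[OF first _ cf(1,2) less_imp_le[OF cf(3)] cf(4)])
      show "weight a \<mu> r \<le> 0" if "r \<in> {0..\<sigma> 1}" for r using neg(3)[of 0 r \<mu>] that \<mu>1 tau_0 by auto
      show "weight a \<mu> r \<le> - k" if r: "r \<in> {c..f}" for r
      proof -
        have "weight a \<mu> r = \<mu> * a r" using neg(2)[of 0 r \<mu>] r cf tau_0 by auto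
        moreover have "1 * k \<le> \<mu> * - a r" by (rule mult_mono) (use cf(4) cf(5)[OF r] \<mu>1 in auto)
        ultimately show ?thesis by simp
      qed
    qed (rule that)
    have wm: "weight a \<mu> r \<le> 0" if "r \<in> {\<tau> m..1}" for r using neg(3)[of m r \<mu>] that \<mu>1 sigma_end by auto
    have "\<exists>F. finite F \<and> card F = 2 ^ (m + 1 - 1) \<and> (\<forall>s\<in>F. p < s \<and> s < q \<and> M.large (1 * s))"
    proof (rule M.many_large[where m = m and \<sigma> = \<sigma> and \<tau> = \<tau>, OF _ sigma_end \<tau>m wm t0(1)])
      show "M.splits (\<tau> (i - 1)) (\<sigma> i) (\<tau> i) (\<sigma> (i + 1))" if "i \<in> {1..m}" for i
        using \<mu>0(2)[OF that] \<mu>s[OF that] \<mu> by simp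
      show "weight a \<mu> r \<le> - (- a 1 / 2)" if r: "r \<in> {t0..1}" for r
      proof -
        have "weight a \<mu> r = \<mu> * a r" using t0(2)[OF r] a_end by (intro weight_nonpos_eq) simp
        moreover have "1 * (- a 1 / 2) \<le> \<mu> * - a r" by (rule mult_mono) (use t0(2)[OF r] a_end \<mu>1 in auto)
        ultimately show ?thesis by simp
      qed
    qed (use pq m_pos a_end tau_0 in auto)
    then obtain F where F: "card F = 2 ^ m" "\<And>d. d \<in> F \<Longrightarrow> M.large d" by auto
    let ?U = "\<lambda>d (z :: real ^ 'n). M.X d (norm z)"
    \<comment> \<open>The value at the centre recovers the initial value, so distinct parameters
      give functions that differ already on the ball. This yields the cardinality as well as the
      injectivity of the restriction.\<close>
    have U0: "?U d 0 = d" for d by simp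
    show "\<exists>S :: (real ^ 'n \<Rightarrow> real) set. card S = 2 ^ m \<and> inj_on (\<lambda>U. restrict U (ball 0 1)) S \<and>
        (\<forall>U\<in>S. positive_radial_large_solution (weight a \<mu>) g U)"
    proof (intro exI[of _ "?U ` F"] conjI ballI)
      have "inj_on ?U F" by (rule inj_onI) (metis U0)
      then show "card (?U ` F) = 2 ^ m" using F(1) by (simp add: card_image)
      show "inj_on (\<lambda>U. restrict U (ball 0 1)) (?U ` F)"
      proof (rule inj_onI)
        fix U V assume UV: "U \<in> ?U ` F" "V \<in> ?U ` F" "restrict U (ball 0 1) = restrict V (ball 0 1)"
        then have "U 0 = V 0" by (metis centre_in_ball restrict_apply' zero_less_one)
        with UV(1,2) U0 show "U = V" by auto
      qed
      fix U assume "U \<in> ?U ` F"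
      then obtain d where d: "d \<in> F" "U = ?U d" by blast
      show "positive_radial_large_solution (weight a \<mu>) g U"
        unfolding d(2) by (rule M.large_imp_solution[OF refl F(2)[OF d(1)] \<tau>m wm])
    qed
  qed
qed

end
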